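(* Let $n\ge1$ be an integer and let $(X,d,\mu)$ be a metric measure space with $n$ independent Alberti representations. Then $\dim_{\mathrm H}\mu\ge n$.
   Context: A metric measure space $(X,d,\mu)$ is a complete and separable metric space $(X,d)$ equipped with a $\sigma$-finite Borel measure $\mu$. Lower Hausdorff dimension of a Borel measure: $\dim_{\mathrm H}\mu=\inf\{\dim_{\mathrm H}B: B\text{ Borel},\ \mu(B)>0\}$ (with $\inf\emptyset=+\infty$). Curve fragments: $\Gamma(X)$ is the set of maps $\gamma\colon\operatorname{dom}\gamma\to X$ where $\operatorname{dom}\gamma\subset[0,1]$ is compact and non-empty (not necessarily connected) and $\gamma$ is 2-biLipschitz, i.e. $\frac12|s-t|\le d(\gamma(s),\gamma(t))\le2|s-t|$. It is metrised by the Hausdorff distance between the graphs $\{(t,\gamma(t)):t\in\operatorname{dom}\gamma\}\subset[0,1]\times X$. Write $\gamma_*\mathcal L^1$ for the push-forward under $\gamma$ of Lebesgue measure restricted to $\operatorname{dom}\gamma$. For a finite Borel measure $\mathbb P$ on $\Gamma(X)$, $\nu(\mathbb P)$ is the Borel measure on $X$ given by $\nu(\mathbb P)(B)=\int_{\Gamma(X)}\gamma_*\mathcal L^1(B)\,d\mathbb P(\gamma)$. An Alberti representation of $(X,d,\mu)$ is a Borel probability measure $\mathbb P$ on $\Gamma(X)$ with $\mu\ll\nu(\mathbb P)$. A cone in $\mathbb R^n$ is a set $C=\{v\in\mathbb R^n:|v\cdot w|\ge\theta\|v\|\}$ with $w\in\mathbb S^{n-1}$, $\theta\in(0,1)$.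 Given a Lipschitz $\phi\colon X\to\mathbb R^n$, $\gamma\in\Gamma(X)$ is a $C$-curve with respect to $\phi$ if there is $\delta>0$ such that $\phi(\gamma(t))-\phi(\gamma(s))\in C$ and $\|\phi(\gamma(t))-\phi(\gamma(s))\|\ge\delta|s-t|$ for all $s,t\in\operatorname{dom}\gamma$. An Alberti representation $\mathbb P$ is a $C$-Alberti representation with respect to $\phi$ if $\mathbb P$-a.e. $\gamma$ is a $C$-curve with respect to $\phi$. Cones $C_1,\dots,C_n\subset\mathbb R^n$ are independent if $\{v_1,\dots,v_n\}$ is linearly independent for every choice of $v_i\in C_i\setminus\{0\}$. Alberti representations $\mathbb P_1,\dots,\mathbb P_n$ of $(X,d,\mu)$ are independent if there exist a Lipschitz $\phi\colon X\to\mathbb R^n$ and independent cones $C_1,\dots,C_n\subset\mathbb R^n$ such that each $\mathbb P_i$ is a $C_i$-Alberti representation with respect to $\phi$. *)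

theory Defs
  imports "HOL-Probability.Probability_Measure"
begin

section \<open>Hausdorff measure and dimension\<close>

text \<open>The term \<open>(diam U)\<^sup>s\<close>, with the conventions \<open>diam(\<emptyset>)\<^sup>s = 0\<close> and \<open>0\<^sup>0 = 1\<close>
  (whereas \<open>0 powr 0 = 0\<close>), so that \<open>s = 0\<close> gives the counting measure.\<close>

definition diam_pow :: "real \<Rightarrow> 'a::metric_space set \<Rightarrow> ennreal" where
  "diam_pow s U = (if U = {} then 0 else if s = 0 then 1 else ennreal (diameter U powr s))"

text \<open>Boundedness of the covering sets is required explicitly, since the real-valued
  \<^const>\<open>diameter\<close> is meaningless on unbounded sets.\<close>

definition hausdorff_content :: "real \<Rightarrow> real \<Rightarrow> 'a::metric_space set \<Rightarrow> ennreal" where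
  "hausdorff_content s \<delta> A =
     (INF U \<in> {U :: nat \<Rightarrow> 'a set. A \<subseteq> (\<Union>i. U i) \<and> (\<forall>i. bounded (U i) \<and> diameter (U i) \<le> \<delta>)}.
        \<Sum>i. diam_pow s (U i))"

definition hausdorff_measure :: "real \<Rightarrow> 'a::metric_space set \<Rightarrow> ennreal" where
  "hausdorff_measure s A = (SUP \<delta> \<in> {0<..}. hausdorff_content s \<delta> A)"

definition hausdorff_dim :: "'a::metric_space set \<Rightarrow> ereal" where
  "hausdorff_dim A = (INF s \<in> {s. 0 \<le> s \<and> hausdorff_measure s A = 0}. ereal s)"

definition lower_hausdorff_dim :: "'a::metric_space measure \<Rightarrow> ereal" where
  "lower_hausdorff_dim \<mu> = (INF B \<in> {B \<in> sets borel. emeasure \<mu> B > 0}. hausdorff_dim B)"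


section \<open>Metric measure spaces\<close>

text \<open>Completeness and separability are carried by the class \<^class>\<open>polish_space\<close> of the
  underlying type.\<close>

definition metric_measure_space :: "'a::polish_space measure \<Rightarrow> bool" where
  "metric_measure_space \<mu> \<longleftrightarrow> sets \<mu> = sets borel \<and> sigma_finite_measure \<mu>"


section \<open>Curve fragments\<close>

text \<open>The set \<open>\<Gamma>(X)\<close>, as a type: a fragment is a partial map from the reals to \<open>X\<close>.\<close>

typedef (overloaded) ('a::metric_space) fragment =
  "{\<gamma> :: real \<rightharpoonup> 'a. dom \<gamma> \<subseteq> {0..1} \<and> compact (dom \<gamma>) \<and> dom \<gamma> \<noteq> {} \<and>
     (\<forall>s\<in>dom \<gamma>. \<forall>t\<in>dom \<gamma>.
        1/2 * \<bar>s - t\<bar> \<le> dist (the (\<gamma> s)) (the (\<gamma> t)) \<and>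
        dist (the (\<gamma> s)) (the (\<gamma> t)) \<le> 2 * \<bar>s - t\<bar>)}"
  by (rule exI[of _ "[0 \<mapsto> undefined]"]) auto

definition frag_dom :: "'a::metric_space fragment \<Rightarrow> real set" where
  "frag_dom \<gamma> = dom (Rep_fragment \<gamma>)"

definition frag_map :: "'a::metric_space fragment \<Rightarrow> real \<Rightarrow> 'a" where
  "frag_map \<gamma> t = the (Rep_fragment \<gamma> t)"

definition frag_graph :: "'a::metric_space fragment \<Rightarrow> (real \<times> 'a) set" where
  "frag_graph \<gamma> = {(t, frag_map \<gamma> t) | t. t \<in> frag_dom \<gamma>}"

text \<open>Intended for non-empty bounded sets, where the suprema are of bounded sets of reals.\<close>

definition hausdorff_dist :: "'a::metric_space set \<Rightarrow> 'a set \<Rightarrow> real" where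
  "hausdorff_dist A B = max (SUP x\<in>A. infdist x B) (SUP y\<in>B. infdist y A)"

lemma bdd_above_infdist:
  assumes "bounded A" "B \<noteq> {}"
  shows "bdd_above ((\<lambda>x. infdist x B) ` A)"
proof -
  obtain b where b: "b \<in> B" using assms by auto
  obtain e where e: "\<And>x. x \<in> A \<Longrightarrow> dist b x \<le> e"
    using assms(1) by (metis bounded_any_center)
  have "infdist x B \<le> e" if "x \<in> A" for x
    using infdist_le[OF b, of x] e[OF that] by (simp add: dist_commute)
  then show ?thesis by (auto intro!: bdd_aboveI[where M = e])
qed

lemma infdist_le_hausdorff_dist:
  assumes "bounded A" "B \<noteq> {}" "x \<in> A"
  shows "infdist x B \<le> hausdorff_dist A B"
  unfolding hausdorff_dist_def
  by (rule max.coboundedI1) (rule cSUP_upper[OF assms(3) bdd_above_infdist[OF assms(1,2)]])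

lemma hausdorff_dist_commute: "hausdorff_dist A B = hausdorff_dist B A"
  unfolding hausdorff_dist_def by (rule max.commute)

lemma hausdorff_dist_le:
  assumes "A \<noteq> {}" "B \<noteq> {}"
    and "\<And>x. x \<in> A \<Longrightarrow> infdist x B \<le> e" "\<And>y. y \<in> B \<Longrightarrow> infdist y A \<le> e"
  shows "hausdorff_dist A B \<le> e"
  unfolding hausdorff_dist_def using assms by (auto intro!: cSUP_least)

lemma infdist_triangle_hausdorff:
  assumes "bounded A" "bounded B" "bounded C" "A \<noteq> {}" "B \<noteq> {}" "C \<noteq> {}" "x \<in> A"
  shows "infdist x C \<le> hausdorff_dist A B + hausdorff_dist B C"
proof -
  have "infdist x C - hausdorff_dist B C \<le> dist x b" if "b \<in> B" for b
    using infdist_triangle[of x C b] infdist_le_hausdorff_dist[OF assms(2,6) that] by linarith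
  then have "infdist x C - hausdorff_dist B C \<le> infdist x B"
    unfolding infdist_notempty[OF assms(5)] by (rule cINF_greatest[OF assms(5)])
  then show ?thesis
    using infdist_le_hausdorff_dist[OF assms(1,5,7)] by linarith
qed

lemma hausdorff_dist_triangle:
  assumes "bounded A" "bounded B" "bounded C" "A \<noteq> {}" "B \<noteq> {}" "C \<noteq> {}"
  shows "hausdorff_dist A C \<le> hausdorff_dist A B + hausdorff_dist B C"
proof (rule hausdorff_dist_le[OF assms(4,6)])
  show "infdist x C \<le> hausdorff_dist A B + hausdorff_dist B C" if "x \<in> A" for x
    by (rule infdist_triangle_hausdorff[OF assms that])
  show "infdist y A \<le> hausdorff_dist A B + hausdorff_dist B C" if "y \<in> C" for y
    using infdist_triangle_hausdorff[OF assms(3,2,1,6,5,4) that]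
    by (simp add: hausdorff_dist_commute[of C B] hausdorff_dist_commute[of B A])
qed

lemma frag_dom_subset: "frag_dom \<gamma> \<subseteq> {0..1}"
  and compact_frag_dom: "compact (frag_dom \<gamma>)"
  and frag_dom_nonempty: "frag_dom \<gamma> \<noteq> {}"
  and frag_bilipschitz: "s \<in> frag_dom \<gamma> \<Longrightarrow> t \<in> frag_dom \<gamma> \<Longrightarrow>
     1/2 * \<bar>s - t\<bar> \<le> dist (frag_map \<gamma> s) (frag_map \<gamma> t) \<and>
     dist (frag_map \<gamma> s) (frag_map \<gamma> t) \<le> 2 * \<bar>s - t\<bar>"
  using Rep_fragment[of \<gamma>] by (auto simp: frag_dom_def frag_map_def)

lemma continuous_on_frag_map: "continuous_on (frag_dom \<gamma>) (frag_map \<gamma>)"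
  by (rule lipschitz_on_continuous_on[of 2], rule lipschitz_onI)
    (use frag_bilipschitz in \<open>auto simp: dist_real_def\<close>)

lemma compact_frag_graph: "compact (frag_graph \<gamma>)"
proof -
  have "frag_graph \<gamma> = (\<lambda>t. (t, frag_map \<gamma> t)) ` frag_dom \<gamma>"
    by (auto simp: frag_graph_def)
  then show ?thesis
    by (auto intro!: compact_continuous_image continuous_intros
        continuous_on_frag_map compact_frag_dom)
qed

lemma bounded_frag_graph: "bounded (frag_graph \<gamma>)"
  by (rule compact_imp_bounded[OF compact_frag_graph])

lemma frag_graph_nonempty: "frag_graph \<gamma> \<noteq> {}"
  using frag_dom_nonempty by (auto simp: frag_graph_def)

lemma frag_graph_inject: "frag_graph \<gamma> = frag_graph \<eta> \<longleftrightarrow> \<gamma> = \<eta>"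
proof
  assume eq: "frag_graph \<gamma> = frag_graph \<eta>"
  have *: "x = y \<longleftrightarrow> (\<forall>t v. x t = Some v \<longleftrightarrow> y t = Some v)" for x y :: "real \<rightharpoonup> 'a"
    by (metis ext not_None_eq option.exhaust)
  have "(t, v) \<in> frag_graph \<xi> \<longleftrightarrow> Rep_fragment \<xi> t = Some v" for \<xi> :: "'a fragment" and t v
    by (force simp: frag_graph_def frag_dom_def frag_map_def)
  then have "Rep_fragment \<gamma> = Rep_fragment \<eta>"
    unfolding * using eq by metis
  then show "\<gamma> = \<eta>" by (simp add: Rep_fragment_inject)
qed simp

text \<open>\<^typ>\<open>real \<times> 'a\<close> carries the library's Euclidean product metric, so that the topology
  (hence the Borel structure) on fragments is the one of Hausdorff convergence of graphs.\<close>

instantiation fragment :: (metric_space) metric_space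
begin

definition dist_fragment :: "'a fragment \<Rightarrow> 'a fragment \<Rightarrow> real" where
  "dist_fragment \<gamma> \<eta> = hausdorff_dist (frag_graph \<gamma>) (frag_graph \<eta>)"

definition uniformity_fragment :: "('a fragment \<times> 'a fragment) filter" where
  "uniformity_fragment = (INF e\<in>{0 <..}. principal {(x, y). dist x y < e})"

definition open_fragment :: "'a fragment set \<Rightarrow> bool" where
  "open_fragment U \<longleftrightarrow> (\<forall>x\<in>U. eventually (\<lambda>(x', y). x' = x \<longrightarrow> y \<in> U) uniformity)"

instance
proof
  fix x y z :: "'a fragment"
  show "dist x y = 0 \<longleftrightarrow> x = y"
  proof
    assume 0: "dist x y = 0"
    have sub: "frag_graph a \<subseteq> frag_graph b" if "dist a b = 0" for a b :: "'a fragment"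
    proof
      fix p assume "p \<in> frag_graph a"
      then have "infdist p (frag_graph b) \<le> 0"
        using infdist_le_hausdorff_dist[OF bounded_frag_graph frag_graph_nonempty] that
        unfolding dist_fragment_def by metis
      then have "infdist p (frag_graph b) = 0"
        using infdist_nonneg[of p "frag_graph b"] by linarith
      then show "p \<in> frag_graph b"
        using in_closed_iff_infdist_zero[OF compact_imp_closed[OF compact_frag_graph]
            frag_graph_nonempty] by blast
    qed
    have "dist y x = 0"
      using 0 by (simp add: dist_fragment_def hausdorff_dist_commute)
    then show "x = y" using sub 0 frag_graph_inject by blast
  next
    assume "x = y"
    moreover have "hausdorff_dist (frag_graph x) (frag_graph x) = 0"
      using frag_graph_nonempty[of x] by (simp add: hausdorff_dist_def cong: SUP_cong_simp)
    ultimately show "dist x y = 0" by (simp add: dist_fragment_def)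
  qed
  show "dist x y \<le> dist x z + dist y z"
    unfolding dist_fragment_def hausdorff_dist_commute[of "frag_graph y" "frag_graph z"]
    by (intro hausdorff_dist_triangle bounded_frag_graph frag_graph_nonempty)
qed (simp_all add: uniformity_fragment_def open_fragment_def)

end


section \<open>Alberti representations\<close>

text \<open>The push-forward under \<open>\<gamma>\<close> of Lebesgue measure restricted to \<open>dom \<gamma>\<close>.\<close>

definition frag_push :: "'a::metric_space fragment \<Rightarrow> 'a measure" where
  "frag_push \<gamma> = distr (restrict_space lborel (frag_dom \<gamma>)) borel (frag_map \<gamma>)"

definition nu :: "'a::metric_space fragment measure \<Rightarrow> 'a measure" where
  "nu P = measure_of UNIV (sets borel) (\<lambda>B. \<integral>\<^sup>+ \<gamma>. emeasure (frag_push \<gamma>) B \<partial>P)"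

lemma sets_frag_push [simp]: "sets (frag_push \<gamma>) = sets borel"
  by (simp add: frag_push_def)

lemma sets_nu [simp]: "sets (nu P) = sets (borel :: 'a::metric_space measure)"
  using sets.sigma_sets_eq[of "borel :: 'a::metric_space measure"] by (simp add: nu_def)

lemma emeasure_frag_push:
  assumes "B \<in> sets borel"
  shows "emeasure (frag_push \<gamma>) B = emeasure lborel {t \<in> frag_dom \<gamma>. frag_map \<gamma> t \<in> B}"
proof -
  have d: "frag_dom \<gamma> \<in> sets lborel"
    using borel_compact[OF compact_frag_dom[of \<gamma>]] by simp
  have m: "frag_map \<gamma> \<in> measurable (restrict_space lborel (frag_dom \<gamma>)) borel"
    using borel_measurable_continuous_on_restrict[OF continuous_on_frag_map[of \<gamma>]]
    by (simp cong: measurable_cong_sets add: sets_restrict_space)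
  have s: "space (restrict_space lborel (frag_dom \<gamma>)) = frag_dom \<gamma>"
    by (simp add: space_restrict_space)
  have "emeasure (frag_push \<gamma>) B =
      emeasure (restrict_space lborel (frag_dom \<gamma>)) (frag_map \<gamma> -` B \<inter> frag_dom \<gamma>)"
    using emeasure_distr[OF m assms] by (simp add: frag_push_def s)
  also have "\<dots> = emeasure lborel (frag_map \<gamma> -` B \<inter> frag_dom \<gamma>)"
    using d by (intro emeasure_restrict_space) auto
  also have "frag_map \<gamma> -` B \<inter> frag_dom \<gamma> = {t \<in> frag_dom \<gamma>. frag_map \<gamma> t \<in> B}" by auto
  finally show ?thesis .
qed

lemma emeasure_frag_push_UNIV_le: "emeasure (frag_push \<gamma>) UNIV \<le> 1"
proof -
  have "emeasure lborel (frag_dom \<gamma>) \<le> emeasure lborel {0..1::real}"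
    by (intro emeasure_mono frag_dom_subset) simp
  then show ?thesis by (simp add: emeasure_frag_push)
qed


lemma compact_closed_gap:
  fixes S T :: "'b::metric_space set"
  assumes "compact S" "closed T" "S \<inter> T = {}"
  shows "\<exists>d>0. \<forall>x\<in>S. \<forall>y\<in>T. d \<le> dist x y"
proof (cases "S = {} \<or> T = {}")
  case True
  then show ?thesis by (auto intro: exI[of _ 1])
next
  case False
  have "continuous_on S (\<lambda>x. infdist x T)" by (intro continuous_intros)
  then obtain x where x: "x \<in> S" "\<And>y. y \<in> S \<Longrightarrow> infdist x T \<le> infdist y T"
    using continuous_attains_inf[OF assms(1)] False by metis
  have "0 < infdist x T"
    using infdist_pos_not_in_closed[OF assms(2), of x] x(1) assms(3) False by blast
  moreover have "infdist x T \<le> dist y z" if "y \<in> S" "z \<in> T" for y z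
    using x(2)[OF that(1)] infdist_le[OF that(2), of y] by linarith
  ultimately show ?thesis by blast
qed

lemma measurable_emeasure_frag_push_closed:
  fixes F :: "'a::metric_space set"
  assumes "closed F"
  shows "(\<lambda>\<gamma>. emeasure (frag_push \<gamma>) F) \<in> borel_measurable borel"
proof (rule borel_measurableI_less)
  fix c :: ennreal
  have "open {\<gamma>. emeasure (frag_push \<gamma>) F < c}"
    unfolding open_dist
  proof (intro ballI)
    fix \<gamma> :: "'a fragment" assume "\<gamma> \<in> {\<gamma>. emeasure (frag_push \<gamma>) F < c}"
    define K where "K = {t \<in> frag_dom \<gamma>. frag_map \<gamma> t \<in> F}"
    have F: "F \<in> sets borel" using assms by simp
    have lt: "emeasure lborel K < c"
      using \<open>\<gamma> \<in> _\<close> by (simp add: emeasure_frag_push[OF F] K_def)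
    have "K = frag_dom \<gamma> \<inter> frag_map \<gamma> -` F" by (auto simp: K_def)
    moreover have "closed (frag_dom \<gamma> \<inter> frag_map \<gamma> -` F)"
      using assms compact_imp_closed[OF compact_frag_dom] continuous_on_frag_map
      by (intro continuous_closed_preimage)
    ultimately have K: "K \<in> sets borel" by simp
    have K1: "emeasure lborel K \<noteq> top"
      using lt by auto
    obtain e where e: "0 < e" "emeasure lborel K + ennreal e < c"
    proof (cases c)
      case (real r)
      obtain k where k: "emeasure lborel K = ennreal k" "0 \<le> k"
        using K1 by (cases "emeasure lborel K") auto
      have "k < r" using lt k real by (simp add: ennreal_less_iff)
      then have "emeasure lborel K + ennreal ((r - k) / 2) < c"
        using k real by (simp add: ennreal_less_iff field_simps flip: ennreal_plus)
      then show ?thesis using that[of "(r - k) / 2"] \<open>k < r\<close> by simp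
    next
      case top
      then show ?thesis using that[of 1] K1 by (simp add: less_top)
    qed
    obtain U where U: "open U" "K \<subseteq> U" "emeasure lborel (U - K) < ennreal e"
      using outer_regular_lborel[OF K e(1)] by blast
    have "emeasure lborel U = emeasure lborel (K \<union> (U - K))"
      using U by (simp add: Un_absorb1)
    also have "\<dots> \<le> emeasure lborel K + emeasure lborel (U - K)"
      using K U by (intro emeasure_subadditive) auto
    also have "\<dots> \<le> emeasure lborel K + ennreal e"
      using U by (intro add_left_mono) simp
    finally have Uc: "emeasure lborel U < c" using e by simp
    have "frag_graph \<gamma> \<inter> (- U) \<times> F = {}"
      using U by (auto simp: frag_graph_def K_def)
    moreover have "closed ((- U) \<times> F)" using U assms by (intro closed_Times) auto
    ultimately obtain d where d: "d > 0" "\<And>p q. p \<in> frag_graph \<gamma> \<Longrightarrow> q \<in> (- U) \<times> F \<Longrightarrow> d \<le> dist p q"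
      using compact_closed_gap[OF compact_frag_graph] by metis
    have "emeasure (frag_push \<eta>) F < c" if "dist \<eta> \<gamma> < d" for \<eta> :: "'a fragment"
    proof -
      have "{t \<in> frag_dom \<eta>. frag_map \<eta> t \<in> F} \<subseteq> U"
      proof (rule ccontr)
        assume "\<not> ?thesis"
        then obtain q where q: "q \<in> frag_graph \<eta>" "q \<in> (- U) \<times> F"
          by (force simp: frag_graph_def)
        have "infdist q (frag_graph \<gamma>) < d"
          using infdist_le_hausdorff_dist[OF bounded_frag_graph frag_graph_nonempty q(1), of \<gamma>] that
          by (simp add: dist_fragment_def)
        moreover have "d \<le> infdist q (frag_graph \<gamma>)"
          unfolding infdist_notempty[OF frag_graph_nonempty]
          using d(2)[OF _ q(2)] by (intro cINF_greatest[OF frag_graph_nonempty]) (simp add: dist_commute)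
        ultimately show False by simp
      qed
      then have "emeasure (frag_push \<eta>) F \<le> emeasure lborel U"
        unfolding emeasure_frag_push[OF F] using U by (intro emeasure_mono) auto
      then show ?thesis using Uc by simp
    qed
    then show "\<exists>d>0. \<forall>\<eta>. dist \<eta> \<gamma> < d \<longrightarrow> \<eta> \<in> {\<gamma>. emeasure (frag_push \<gamma>) F < c}"
      using d(1) by blast
  qed
  then show "{\<gamma> \<in> space borel. emeasure (frag_push \<gamma>) F < c} \<in> sets borel" by simp
qed

lemma measurable_emeasure_frag_push:
  fixes B :: "'a::metric_space set"
  assumes "B \<in> sets borel"
  shows "(\<lambda>\<gamma>. emeasure (frag_push \<gamma>) B) \<in> borel_measurable borel"
proof -
  have sp: "space (frag_push \<gamma>) = UNIV" for \<gamma> :: "'a fragment"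
    by (simp add: frag_push_def)
  have eq: "sets borel = sigma_sets UNIV {F :: 'a set. closed F}"
    by (simp add: borel_eq_closed)
  have "Int_stable {F :: 'a set. closed F}" by (auto simp: Int_stable_def)
  moreover have "{F :: 'a set. closed F} \<subseteq> Pow UNIV" by simp
  moreover have "B \<in> sigma_sets UNIV {F. closed F}" using assms eq by simp
  ultimately show ?thesis
  proof (induction rule: sigma_sets_induct_disjoint)
    case (basic A)
    then show ?case by (simp add: measurable_emeasure_frag_push_closed)
  next
    case empty
    show ?case by simp
  next
    case (compl A)
    have "emeasure (frag_push \<gamma>) (UNIV - A) =
        emeasure (frag_push \<gamma>) UNIV - emeasure (frag_push \<gamma>) A" for \<gamma> :: "'a fragment"
    proof -
      have "emeasure (frag_push \<gamma>) A \<le> emeasure (frag_push \<gamma>) UNIV"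
        by (intro emeasure_mono) auto
      also have "\<dots> < top"
        using emeasure_frag_push_UNIV_le[of \<gamma>] by (auto intro: le_less_trans)
      finally show ?thesis
        using compl(1) eq by (intro emeasure_Diff) auto
    qed
    then show ?case
      using compl(2) measurable_emeasure_frag_push_closed[OF closed_UNIV]
      by (auto intro: borel_measurable_minus_ennreal)
  next
    case (union A)
    have "emeasure (frag_push \<gamma>) (\<Union>i. A i) = (\<Sum>i. emeasure (frag_push \<gamma>) (A i))"
      for \<gamma> :: "'a fragment"
      using union(1,2) eq by (intro suminf_emeasure[symmetric]) auto
    then show ?case using union(3) by simp
  qed
qed

text \<open>\<^const>\<open>measure_of\<close> yields the zero measure unless the given set function is countably
  additive; the next lemma rules this out.\<close>

lemma emeasure_nu:
  fixes P :: "'a::metric_space fragment measure"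
  assumes P: "sets P = sets borel" and "B \<in> sets borel"
  shows "emeasure (nu P) B = (\<integral>\<^sup>+ \<gamma>. emeasure (frag_push \<gamma>) B \<partial>P)"
proof (rule emeasure_measure_of[OF nu_def])
  show "sets (borel :: 'a measure) \<subseteq> Pow UNIV" by simp
  show "B \<in> sets (nu P)" using assms by simp
  show "positive (sets (nu P)) (\<lambda>B. \<integral>\<^sup>+ \<gamma>. emeasure (frag_push \<gamma>) B \<partial>P)"
    by (simp add: positive_def)
  show "countably_additive (sets (nu P)) (\<lambda>B. \<integral>\<^sup>+ \<gamma>. emeasure (frag_push \<gamma>) B \<partial>P)"
  proof (rule countably_additiveI)
    fix A :: "nat \<Rightarrow> 'a set"
    assume A: "range A \<subseteq> sets (nu P)" "disjoint_family A"
    have "(\<lambda>\<gamma>. emeasure (frag_push \<gamma>) (A i)) \<in> borel_measurable P" for i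
      using measurable_emeasure_frag_push[of "A i"] A(1)
      by (simp cong: measurable_cong_sets add: P image_subset_iff)
    then have "(\<Sum>i. \<integral>\<^sup>+ \<gamma>. emeasure (frag_push \<gamma>) (A i) \<partial>P) =
        (\<integral>\<^sup>+ \<gamma>. (\<Sum>i. emeasure (frag_push \<gamma>) (A i)) \<partial>P)"
      by (rule nn_integral_suminf[symmetric])
    also have "\<dots> = (\<integral>\<^sup>+ \<gamma>. emeasure (frag_push \<gamma>) (\<Union>i. A i) \<partial>P)"
      using A by (intro nn_integral_cong suminf_emeasure) auto
    finally show "(\<Sum>i. \<integral>\<^sup>+ \<gamma>. emeasure (frag_push \<gamma>) (A i) \<partial>P) =
        (\<integral>\<^sup>+ \<gamma>. emeasure (frag_push \<gamma>) (\<Union>i. A i) \<partial>P)" .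
  qed
qed

definition alberti_representation :: "'a::metric_space measure \<Rightarrow> 'a fragment measure \<Rightarrow> bool" where
  "alberti_representation \<mu> P \<longleftrightarrow>
     sets P = sets borel \<and> prob_space P \<and> absolutely_continuous (nu P) \<mu>"

definition is_cone :: "(real ^ 'n) set \<Rightarrow> bool" where
  "is_cone C \<longleftrightarrow>
     (\<exists>w \<theta>. norm w = 1 \<and> 0 < \<theta> \<and> \<theta> < 1 \<and> C = {v. \<bar>v \<bullet> w\<bar> \<ge> \<theta> * norm v})"

definition C_curve ::
  "('a::metric_space \<Rightarrow> real ^ 'n) \<Rightarrow> (real ^ 'n) set \<Rightarrow> 'a fragment \<Rightarrow> bool" where
  "C_curve \<phi> C \<gamma> \<longleftrightarrow>
     (\<exists>\<delta>>0. \<forall>s\<in>frag_dom \<gamma>. \<forall>t\<in>frag_dom \<gamma>.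
        \<phi> (frag_map \<gamma> t) - \<phi> (frag_map \<gamma> s) \<in> C \<and>
        norm (\<phi> (frag_map \<gamma> t) - \<phi> (frag_map \<gamma> s)) \<ge> \<delta> * \<bar>s - t\<bar>)"

definition C_alberti_representation ::
  "'a::metric_space measure \<Rightarrow> ('a \<Rightarrow> real ^ 'n) \<Rightarrow> (real ^ 'n) set \<Rightarrow> 'a fragment measure \<Rightarrow> bool"
  where
  "C_alberti_representation \<mu> \<phi> C P \<longleftrightarrow>
     alberti_representation \<mu> P \<and> (AE \<gamma> in P. C_curve \<phi> C \<gamma>)"

text \<open>Linear independence is that of the family \<open>v\<^sub>1, \<dots>, v\<^sub>n\<close>, so the vectors must also be
  distinct: \<^const>\<open>independent\<close> alone only speaks about the set of their values.\<close>

definition independent_cones :: "('i \<Rightarrow> (real ^ 'n) set) \<Rightarrow> bool" where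
  "independent_cones C \<longleftrightarrow>
     (\<forall>v. (\<forall>i. v i \<in> C i - {0}) \<longrightarrow> inj v \<and> independent (range v))"

text \<open>The \<open>n\<close> representations and cones are indexed by the same finite type \<^typ>\<open>'n\<close> as the
  coordinates of \<open>\<real>\<^sup>n\<close>.\<close>

definition independent_alberti_representations ::
  "'a::metric_space measure \<Rightarrow> ('n::finite \<Rightarrow> 'a fragment measure) \<Rightarrow> bool" where
  "independent_alberti_representations \<mu> P \<longleftrightarrow>
     (\<exists>(\<phi> :: 'a \<Rightarrow> real ^ 'n) C.
        (\<exists>L. L-lipschitz_on UNIV \<phi>) \<and>
        (\<forall>i. is_cone (C i)) \<and> independent_cones C \<and>
        (\<forall>i. C_alberti_representation \<mu> \<phi> (C i) (P i)))"

end

theory Submission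
  imports Defs "HOL-Analysis.Analysis" "HOL-Real_Asymp.Real_Asymp"
begin

text \<open>Push everything forward to \<open>\<real>\<^sup>n\<close> by \<open>\<phi>\<close>. Lipschitz curves are differentiable almost everywhere,
  so each representation splits into countably many pieces on which the curves move in an almost
  constant direction \<open>u\<^sub>i \<in> C\<^sub>i\<close>, with relative error \<open>\<eta>\<close> as small as we please. Near a density point
  of a suitable set \<open>S\<close> of positive measure, such curves transport a fixed fraction of the mass of a
  small ball to any ball displaced by a multiple of \<open>u\<^sub>i\<close>, as long as the displacement is at most
  about \<open>1 / \<eta>\<close> radii; the part of the representation that lives outside \<open>S\<close> is negligible there by
  a Vitali covering argument. Transporting along \<open>u\<^sub>1, \<dots>, u\<^sub>n\<close> in turn fills a grid of \<open>N\<^sup>n\<close> disjoint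
  balls of radius comparable to \<open>b\<close> inside a ball of radius \<open>c N b\<close>. The loss is a constant independent
  of \<open>N\<close>, so for large \<open>N\<close> the mass of the ball of radius \<open>b\<close> is at most \<open>T\<^sup>-\<^sup>s\<close> times that of radius
  \<open>T b\<close> for any prescribed \<open>s < n\<close>, where \<open>T = 5 c N\<close>. Iterating over scales gives a power bound, and
  the mass distribution principle concludes. No absolute continuity with respect to Lebesgue measure
  is needed.\<close>

section \<open>Densities and differentiability\<close>

text \<open>The order in which constants are chosen carries the argument. The lower bound
  \<open>\<kappa>\<close> for combinations of unit vectors from the cones is uniform in the vectors,
  so \<open>c\<close> and then \<open>N\<close> are fixed from \<open>s\<close> and the cones,
  before any direction is known. Next comes \<open>\<eta>\<close>, small enough that a curve
  displaced by a distance of order \<open>N * b\<close> deviates by at most half a radius. Only then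
  are directions and the set \<open>S\<close> selected. The constants \<open>K i\<close> in front of
  the error terms depend on this selection and are uncontrolled, but the density argument absorbs
  them through a \<open>\<tau>\<close> chosen last. What must stay bounded is the factor 128 of a
  single transport: the selected density level enters it once from below and once from above, and
  cancels. The gap between \<open>s\<close> and the dimension leaves a positive power of
  \<open>N\<close> to pay for the \<open>n\<close>-th power of 128. Masses of concentric balls
  cannot be compared in the direction from large to small, so the radius is allowed to triple in
  each transport; the grid spacing makes room for this.\<close>

text \<open>Subadditivity in the count-space form that \<open>emeasure_UN_countable\<close> has for
  disjoint unions, so that a covering by dilated balls can be compared term by term with the
  disjoint balls.\<close>

lemma emeasure_UN_le_count_space:
  assumes "countable I" and X: "\<And>i. i \<in> I \<Longrightarrow> X i \<in> sets M"
  shows "emeasure M (\<Union>i\<in>I. X i) \<le> (\<integral>\<^sup>+i. emeasure M (X i) \<partial>count_space I)"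
proof -
  have [measurable]: "(\<Union>i\<in>I. X i) \<in> sets M"
    using assms by (intro sets.countable_UN') auto
  have "emeasure M (\<Union>i\<in>I. X i) = (\<integral>\<^sup>+x. indicator (\<Union>i\<in>I. X i) x \<partial>M)"
    by simp
  also have "\<dots> \<le> (\<integral>\<^sup>+x. \<integral>\<^sup>+i. indicator (X i) x \<partial>count_space I \<partial>M)"
  proof (rule nn_integral_mono)
    fix x
    show "indicator (\<Union>i\<in>I. X i) x \<le> (\<integral>\<^sup>+i. indicator (X i) x \<partial>count_space I)"
    proof (cases "x \<in> (\<Union>i\<in>I. X i)")
      case True
      then obtain j where j: "j \<in> I" "x \<in> X j" by auto
      have "(1::ennreal) = (\<integral>\<^sup>+i. indicator {j} i \<partial>(count_space I))"
        using j by (subst nn_integral_indicator) auto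
      also have "\<dots> \<le> (\<integral>\<^sup>+i. indicator (X i) x \<partial>count_space I)"
        using j by (intro nn_integral_mono) (auto simp: indicator_def)
      finally show ?thesis using True by simp
    qed simp
  qed
  also have "\<dots> = (\<integral>\<^sup>+i. \<integral>\<^sup>+x. indicator (X i) x \<partial>M \<partial>count_space I)"
    using assms by (subst nn_integral_count_space_nn_integral) auto
  also have "\<dots> = (\<integral>\<^sup>+i. emeasure M (X i) \<partial>count_space I)"
    using X by (intro nn_integral_cong) simp
  finally show ?thesis .
qed

text \<open>The factor 5 lets the elementary Vitali covering lemma replace Besicovitch's theorem: \<open>\<sigma>\<close> need
  not be doubling.\<close>

proposition vitali_density:
  fixes \<nu> \<sigma> :: "'a::euclidean_space measure"
  assumes \<nu>: "sets \<nu> = sets borel" "finite_measure \<nu>" and \<sigma>: "sets \<sigma> = sets borel"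
    and S: "S \<in> sets borel" and "0 < \<tau>"
  shows "\<exists>N\<in>null_sets \<sigma>. \<forall>y\<in>S - N. \<exists>r0>0. \<forall>r. 0 < r \<and> r < r0 \<longrightarrow>
     emeasure \<nu> (cball y r - S) \<le> ennreal \<tau> * emeasure \<sigma> (S \<inter> cball y (5 * r))"
proof -
  interpret \<nu>: finite_measure \<nu> by fact
  have sp: "space \<nu> = UNIV" using \<nu>(1) by (metis sets_eq_imp_space_eq space_borel)
  define e where "e = density \<nu> (indicator (- S))"
  have S': "- S \<in> sets \<nu>" using S \<nu>(1) by auto
  have e: "emeasure e A = emeasure \<nu> (A - S)" if "A \<in> sets borel" for A
    using emeasure_restricted[OF S', of A] that \<nu>(1) by (simp add: e_def Diff_eq Int_commute)
  have se: "sets e = sets borel" "space e = UNIV" by (auto simp: e_def \<nu> sp)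
  have fe: "emeasure e (space e) \<noteq> \<infinity>" by (simp add: se e)
  define bad where "bad y r \<longleftrightarrow> \<not> (emeasure \<nu> (cball y r - S) \<le> ennreal \<tau> * emeasure \<sigma> (S \<inter> cball y (5 * r)))" for y r
  define Z where "Z = {y\<in>S. \<forall>r0>0. \<exists>r. 0 < r \<and> r < r0 \<and> bad y r}"
  \<comment> \<open>\<open>Z\<close> need not be Borel, so it is caught in Borel sets of arbitrarily
    small \<open>\<sigma>\<close>-mass.\<close>
  have "\<exists>N\<in>sets borel. Z \<subseteq> N \<and> emeasure \<sigma> N \<le> ennreal (1 / real (Suc k))" for k
  proof -
    \<comment> \<open>\<open>e\<close> vanishes on \<open>S\<close>, so outer regularity yields open
      neighbourhoods of \<open>S\<close> whose \<open>\<nu>\<close>-mass outside \<open>S\<close> is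
      as small as desired.\<close>
    have "emeasure e S = (INF U \<in> {U. S \<subseteq> U \<and> open U}. emeasure e U)"
      by (rule outer_regular[OF se(1) fe S])
    moreover have "emeasure e S < ennreal (\<tau> / real (Suc k))" using \<open>0 < \<tau>\<close> by (simp add: e[OF S])
    ultimately obtain U where U: "S \<subseteq> U" "open U" "emeasure e U < ennreal (\<tau> / real (Suc k))"
      by (auto simp: INF_less_iff)
    define K where "K = {(y, r). y \<in> Z \<and> 0 < r \<and> r \<le> 1 \<and> cball y r \<subseteq> U \<and> bad y r}"
    have cov: "Z \<subseteq> (\<Union>i\<in>K. cball (fst i) (snd i))"
    proof
      fix y assume y: "y \<in> Z"
      then obtain d where d: "d > 0" "cball y d \<subseteq> U"
        using U(1) U(2)[unfolded open_contains_cball] by (auto simp: Z_def) (metis subsetD that)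
      then obtain r where r: "0 < r" "r < min d 1" "bad y r" using y unfolding Z_def
        by (auto dest!: spec[of _ "min d 1"])
      then have "(y, r) \<in> K" using d y subset_cball[of r d y] by (auto simp: K_def)
      then show "y \<in> (\<Union>i\<in>K. cball (fst i) (snd i))" using r by (intro UN_I[of "(y, r)"]) auto
    qed
    have KD: "0 < snd i \<and> snd i \<le> 1" if "i \<in> K" for i using that by (auto simp: K_def)
    obtain C where C: "countable C" "C \<subseteq> K"
      "pairwise (\<lambda>i j. disjnt (cball (fst i) (snd i)) (cball (fst j) (snd j))) C"
      "Z \<subseteq> (\<Union>i\<in>C. cball (fst i) (5 * snd i))"
      by (rule Vitali_covering_lemma_cballs[OF cov KD])
    have CU: "cball (fst i) (snd i) \<subseteq> U" if "i \<in> C" for i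
      using that C(2) by (force simp: K_def)
    define N where "N = (\<Union>i\<in>C. S \<inter> cball (fst i) (5 * snd i))"
    \<comment> \<open>The inequality that fails for a bad ball bounds the
      \<open>\<sigma>\<close>-mass of its dilate by the \<open>e\<close>-mass of the ball itself;
      the balls are disjoint and lie in \<open>U\<close>, so these masses sum to at most that of
      \<open>U\<close>.\<close>
    have "ennreal \<tau> * emeasure \<sigma> N \<le> ennreal \<tau> * (\<integral>\<^sup>+i. emeasure \<sigma> (S \<inter> cball (fst i) (5 * snd i)) \<partial>count_space C)"
      unfolding N_def using C S \<sigma> by (intro mult_left_mono emeasure_UN_le_count_space) auto
    also have "\<dots> = (\<integral>\<^sup>+i. ennreal \<tau> * emeasure \<sigma> (S \<inter> cball (fst i) (5 * snd i)) \<partial>count_space C)"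
      by (simp add: nn_integral_cmult)
    also have "\<dots> \<le> (\<integral>\<^sup>+i. emeasure e (cball (fst i) (snd i)) \<partial>count_space C)"
      using C(2) by (intro nn_integral_mono) (auto simp: K_def bad_def e)
    also have "\<dots> = emeasure e (\<Union>i\<in>C. cball (fst i) (snd i))"
      using C by (intro emeasure_UN_countable[symmetric])
        (auto simp: se disjoint_family_on_def pairwise_def disjnt_def)
    also have "\<dots> \<le> emeasure e U"
      using CU U(2) by (intro emeasure_mono UN_least) (auto simp: se)
    also have "\<dots> \<le> ennreal \<tau> * ennreal (1 / real (Suc k))"
      using U(3) \<open>0 < \<tau>\<close> by (simp flip: ennreal_mult)
    finally have "emeasure \<sigma> N \<le> ennreal (1 / real (Suc k))"
      using \<open>0 < \<tau>\<close> by (simp add: ennreal_mult_le_mult_iff)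
    moreover have "Z \<subseteq> N" using C(4) by (auto simp: N_def Z_def)
    moreover have "N \<in> sets borel" unfolding N_def using C S by (intro sets.countable_UN') auto
    ultimately show ?thesis by blast
  qed
  then obtain N where N: "\<And>k. N k \<in> sets borel" "\<And>k. Z \<subseteq> N k"
    "\<And>k. emeasure \<sigma> (N k) \<le> ennreal (1 / real (Suc k))" by metis
  have "emeasure \<sigma> (\<Inter>k. N k) \<le> ennreal (1 / real (Suc k))" for k
    using N by (intro order_trans[OF emeasure_mono N(3)]) (auto simp: \<sigma>)
  then have "emeasure \<sigma> (\<Inter>k. N k) = 0"
  proof -
    assume *: "\<And>k. emeasure \<sigma> (\<Inter>k. N k) \<le> ennreal (1 / real (Suc k))"
    have "(\<lambda>k. ennreal (1 / real (Suc k))) \<longlonglongrightarrow> ennreal 0"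
      by (intro tendsto_ennrealI LIMSEQ_Suc[OF lim_1_over_n])
    then have "emeasure \<sigma> (\<Inter>k. N k) \<le> ennreal 0"
      by (rule LIMSEQ_le_const) (use * in blast)
    then show ?thesis by simp
  qed
  then have "(\<Inter>k. N k) \<in> null_sets \<sigma>" using N(1) by (auto simp: null_sets_def \<sigma>)
  moreover have "\<forall>y\<in>S - (\<Inter>k. N k). \<exists>r0>0. \<forall>r. 0 < r \<and> r < r0 \<longrightarrow>
     emeasure \<nu> (cball y r - S) \<le> ennreal \<tau> * emeasure \<sigma> (S \<inter> cball y (5 * r))"
  proof
    fix y assume y: "y \<in> S - (\<Inter>k. N k)"
    then have "y \<notin> Z" using N(2) by auto
    then obtain r0 where "r0 > 0" "\<And>r. 0 < r \<Longrightarrow> r < r0 \<Longrightarrow> \<not> bad y r"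
      using y unfolding Z_def by blast
    then show "\<exists>r0>0. \<forall>r. 0 < r \<and> r < r0 \<longrightarrow>
        emeasure \<nu> (cball y r - S) \<le> ennreal \<tau> * emeasure \<sigma> (S \<inter> cball y (5 * r))"
      unfolding bad_def not_not by blast
  qed
  ultimately show ?thesis by (rule bexI[rotated])
qed

section \<open>Lebesgue density and almost everywhere differentiability on the line\<close>

text \<open>The case of Lebesgue measure in \<open>vitali_density\<close>, cut to a window
  \<open>{-m..m}\<close> to make it finite. The dilated ball has length \<open>10 * h\<close>,
  whence the 10 in the choice of \<open>\<tau>\<close>.\<close>

lemma lebesgue_density_real:
  fixes G :: "real set"
  assumes G: "G \<in> sets borel"
  shows "AE t in lborel. t \<in> G \<longrightarrow> (\<forall>\<tau>>0. \<exists>h0>0. \<forall>h. 0 < h \<and> h < h0 \<longrightarrow>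
     emeasure lborel ({t-h..t+h} - G) \<le> ennreal (\<tau> * h))"
proof -
  have "AE t in lborel. \<bar>t\<bar> < real m \<longrightarrow> t \<in> G \<longrightarrow> (\<exists>h0>0. \<forall>h. 0 < h \<and> h < h0 \<longrightarrow>
     emeasure lborel ({t-h..t+h} - G) \<le> ennreal (1 / real (Suc k) * h))" for m k
  proof -
    define \<nu> where "\<nu> = density lborel (indicator {-real m..real m})"
    have \<nu>: "emeasure \<nu> A = emeasure lborel ({-real m..real m} \<inter> A)" if "A \<in> sets borel" for A
      unfolding \<nu>_def using that by (intro emeasure_restricted) auto
    have fin: "finite_measure \<nu>" by (rule finite_measureI) (simp add: \<nu>_def emeasure_restricted)
    obtain N where N: "N \<in> null_sets lborel" "\<And>y. y \<in> G - N \<Longrightarrow> \<exists>r0>0. \<forall>r. 0 < r \<and> r < r0 \<longrightarrow>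
     emeasure \<nu> (cball y r - G) \<le> ennreal (1 / (10 * real (Suc k))) * emeasure lborel (G \<inter> cball y (5 * r))"
      using vitali_density[of \<nu> lborel G "1 / (10 * real (Suc k))"] fin G by (auto simp: \<nu>_def)
    show ?thesis
    proof (rule AE_I'[OF N(1)], clarify, rule ccontr)
      fix t assume t: "\<bar>t\<bar> < real m" "t \<in> G" "t \<notin> N" and
        n: "\<not> (\<exists>h0>0. \<forall>h. 0 < h \<and> h < h0 \<longrightarrow> emeasure lborel ({t-h..t+h} - G) \<le> ennreal (1 / real (Suc k) * h))"
      obtain r0 where r0: "r0 > 0" "\<And>r. 0 < r \<Longrightarrow> r < r0 \<Longrightarrow> 
        emeasure \<nu> (cball t r - G) \<le> ennreal (1 / (10 * real (Suc k))) * emeasure lborel (G \<inter> cball t (5 * r))"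
        using N(2)[of t] t by auto
      have "emeasure lborel ({t-h..t+h} - G) \<le> ennreal (1 / real (Suc k) * h)"
        if h: "0 < h" "h < min r0 (real m - \<bar>t\<bar>)" for h
      proof -
        have "{t-h..t+h} - G = {-real m..real m} \<inter> (cball t h - G)"
          using h by (auto simp: cball_eq_atLeastAtMost)
        then have "emeasure lborel ({t-h..t+h} - G) = emeasure \<nu> (cball t h - G)"
          using G by (subst \<nu>) auto
        also have "\<dots> \<le> ennreal (1 / (10 * real (Suc k))) * emeasure lborel (G \<inter> cball t (5 * h))"
          using h by (intro r0) auto
        also have "\<dots> \<le> ennreal (1 / (10 * real (Suc k))) * emeasure lborel (cball t (5 * h))"
          by (intro mult_left_mono emeasure_mono) auto
        also have "\<dots> = ennreal (1 / real (Suc k) * h)"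
          using h by (simp add: cball_eq_atLeastAtMost field_simps flip: ennreal_mult)
        finally show ?thesis .
      qed
      moreover have "min r0 (real m - \<bar>t\<bar>) > 0" using r0 t by auto
      ultimately show False using n by blast
    qed
  qed
  then have "AE t in lborel. \<forall>m k. \<bar>t\<bar> < real m \<longrightarrow> t \<in> G \<longrightarrow> (\<exists>h0>0. \<forall>h. 0 < h \<and> h < h0 \<longrightarrow>
     emeasure lborel ({t-h..t+h} - G) \<le> ennreal (1 / real (Suc k) * h))"
    by (intro AE_all_countable[THEN iffD2] allI)
  then show ?thesis
  proof eventually_elim
    case (elim t)
    show ?case
    proof (intro impI allI)
      fix \<tau> :: real assume "t \<in> G" "\<tau> > 0"
      obtain k where k: "1 / real (Suc k) < \<tau>" using \<open>\<tau> > 0\<close> nat_approx_posE by blast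
      obtain m where "\<bar>t\<bar> < real m" using reals_Archimedean2 by blast
      with elim \<open>t \<in> G\<close> obtain h0 where h0: "h0 > 0" "\<forall>h. 0 < h \<and> h < h0 \<longrightarrow>
         emeasure lborel ({t-h..t+h} - G) \<le> ennreal (1 / real (Suc k) * h)" by blast
      have "emeasure lborel ({t-h..t+h} - G) \<le> ennreal (\<tau> * h)" if "0 < h" "h < h0" for h
        by (rule order_trans[OF h0(2)[rule_format, OF conjI[OF that]] ennreal_leI])
          (use that k in \<open>intro mult_right_mono, auto\<close>)
      then show "\<exists>h0>0. \<forall>h. 0 < h \<and> h < h0 \<longrightarrow> emeasure lborel ({t-h..t+h} - G) \<le> ennreal (\<tau> * h)"
        using h0(1) by blast
    qed
  qed
qed

text \<open>Domination on intervals passes to Borel sets because the Stieltjes measures of \<open>F\<close> and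
  of \<open>K x - F x\<close> add up to \<open>K\<close> times Lebesgue measure.\<close>

lemma interval_measure_le_lborel:
  fixes F :: "real \<Rightarrow> real"
  assumes mono: "\<And>x y. x \<le> y \<Longrightarrow> F x \<le> F y" and lip: "\<And>x y. x \<le> y \<Longrightarrow> F y - F x \<le> K * (y - x)"
    and "A \<in> sets borel"
  shows "emeasure (interval_measure F) A \<le> ennreal K * emeasure lborel A"
proof -
  have K: "K \<ge> 0" using lip[of 0 1] mono[of 0 1] by simp
  have "\<bar>F x - F y\<bar> \<le> K * \<bar>x - y\<bar>" for x y
    using lip[of x y] lip[of y x] mono[of x y] mono[of y x] by (cases "x \<le> y") auto
  then have "K-lipschitz_on UNIV F" using K by (intro lipschitz_onI) (auto simp: dist_real_def)
  then have cont: "continuous_on UNIV F" by (rule lipschitz_on_continuous_on)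
  then have cF: "continuous (at_right a) F" for a
    by (meson UNIV_I continuous_on_eq_continuous_at continuous_at_imp_continuous_at_within open_UNIV)
  define H where "H x = K * x - F x" for x
  have "continuous (at_right a) H" for a
    unfolding H_def by (intro continuous_intros cF)
  then have M2: "emeasure (interval_measure H) {a<..b} = H b - H a" if "a \<le> b" for a b
    using lip that by (intro emeasure_interval_measure_Ioc) (auto simp: H_def algebra_simps)
  have M1: "emeasure (interval_measure F) {a<..b} = F b - F a" if "a \<le> b" for a b
    using mono cF that by (intro emeasure_interval_measure_Ioc) auto
  define N where "N = measure_of UNIV (sets borel) (\<lambda>A. emeasure (interval_measure F) A + emeasure (interval_measure H) A)"
  have sN: "sets N = sets borel"
    using sets.sigma_sets_eq[of "borel :: real measure"] by (simp add: N_def)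
  have N: "emeasure N A = emeasure (interval_measure F) A + emeasure (interval_measure H) A"
    if "A \<in> sets borel" for A
  proof (rule emeasure_measure_of[OF N_def])
    show "countably_additive (sets N) (\<lambda>A. emeasure (interval_measure F) A + emeasure (interval_measure H) A)"
    proof (rule countably_additiveI)
      fix B :: "nat \<Rightarrow> real set" assume B: "range B \<subseteq> sets N" "disjoint_family B"
      then show "(\<Sum>i. emeasure (interval_measure F) (B i) + emeasure (interval_measure H) (B i)) =
        emeasure (interval_measure F) (\<Union>(range B)) + emeasure (interval_measure H) (\<Union>(range B))"
        by (subst suminf_add[symmetric]) (auto simp: sN suminf_emeasure)
    qed
  qed (use that in \<open>auto simp: positive_def sN\<close>)
  have bs: "sets (borel :: real measure) = sigma_sets UNIV (range (\<lambda>(a, b). {a<..b}))"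
    by (metis borel_sigma_sets_Ioc sets_measure_of Pow_UNIV subset_UNIV)
  have "N = density lborel (\<lambda>_. ennreal K)"
  proof (rule measure_eqI_generator_eq[where E = "range (\<lambda>(a, b). {a<..b})" and \<Omega> = UNIV and A = "\<lambda>i. {- real i<..real i}"])
    show "Int_stable (range (\<lambda>(a, b::real). {a<..b}))"
      unfolding Int_stable_def
    proof clarify
      fix a b c d :: real
      have "{a<..b} \<inter> {c<..d} = (\<lambda>(a, b). {a<..b}) (max a c, min b d)" by auto
      then show "{a<..b} \<inter> {c<..d} \<in> range (\<lambda>(a, b). {a<..b})" by blast
    qed
    show "sets N = sigma_sets UNIV (range (\<lambda>(a, b). {a<..b}))" using sN bs by (rule trans)
    show "sets (density lborel (\<lambda>_::real. ennreal K)) = sigma_sets UNIV (range (\<lambda>(a, b). {a<..b}))"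
      using bs by simp
    show "(\<Union>i. {- real i<..real i}) = UNIV"
    proof -
      have "\<exists>i. x \<in> {- real i<..real i}" for x
      proof -
        obtain i where "\<bar>x\<bar> < real i" using reals_Archimedean2 by blast
        then show ?thesis by (intro exI[of _ i]) auto
      qed
      then show ?thesis by blast
    qed
    show "emeasure N X = emeasure (density lborel (\<lambda>_. ennreal K)) X" if X: "X \<in> range (\<lambda>(a, b). {a<..b})" for X
    proof -
      obtain a b where ab: "X = {a<..b}" using X by auto
      show ?thesis
      proof (cases "a \<le> b")
        case True
        then have "emeasure N X = ennreal (F b - F a) + ennreal (H b - H a)"
          by (simp add: ab N M1 M2)
        also have "\<dots> = ennreal (K * (b - a))"
          using mono[OF True] lip[OF True]
          by (subst ennreal_plus[symmetric]) (auto simp: H_def algebra_simps)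
        also have "\<dots> = emeasure (density lborel (\<lambda>_. ennreal K)) X"
          using K True by (simp add: ab emeasure_density_const ennreal_mult)
        finally show ?thesis .
      qed (simp add: ab N)
    qed
    show "emeasure N {- real i<..real i} \<noteq> \<infinity>" for i by (simp add: N M1 M2)
  qed auto
  then show ?thesis using N[of A] assms(3) by (simp add: emeasure_density_const)
qed

text \<open>The derivative is read off from the Radon-Nikodym density \<open>g\<close> of a
  Stieltjes measure. Instead of differentiating the integral of \<open>g\<close>, it suffices to
  take density points of the level sets of \<open>g\<close> between \<open>q\<close> and
  \<open>q + 1 / (k + 1)\<close>: the Lipschitz bound controls what happens off the level
  set.\<close>

proposition lipschitz_imp_AE_differentiable:
  fixes f :: "real \<Rightarrow> real"
  assumes L: "L-lipschitz_on UNIV f"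
  shows "AE t in lborel. f differentiable (at t)"
proof -
  have L0: "L \<ge> 0" using L by (rule lipschitz_on_nonneg)
  have Lf: "\<bar>f x - f y\<bar> \<le> L * \<bar>x - y\<bar>" for x y
    using lipschitz_onD[OF L, of x y] by (simp add: dist_real_def)
  \<comment> \<open>Adding \<open>L * t\<close> makes the function nondecreasing, with slopes at
    most \<open>2 * L\<close>.\<close>
  define F where "F t = f t + L * t" for t
  have mono: "F x \<le> F y" and lip: "F y - F x \<le> (2 * L) * (y - x)" if "x \<le> y" for x y
    using Lf[of x y] that by (auto simp: F_def algebra_simps abs_le_iff)
  define M where "M = interval_measure F"
  have sM[simp]: "sets M = sets borel" "space M = UNIV" by (auto simp: M_def)
  have le: "emeasure M A \<le> ennreal (2 * L) * emeasure lborel A" if "A \<in> sets borel" for A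
    unfolding M_def by (intro interval_measure_le_lborel mono lip that)
  have "continuous_on UNIV F"
    unfolding F_def by (intro continuous_intros lipschitz_on_continuous_on[OF L])
  then have cF: "continuous (at_right a) F" for a
    by (meson UNIV_I continuous_on_eq_continuous_at continuous_at_imp_continuous_at_within open_UNIV)
  have M: "emeasure M {a<..b} = F b - F a" if "a \<le> b" for a b
    unfolding M_def using mono cF that by (intro emeasure_interval_measure_Ioc) auto
  have ac: "absolutely_continuous lborel M"
    unfolding absolutely_continuous_def using le by (auto simp: null_sets_def)
      (metis ennreal_mult_eq_top_iff le_zero_eq mult_zero_right)
  define g where "g = RN_deriv lborel M"
  have g[measurable]: "g \<in> borel_measurable lborel" by (simp add: g_def)
  have dg: "density lborel g = M"
    unfolding g_def by (rule sigma_finite_measure.density_RN_deriv[OF sigma_finite_lborel ac]) simp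
  have "sigma_finite_measure M" unfolding M_def by (intro sigma_finite_interval_measure mono cF)
  then have "AE t in lborel. g t \<noteq> \<infinity>"
    unfolding g_def by (intro sigma_finite_measure.RN_deriv_finite[OF sigma_finite_lborel] ac) auto
  define S where "S q k = {t. ennreal q \<le> g t \<and> g t \<le> ennreal (q + 1 / real (Suc k))}" for q k
  have [measurable]: "S q k \<in> sets borel" for q k
    unfolding S_def using g by (simp add: measurable_lborel1) 
  have "AE t in lborel. \<forall>q\<in>\<rat>. \<forall>k. t \<in> S q k \<longrightarrow> (\<forall>\<tau>>0. \<exists>h0>0. \<forall>h. 0 < h \<and> h < h0 \<longrightarrow>
     emeasure lborel ({t-h..t+h} - S q k) \<le> ennreal (\<tau> * h))"
    by (intro AE_ball_countable' AE_all_countable[THEN iffD2] allI lebesgue_density_real) (auto simp: countable_rat)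
  with \<open>AE t in lborel. g t \<noteq> \<infinity>\<close> show ?thesis
  proof eventually_elim
    case (elim t)
    define v where "v = enn2real (g t)"
    have v: "g t = ennreal v" "v \<ge> 0" using elim(1) by (auto simp: v_def less_top)
    have "\<exists>d>0. \<forall>s. norm (s - t) < d \<longrightarrow> norm (F s - F t - v * (s - t)) \<le> \<epsilon> * norm (s - t)" if "\<epsilon> > 0" for \<epsilon>
    proof -
      obtain k where k: "1 / real (Suc k) < \<epsilon> / 2" using nat_approx_posE[of "\<epsilon> / 2"] \<open>\<epsilon> > 0\<close> by auto
      \<comment> \<open>\<open>q\<close> must be nonnegative because \<open>ennreal\<close> sends
        negative reals to 0; when \<open>v = 0\<close> the choice is \<open>q = 0\<close>.\<close>
      have "\<exists>q\<in>\<rat>. 0 \<le> q \<and> q \<le> v \<and> v \<le> q + 1 / real (Suc k)"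
      proof (cases "v = 0")
        case False
        then have "max 0 (v - 1 / real (Suc k)) < v" using v by auto
        then obtain q where "q \<in> \<rat>" "max 0 (v - 1 / real (Suc k)) < q" "q < v"
          using Rats_dense_in_real by blast
        then show ?thesis by (intro bexI[of _ q]) auto
      qed auto
      then obtain q where q: "q \<in> \<rat>" "0 \<le> q" "q \<le> v" "v \<le> q + 1 / real (Suc k)" by blast
      \<comment> \<open>Two errors arise off the level set, the growth of \<open>F\<close> at rate
        at most \<open>2 * L\<close> and the missing contribution at rate \<open>q\<close>; this
        \<open>\<tau>\<close> keeps each below half of \<open>\<epsilon>\<close>.\<close>
      define \<tau> where "\<tau> = \<epsilon> / (2 * (2 * L + q + 1))"
      have \<tau>: "\<tau> > 0" using \<open>\<epsilon> > 0\<close> L0 q by (auto simp: \<tau>_def)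
      have \<tau>1: "(2 * L) * \<tau> \<le> \<epsilon> / 2" "q * \<tau> \<le> \<epsilon> / 2"
      proof -
        have "(2 * L) * \<tau> \<le> (2 * L + q + 1) * \<tau>" "q * \<tau> \<le> (2 * L + q + 1) * \<tau>"
          using L0 q \<tau> by (auto intro!: mult_right_mono)
        moreover have "(2 * L + q + 1) * \<tau> = \<epsilon> / 2"
        proof -
          have "X * (\<epsilon> / (2 * X)) = \<epsilon> / 2" if "X \<noteq> 0" for X :: real using that by simp
          moreover have "2 * L + q + 1 \<noteq> 0" using L0 q by auto
          ultimately show ?thesis unfolding \<tau>_def by blast
        qed
        ultimately show "(2 * L) * \<tau> \<le> \<epsilon> / 2" "q * \<tau> \<le> \<epsilon> / 2" by auto
      qed
      have "t \<in> S q k" unfolding S_def mem_Collect_eq v(1) using q by (intro conjI ennreal_leI)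
      then obtain h0 where h0: "h0 > 0" "\<And>h. 0 < h \<Longrightarrow> h < h0 \<Longrightarrow>
          emeasure lborel ({t-h..t+h} - S q k) \<le> ennreal (\<tau> * h)"
        using elim(2)[rule_format, OF q(1) \<open>t \<in> S q k\<close> \<tau>] by blast
      \<comment> \<open>If \<open>x\<close> and \<open>y\<close> are the lengths of the interval
        inside and outside the level set, the increment of \<open>F\<close> lies between
        \<open>q * x\<close> and \<open>(q + 1 / (k + 1)) * x + 2 * L * y\<close>, and
        \<open>y\<close> is at most \<open>\<tau> * h\<close>.\<close>
      have main: "norm (F b - F a - v * (b - a)) \<le> \<epsilon> * (b - a)" if ab: "a < b" "b - a < h0" "a = t \<or> b = t" for a b
      proof -
        define h where "h = b - a"
        define I where "I = {a<..b}"
        have h: "0 < h" "h < h0" using ab by (auto simp: h_def)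
        have LI: "emeasure lborel I = ennreal h" using ab by (simp add: I_def h_def)
        have "emeasure lborel (I - S q k) \<le> emeasure lborel ({t-h..t+h} - S q k)"
          using ab by (intro emeasure_mono) (auto simp: I_def h_def)
        also have "\<dots> \<le> ennreal (\<tau> * h)" by (rule h0(2)[OF h])
        finally have bad: "emeasure lborel (I - S q k) \<le> ennreal (\<tau> * h)" .
        define x where "x = measure lborel (I \<inter> S q k)"
        define y where "y = measure lborel (I - S q k)"
        have fin: "emeasure lborel (I \<inter> S q k) < \<infinity>" "emeasure lborel (I - S q k) < \<infinity>"
          using LI emeasure_mono[of "I \<inter> S q k" I lborel] emeasure_mono[of "I - S q k" I lborel]
          by (auto intro: le_less_trans simp: I_def simp del: emeasure_lborel_Ioc)
        have xy: "emeasure lborel (I \<inter> S q k) = ennreal x" "emeasure lborel (I - S q k) = ennreal y" "0 \<le> x" "0 \<le> y"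
          using fin by (auto simp: x_def y_def emeasure_eq_ennreal_measure less_top)
        have "emeasure lborel I = emeasure lborel (I \<inter> S q k) + emeasure lborel (I - S q k)"
          by (subst plus_emeasure) (auto intro!: arg_cong[where f = "emeasure lborel"] simp: I_def)
        then have xyh: "x + y = h" using xy LI h by (simp flip: ennreal_plus)
        have y: "y \<le> \<tau> * h" using bad xy \<tau> h by (simp add: ennreal_le_iff)
        have F0: "F b - F a \<ge> 0" using mono ab by simp
        have MI: "emeasure M I = emeasure M (I \<inter> S q k) + emeasure M (I - S q k)"
          by (subst plus_emeasure) (auto intro!: arg_cong[where f = "emeasure M"] simp: I_def)
        have MS: "emeasure M (I \<inter> S q k) = (\<integral>\<^sup>+s. g s * indicator (I \<inter> S q k) s \<partial>lborel)"
          unfolding dg[symmetric] by (subst emeasure_density) (auto simp: I_def)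
        have "emeasure M (I \<inter> S q k) \<le> (\<integral>\<^sup>+s. ennreal (q + 1 / real (Suc k)) * indicator (I \<inter> S q k) s \<partial>lborel)"
          unfolding MS by (intro nn_integral_mono) (auto simp: S_def split: split_indicator)
        also have "\<dots> = ennreal ((q + 1 / real (Suc k)) * x)"
          using xy q by (subst nn_integral_cmult_indicator) (auto simp: I_def ennreal_mult simp del: of_nat_Suc)
        finally have 1: "emeasure M (I \<inter> S q k) \<le> ennreal ((q + 1 / real (Suc k)) * x)" .
        have "ennreal (q * x) = (\<integral>\<^sup>+s. ennreal q * indicator (I \<inter> S q k) s \<partial>lborel)"
          using xy q by (subst nn_integral_cmult_indicator) (auto simp: I_def ennreal_mult)
        also have "\<dots> \<le> emeasure M (I \<inter> S q k)"
          unfolding MS by (intro nn_integral_mono) (auto simp: S_def split: split_indicator)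
        finally have 2: "ennreal (q * x) \<le> emeasure M (I \<inter> S q k)" .
        have 3: "emeasure M (I - S q k) \<le> ennreal (2 * L * y)"
          using le[of "I - S q k"] xy L0 by (simp add: I_def ennreal_mult)
        have MF: "emeasure M I = ennreal (F b - F a)" using M[of a b] ab by (simp add: I_def)
        have "ennreal (F b - F a) \<le> ennreal ((q + 1 / real (Suc k)) * x) + ennreal (2 * L * y)"
          unfolding MF[symmetric] MI by (intro add_mono 1 3)
        also have "\<dots> = ennreal ((q + 1 / real (Suc k)) * x + 2 * L * y)"
          using xy q L0 by (intro ennreal_plus[symmetric]) auto
        finally have up: "F b - F a \<le> (q + 1 / real (Suc k)) * x + 2 * L * y"
          using xy q L0 by (subst (asm) ennreal_le_iff) auto
        have "ennreal (q * x) \<le> ennreal (F b - F a)"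
          unfolding MF[symmetric] MI using 2 by (simp add: add_increasing2)
        then have lo: "q * x \<le> F b - F a" using F0 by (simp add: ennreal_le_iff)
        have "(q + 1 / real (Suc k)) * x \<le> (q + 1 / real (Suc k)) * h"
          using xyh xy q by (intro mult_left_mono) auto
        moreover have "2 * L * y \<le> 2 * L * (\<tau> * h)" using y L0 by (intro mult_left_mono) auto
        moreover have "2 * L * (\<tau> * h) \<le> \<epsilon> / 2 * h" using mult_right_mono[OF \<tau>1(1), of h] h by (simp add: mult_ac)
        moreover have "(q + 1 / real (Suc k)) * h \<le> (v + \<epsilon> / 2) * h"
          using q k h by (intro mult_right_mono) auto
        ultimately have u: "F b - F a - v * h \<le> \<epsilon> * h" using up by (simp add: algebra_simps)
        have "q * x \<ge> q * (h - \<tau> * h)" using xyh y q by (intro mult_left_mono) auto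
        moreover have "q * (\<tau> * h) \<le> \<epsilon> / 2 * h" using mult_right_mono[OF \<tau>1(2), of h] h by (simp add: mult_ac)
        moreover have "q * h \<ge> (v - \<epsilon> / 2) * h" using q k h by (intro mult_right_mono) auto
        ultimately have l: "v * h - (F b - F a) \<le> \<epsilon> * h" using lo by (simp add: algebra_simps)
        show ?thesis using u l by (auto simp: h_def abs_le_iff)
      qed
      have "norm (F s - F t - v * (s - t)) \<le> \<epsilon> * norm (s - t)" if "norm (s - t) < h0" for s
      proof -
        consider "s = t" | "s < t" | "t < s" by linarith
        then show ?thesis
        proof cases
          case 2
          then show ?thesis using main[of s t] that by (auto simp: abs_minus_commute algebra_simps abs_le_iff)
        next
          case 3
          then show ?thesis using main[of t s] that by auto
        qed auto
      qed
      then show ?thesis using h0(1) by blast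
    qed
    then have "(F has_derivative (\<lambda>x. v * x)) (at t)"
      unfolding has_derivative_at_alt by (auto intro: bounded_linear_mult_right)
    then have "(F has_field_derivative v) (at t)" by (simp add: has_field_derivative_def)
    then have "((\<lambda>t. F t - L * t) has_field_derivative (v - L)) (at t)"
      by (auto intro!: derivative_eq_intros)
    then have "(f has_field_derivative (v - L)) (at t)" by (simp add: F_def[abs_def])
    then show ?case by (auto simp: real_differentiable_def)
  qed
qed

section \<open>Straight pieces of curve fragments\<close>

text \<open>A countable base of the second factor is enough: for each basic \<open>V\<close> all
  admissible open sets of the first factor are merged into one open set \<open>W V\<close>. The
  first factor will be the space of fragments, over a metric space with no separability
  assumed.\<close>

lemma open_in_borel_pair:
  fixes U :: "('a::topological_space \<times> 'b::second_countable_topology) set"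
  assumes "open U"
  shows "U \<in> sets (borel \<Otimes>\<^sub>M borel)"
proof -
  obtain B :: "'b set set" where B: "countable B" "topological_basis B"
    using ex_countable_basis by auto
  define W where "W V = \<Union>{A. open A \<and> A \<times> V \<subseteq> U}" for V
  have "U = (\<Union>V\<in>B. W V \<times> V)"
  proof (intro equalityI subsetI)
    fix x assume "x \<in> U"
    obtain A V where AV: "open A" "open V" "x \<in> A \<times> V" "A \<times> V \<subseteq> U"
      using open_prod_elim[OF assms \<open>x \<in> U\<close>] by blast
    obtain V' where V': "V' \<in> B" "snd x \<in> V'" "V' \<subseteq> V"
      using topological_basisE[OF B(2) AV(2), of "snd x"] AV(3) by (auto simp: mem_Times_iff)
    then have "fst x \<in> W V'" using AV unfolding W_def by (fastforce simp: mem_Times_iff)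
    then show "x \<in> (\<Union>V\<in>B. W V \<times> V)" using V' by (auto simp: mem_Times_iff intro!: bexI[of _ V'])
  qed (auto simp: W_def)
  moreover have "W V \<in> sets borel" for V unfolding W_def by (intro borel_open open_Union) auto
  moreover have "V \<in> B \<Longrightarrow> V \<in> sets borel" for V
    by (rule borel_open[OF topological_basis_open[OF B(2)]])
  ultimately show ?thesis
    using B(1) by (auto intro!: sets.countable_UN' pair_measureI)
qed

lemma closed_in_borel_pair:
  fixes F :: "('a::topological_space \<times> 'b::second_countable_topology) set"
  assumes "closed F"
  shows "F \<in> sets (borel \<Otimes>\<^sub>M borel)"
proof -
  have "space (borel \<Otimes>\<^sub>M borel) - (- F) \<in> sets (borel \<Otimes>\<^sub>M (borel :: 'b measure))"
    using assms by (intro sets.compl_sets open_in_borel_pair) auto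
  then show ?thesis by (simp add: space_pair_measure Compl_eq_Diff_UNIV[symmetric])
qed

lemma fragment_approx:
  assumes "t \<in> frag_dom \<gamma>" "dist \<gamma> \<eta> < d"
  shows "\<exists>s\<in>frag_dom \<eta>. \<bar>s - t\<bar> < d \<and> dist (frag_map \<gamma> t) (frag_map \<eta> s) < d"
proof -
  have "(t, frag_map \<gamma> t) \<in> frag_graph \<gamma>" using assms by (auto simp: frag_graph_def)
  then have "infdist (t, frag_map \<gamma> t) (frag_graph \<eta>) < d"
    using infdist_le_hausdorff_dist[OF bounded_frag_graph frag_graph_nonempty, of _ \<gamma> \<eta>] assms(2)
    unfolding dist_fragment_def by force
  then obtain p where p: "p \<in> frag_graph \<eta>" "dist (t, frag_map \<gamma> t) p < d"
    unfolding infdist_notempty[OF frag_graph_nonempty]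
    by (subst (asm) cINF_less_iff) (auto simp: frag_graph_nonempty intro: bdd_belowI2[of _ 0])
  then obtain s where s: "s \<in> frag_dom \<eta>" "p = (s, frag_map \<eta> s)" by (auto simp: frag_graph_def)
  have "\<bar>s - t\<bar> \<le> dist (t, frag_map \<gamma> t) p" "dist (frag_map \<gamma> t) (frag_map \<eta> s) \<le> dist (t, frag_map \<gamma> t) p"
    using dist_fst_le[of "(t, frag_map \<gamma> t)" p] dist_snd_le[of "(t, frag_map \<gamma> t)" p]
    by (auto simp: s dist_real_def)
  then show ?thesis using s p by (intro bexI[of _ s]) auto
qed

text \<open>Hausdorff convergence of graphs: limits of points of the approximating graphs lie on the
  limiting graph, because its domain is closed and its map is 2-Lipschitz.\<close>

lemma fragment_limit:
  assumes g: "g \<longlonglongrightarrow> \<gamma>" and x: "x \<longlonglongrightarrow> t" and dom: "\<And>j. x j \<in> frag_dom (g j)"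
  shows "t \<in> frag_dom \<gamma>" and "(\<lambda>j. frag_map (g j) (x j)) \<longlonglongrightarrow> frag_map \<gamma> t"
proof -
  have ev: "\<forall>\<^sub>F j in sequentially. dist (g j) \<gamma> < e \<and> dist (x j) t < e" if "e > 0" for e
    using tendstoD[OF g that] tendstoD[OF x that] by eventually_elim auto
  have "\<exists>s\<in>frag_dom \<gamma>. dist s t < e" if "e > 0" for e
  proof -
    obtain j where j: "dist (g j) \<gamma> < e / 2" "dist (x j) t < e / 2"
      using ev[of "e / 2"] \<open>e > 0\<close> by (auto simp: eventually_sequentially)
    obtain s where "s \<in> frag_dom \<gamma>" "\<bar>s - x j\<bar> < e / 2" using fragment_approx[OF dom j(1)] by blast
    then show ?thesis using j(2) by (intro bexI[of _ s]) (unfold dist_real_def, linarith+)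
  qed
  then have "t \<in> closure (frag_dom \<gamma>)" by (auto simp: closure_approachable)
  then show t: "t \<in> frag_dom \<gamma>"
    using closure_closed[OF compact_imp_closed[OF compact_frag_dom]] by blast
  show "(\<lambda>j. frag_map (g j) (x j)) \<longlonglongrightarrow> frag_map \<gamma> t"
  proof (rule tendstoI)
    fix e :: real assume "e > 0"
    \<comment> \<open>One fifth goes to the distance of the graphs and four fifths to
      \<open>2 * \<bar>s - t\<bar>\<close>, where \<open>\<bar>s - t\<bar>\<close> is at most two
      fifths of \<open>e\<close>.\<close>
    have "\<forall>\<^sub>F j in sequentially. dist (g j) \<gamma> < e / 5 \<and> dist (x j) t < e / 5" using \<open>e > 0\<close> by (intro ev) auto
    then show "\<forall>\<^sub>F j in sequentially. dist (frag_map (g j) (x j)) (frag_map \<gamma> t) < e"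
    proof eventually_elim
      case (elim j)
      obtain s where s: "s \<in> frag_dom \<gamma>" "\<bar>s - x j\<bar> < e / 5" "dist (frag_map (g j) (x j)) (frag_map \<gamma> s) < e / 5"
        using fragment_approx[OF dom conjunct1[OF elim]] by blast
      have "dist (frag_map \<gamma> s) (frag_map \<gamma> t) \<le> 2 * \<bar>s - t\<bar>" using frag_bilipschitz[OF s(1) t] by blast
      moreover have "\<bar>s - t\<bar> \<le> 2 * (e / 5)" using s(2) elim unfolding dist_real_def by linarith
      ultimately show ?case
        using s(3) dist_triangle[of "frag_map (g j) (x j)" "frag_map \<gamma> t" "frag_map \<gamma> s"] by simp
    qed
  qed
qed

text \<open>The converse half of graph convergence. It lets conditions quantified over all times of
  the domain pass to the limit.\<close>

lemma fragment_lift: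
  assumes g: "g \<longlonglongrightarrow> \<gamma>" and t: "t \<in> frag_dom \<gamma>"
  shows "\<exists>x. (\<forall>j. x j \<in> frag_dom (g j)) \<and> x \<longlonglongrightarrow> t"
proof -
  \<comment> \<open>The summand \<open>1 / real (Suc j)\<close> supplies the strict inequality that
    \<open>fragment_approx\<close> asks for.\<close>
  have "\<exists>s\<in>frag_dom (g j). \<bar>s - t\<bar> < dist (g j) \<gamma> + 1 / real (Suc j)" for j
  proof -
    have "dist \<gamma> (g j) < dist (g j) \<gamma> + 1 / real (Suc j)" by (simp add: dist_commute)
    then show ?thesis using fragment_approx[OF t] by blast
  qed
  then obtain x where x: "\<And>j. x j \<in> frag_dom (g j)" "\<And>j. \<bar>x j - t\<bar> < dist (g j) \<gamma> + 1 / real (Suc j)"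
    by metis
  have "(\<lambda>j. dist (g j) \<gamma> + 1 / real (Suc j)) \<longlonglongrightarrow> 0 + 0"
    using g by (intro tendsto_add LIMSEQ_Suc[OF lim_1_over_n]) (simp add: tendsto_dist_iff[symmetric])
  then have "(\<lambda>j. x j - t) \<longlonglongrightarrow> 0"
    using x(2) by (intro Lim_null_comparison[of "\<lambda>j. x j - t"]) (auto intro!: always_eventually less_imp_le)
  then have "x \<longlonglongrightarrow> t" by (simp add: LIM_zero_iff)
  then show ?thesis using x(1) by blast
qed

definition frag_pairs :: "('a::metric_space fragment \<times> real) set" where
  "frag_pairs = {(\<gamma>, t). t \<in> frag_dom \<gamma>}"

text \<open>The value 0 is a mere default: preimages under the evaluation are intersected with
  subsets of \<open>frag_pairs\<close> before they are measured.\<close>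

definition frag_eval :: "('a::metric_space \<Rightarrow> 'b::zero) \<Rightarrow> 'a fragment \<times> real \<Rightarrow> 'b" where
  "frag_eval \<phi> = (\<lambda>(\<gamma>, t). if t \<in> frag_dom \<gamma> then \<phi> (frag_map \<gamma> t) else 0)"

lemma closed_frag_pairs: "closed (frag_pairs :: ('a::metric_space fragment \<times> real) set)"
proof -
  have "l \<in> frag_pairs" if "\<And>n. x n \<in> frag_pairs" "x \<longlonglongrightarrow> l" for x and l :: "'a fragment \<times> real"
    using fragment_limit(1)[of "\<lambda>n. fst (x n)" "fst l" "\<lambda>n. snd (x n)" "snd l"] that
    by (auto simp: frag_pairs_def split_beta intro: tendsto_fst tendsto_snd)
  then show ?thesis unfolding closed_sequential_limits by blast
qed

lemma measurable_frag_eval: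
  fixes \<phi> :: "'a::metric_space \<Rightarrow> 'b::{zero, topological_space}"
  assumes "continuous_on UNIV \<phi>"
  shows "frag_eval \<phi> \<in> borel \<Otimes>\<^sub>M borel \<rightarrow>\<^sub>M borel"
proof (rule borel_measurableI)
  fix S :: "'b set" assume "open S"
  define F where "F = {(\<gamma>, t). t \<in> frag_dom \<gamma> \<and> \<phi> (frag_map \<gamma> t) \<in> - S}"
  have lim: "l \<in> F" if x: "\<And>n. x n \<in> F" "x \<longlonglongrightarrow> l" for x l
  proof -
    have 1: "(\<lambda>n. fst (x n)) \<longlonglongrightarrow> fst l" "(\<lambda>n. snd (x n)) \<longlonglongrightarrow> snd l" "\<And>n. snd (x n) \<in> frag_dom (fst (x n))"
      using x by (auto simp: F_def split_beta intro: tendsto_fst tendsto_snd)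
    have c: "(\<lambda>n. \<phi> (frag_map (fst (x n)) (snd (x n)))) \<longlonglongrightarrow> \<phi> (frag_map (fst l) (snd l))"
      using assms fragment_limit(2)[OF 1] by (intro isCont_tendsto_compose[of _ \<phi>]) (auto simp: continuous_on_eq_continuous_at)
    have inS: "\<phi> (frag_map (fst (x n)) (snd (x n))) \<in> - S" for n
      using x(1)[of n] by (simp add: F_def split_beta)
    have "closed (- S)" using \<open>open S\<close> by (rule closed_Compl)
    then have "\<phi> (frag_map (fst l) (snd l)) \<in> - S"
      by (rule Lim_in_closed_set[OF _ always_eventually sequentially_bot c]) (use inS in simp)
    then show ?thesis using fragment_limit(1)[OF 1] by (auto simp: F_def split_beta)
  qed
  have "closed F" unfolding closed_sequential_limits using lim by blast
  then have F: "F \<in> sets (borel \<Otimes>\<^sub>M borel)" by (rule closed_in_borel_pair)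
  have D: "frag_pairs \<in> sets (borel \<Otimes>\<^sub>M borel)" by (rule closed_in_borel_pair[OF closed_frag_pairs])
  have "frag_eval \<phi> -` S \<inter> space (borel \<Otimes>\<^sub>M borel) =
      (frag_pairs - F) \<union> (if 0 \<in> S then space (borel \<Otimes>\<^sub>M borel) - frag_pairs else {})"
    by (cases "0 \<in> S"; intro set_eqI) (auto simp: F_def frag_pairs_def frag_eval_def space_pair_measure split_beta)
  also have "\<dots> \<in> sets (borel \<Otimes>\<^sub>M borel)" using F D by auto
  finally show "frag_eval \<phi> -` S \<inter> space (borel \<Otimes>\<^sub>M borel) \<in> sets (borel \<Otimes>\<^sub>M borel)" .
qed

text \<open>An index \<open>(v, q, k)\<close> fixes a direction \<open>v\<close> and a time window around \<open>q\<close> on which \<open>\<phi> \<circ> \<gamma>\<close>, seen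
  from time \<open>t\<close>, moves in direction \<open>v\<close> up to a relative error \<open>\<eta>\<close>.\<close>

definition straight_pairs ::
  "('a::metric_space \<Rightarrow> 'b::real_normed_vector) \<Rightarrow> real \<Rightarrow> 'b \<times> real \<times> nat \<Rightarrow> ('a fragment \<times> real) set" where
  "straight_pairs \<phi> \<eta> = (\<lambda>(v, q, k). {(\<gamma>, t). t \<in> frag_dom \<gamma> \<and> \<bar>t - q\<bar> < 1 / real (Suc k) \<and>
     (\<forall>s\<in>frag_dom \<gamma>. \<bar>s - q\<bar> < 1 / real (Suc k) \<longrightarrow>
        norm (\<phi> (frag_map \<gamma> s) - \<phi> (frag_map \<gamma> t) - (s - t) *\<^sub>R v) \<le> \<eta> * norm v * \<bar>s - t\<bar>)})"

text \<open>The requirement on all other times \<open>s\<close> is closed in the pair: a time of the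
  limiting domain in the open window is a limit of times of the approximating domains, which
  eventually lie in the window too. Only the requirement that \<open>t\<close> itself lie in the
  window is open.\<close>

lemma straight_pairs_sets:
  assumes "continuous_on UNIV \<phi>"
  shows "straight_pairs \<phi> \<eta> i \<in> sets (borel \<Otimes>\<^sub>M borel)"
proof -
  obtain v q k where i: "i = (v, q, k)" by (cases i)
  define e where "e = 1 / real (Suc k)"
  define F where "F = {(\<gamma>, t). t \<in> frag_dom \<gamma> \<and> (\<forall>s\<in>frag_dom \<gamma>. \<bar>s - q\<bar> < e \<longrightarrow>
        norm (\<phi> (frag_map \<gamma> s) - \<phi> (frag_map \<gamma> t) - (s - t) *\<^sub>R v) \<le> \<eta> * norm v * \<bar>s - t\<bar>)}"
  have lim: "l \<in> F" if x: "\<And>n. x n \<in> F" "x \<longlonglongrightarrow> l" for x l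
  proof -
    obtain \<gamma> t where l: "l = (\<gamma>, t)" by (cases l)
    have g: "(\<lambda>n. fst (x n)) \<longlonglongrightarrow> \<gamma>" and tl: "(\<lambda>n. snd (x n)) \<longlonglongrightarrow> t"
      using tendsto_fst[OF x(2)] tendsto_snd[OF x(2)] by (auto simp: l)
    have d: "\<And>n. snd (x n) \<in> frag_dom (fst (x n))" using x(1) by (auto simp: F_def split_beta)
    have c: "(\<lambda>n. \<phi> (y n)) \<longlonglongrightarrow> \<phi> z" if "y \<longlonglongrightarrow> z" for y z
      using assms that by (intro isCont_tendsto_compose[of _ \<phi>]) (auto simp: continuous_on_eq_continuous_at)
    have "norm (\<phi> (frag_map \<gamma> s) - \<phi> (frag_map \<gamma> t) - (s - t) *\<^sub>R v) \<le> \<eta> * norm v * \<bar>s - t\<bar>"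
      if s: "s \<in> frag_dom \<gamma>" "\<bar>s - q\<bar> < e" for s
    proof -
      obtain y where y: "\<And>n. y n \<in> frag_dom (fst (x n))" "y \<longlonglongrightarrow> s" using fragment_lift[OF g s(1)] by blast
      have "(\<lambda>n. \<bar>y n - q\<bar>) \<longlonglongrightarrow> \<bar>s - q\<bar>" by (intro tendsto_intros y)
      then have "\<forall>\<^sub>F n in sequentially. \<bar>y n - q\<bar> < e" using s(2) by (rule order_tendstoD)
      then have ev: "\<forall>\<^sub>F n in sequentially. norm (\<phi> (frag_map (fst (x n)) (y n)) - \<phi> (frag_map (fst (x n)) (snd (x n))) - (y n - snd (x n)) *\<^sub>R v)
          \<le> \<eta> * norm v * \<bar>y n - snd (x n)\<bar>"
        by eventually_elim (use x(1) y(1) in \<open>auto simp: F_def split_beta\<close>)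
      show ?thesis
      proof (rule tendsto_le[OF sequentially_bot _ _ ev])
        show "(\<lambda>n. \<eta> * norm v * \<bar>y n - snd (x n)\<bar>) \<longlonglongrightarrow> \<eta> * norm v * \<bar>s - t\<bar>"
          by (intro tendsto_intros y tl)
        show "(\<lambda>n. norm (\<phi> (frag_map (fst (x n)) (y n)) - \<phi> (frag_map (fst (x n)) (snd (x n))) - (y n - snd (x n)) *\<^sub>R v))
           \<longlonglongrightarrow> norm (\<phi> (frag_map \<gamma> s) - \<phi> (frag_map \<gamma> t) - (s - t) *\<^sub>R v)"
          by (intro tendsto_intros c fragment_limit(2)[OF g] y tl d)
      qed
    qed
    then show ?thesis using fragment_limit(1)[OF g tl d] by (auto simp: F_def l)
  qed
  have "closed F" unfolding closed_sequential_limits using lim by blast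
  moreover have "open {p :: 'a fragment \<times> real. \<bar>snd p - q\<bar> < e}"
    by (intro open_Collect_less continuous_intros)
  moreover have "straight_pairs \<phi> \<eta> i = F \<inter> {p. \<bar>snd p - q\<bar> < e}"
    by (auto simp: straight_pairs_def i F_def e_def)
  ultimately show ?thesis using closed_in_borel_pair open_in_borel_pair by (metis sets.Int)
qed

section \<open>Derivatives of Lipschitz curves and directions in the cone\<close>

text \<open>McShane's extension by an infimum of cones.\<close>

lemma lipschitz_extension_real:
  fixes f :: "'a::metric_space \<Rightarrow> real"
  assumes f: "L-lipschitz_on S f" and "S \<noteq> {}"
  shows "\<exists>g. L-lipschitz_on UNIV g \<and> (\<forall>x\<in>S. g x = f x)"
proof -
  have L: "L \<ge> 0" using f by (rule lipschitz_on_nonneg)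
  define g where "g x = (INF s\<in>S. f s + L * dist x s)" for x
  obtain s0 where s0: "s0 \<in> S" using assms by auto
  have bdd: "bdd_below ((\<lambda>s. f s + L * dist x s) ` S)" for x
  proof (rule bdd_belowI2)
    fix s assume "s \<in> S"
    have "f s0 - f s \<le> L * dist s0 s" using lipschitz_onD[OF f s0 \<open>s \<in> S\<close>] by (auto simp: dist_real_def)
    also have "\<dots> \<le> L * (dist x s0 + dist x s)" using L by (intro mult_left_mono) (metis dist_triangle3 dist_commute)+
    finally show "f s0 - L * dist x s0 \<le> f s + L * dist x s" by (simp add: algebra_simps)
  qed
  have le: "g x \<le> g y + L * dist x y" for x y
  proof -
    have "g x - L * dist x y \<le> f s + L * dist y s" if "s \<in> S" for s
    proof -
      have "g x \<le> f s + L * dist x s" unfolding g_def using that by (intro cINF_lower bdd)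
      also have "\<dots> \<le> f s + L * (dist x y + dist y s)" using L by (intro add_left_mono mult_left_mono dist_triangle)
      finally show ?thesis by (simp add: algebra_simps)
    qed
    then have "g x - L * dist x y \<le> g y" unfolding g_def[of y] using assms(2) by (intro cINF_greatest) auto
    then show ?thesis by simp
  qed
  have "L-lipschitz_on UNIV g"
  proof (rule lipschitz_onI)
    fix x y show "dist (g x) (g y) \<le> L * dist x y"
      using le[of x y] le[of y x] by (auto simp: dist_real_def dist_commute)
  qed (rule L)
  moreover have "g x = f x" if "x \<in> S" for x
  proof (rule antisym)
    have "g x \<le> f x + L * dist x x" unfolding g_def using that by (intro cINF_lower bdd)
    then show "g x \<le> f x" by simp
    show "f x \<le> g x" unfolding g_def
    proof (rule cINF_greatest)
      fix s assume "s \<in> S"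
      then show "f x \<le> f s + L * dist x s" using lipschitz_onD[OF f that \<open>s \<in> S\<close>] by (auto simp: dist_real_def)
    qed (use assms in auto)
  qed
  ultimately show ?thesis by blast
qed

lemma lipschitz_AE_derivative_within:
  fixes c :: "real \<Rightarrow> real ^ 'n"
  assumes "L-lipschitz_on S c" "S \<noteq> {}"
  shows "AE t in lborel. t \<in> S \<longrightarrow> (\<exists>v. (c has_vector_derivative v) (at t within S))"
proof -
  have "L-lipschitz_on S (\<lambda>t. c t $ i)" for i
  proof (rule lipschitz_onI)
    fix x y assume "x \<in> S" "y \<in> S"
    then show "dist (c x $ i) (c y $ i) \<le> L * dist x y"
      using lipschitz_onD[OF assms(1)] dist_vec_nth_le[of "c x" i "c y"] by (meson order_trans)
  qed (rule lipschitz_on_nonneg[OF assms(1)])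
  then have "\<forall>i. \<exists>g. L-lipschitz_on UNIV g \<and> (\<forall>t\<in>S. g t = c t $ i)"
    using lipschitz_extension_real[OF _ assms(2)] by blast
  then obtain g where g: "\<And>i. L-lipschitz_on UNIV (g i)" "\<And>i t. t \<in> S \<Longrightarrow> g i t = c t $ i" by metis
  have "AE t in lborel. \<forall>i. g i differentiable (at t)"
    using lipschitz_imp_AE_differentiable[OF g(1)] by (subst AE_all_countable) auto
  then show ?thesis
  proof eventually_elim
    case (elim t)
    show ?case
    proof
      assume t: "t \<in> S"
      obtain d where d: "\<And>i. (g i has_field_derivative d i) (at t)"
        using elim unfolding real_differentiable_def by metis
      have "((\<lambda>t. c t $ i) has_derivative (\<lambda>x. (x *\<^sub>R (\<chi> i. d i)) $ i)) (at t within S)" for i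
      proof -
        have "(g i has_derivative (\<lambda>x. d i * x)) (at t within S)"
          using d[of i] by (simp add: has_field_derivative_def has_derivative_at_withinI)
        then have "(g i has_derivative (\<lambda>x. (x *\<^sub>R (\<chi> i. d i)) $ i)) (at t within S)"
          by (simp add: mult.commute)
        then show ?thesis by (rule has_derivative_transform[OF t, rotated]) (simp add: g(2))
      qed
      then have "(c has_derivative (\<lambda>x. x *\<^sub>R (\<chi> i. d i))) (at t within S)"
        by (subst has_derivative_componentwise_within) (auto simp: Basis_vec_def inner_axis)
      then show "\<exists>v. (c has_vector_derivative v) (at t within S)"
        by (auto simp: has_vector_derivative_def)
    qed
  qed
qed

text \<open>At an isolated point every vector is a derivative within the set, so such times must be
  discarded before a derivative can be placed in a cone. A density point is never isolated.\<close>

lemma AE_limit_point: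
  fixes S :: "real set"
  assumes "S \<in> sets borel"
  shows "AE t in lborel. t \<in> S \<longrightarrow> t islimpt S"
  using lebesgue_density_real[OF assms]
proof eventually_elim
  case (elim t)
  show ?case
  proof
    assume "t \<in> S"
    then obtain h0 where h0: "h0 > 0" "\<And>h. 0 < h \<Longrightarrow> h < h0 \<Longrightarrow> emeasure lborel ({t-h..t+h} - S) \<le> ennreal (1 * h)"
      using elim by (metis zero_less_one)
    have "\<exists>s\<in>S. s \<noteq> t \<and> dist s t < e" if "e > 0" for e
    proof (rule ccontr)
      assume no: "\<not> ?thesis"
      define h where "h = min e h0 / 2"
      have h: "0 < h" "h < h0" "h < e" using \<open>e > 0\<close> h0(1) by (auto simp: h_def)
      have "ennreal (2 * h) = emeasure lborel ({t-h..t+h} - {t})"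
        using h by (subst emeasure_Diff_null_set) (auto simp: null_sets_def)
      also have "\<dots> \<le> emeasure lborel ({t-h..t+h} - S)"
        using no h assms by (intro emeasure_mono) (force simp: dist_real_def abs_less_iff)+
      also have "\<dots> \<le> ennreal (1 * h)" by (rule h0(2)[OF h(1,2)])
      finally show False using h by (simp add: ennreal_le_iff)
    qed
    then show "t islimpt S" by (auto simp: islimpt_approachable)
  qed
qed

lemma is_cone_closed:
  assumes "is_cone C"
  shows "closed C" and "v \<in> C \<Longrightarrow> a *\<^sub>R v \<in> C"
proof -
  obtain w \<theta> where C: "C = {v. \<bar>v \<bullet> w\<bar> \<ge> \<theta> * norm v}" using assms by (auto simp: is_cone_def)
  show "closed C" unfolding C by (intro closed_Collect_le continuous_intros)
  assume v: "v \<in> C"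
  have "\<bar>a\<bar> * (\<theta> * norm v) \<le> \<bar>a\<bar> * \<bar>v \<bullet> w\<bar>" using v by (intro mult_left_mono) (auto simp: C)
  then show "a *\<^sub>R v \<in> C" by (simp add: C abs_mult mult_ac)
qed

text \<open>Difference quotients stay in the cone, which is closed and invariant under all real
  factors, including the negative ones that arise for \<open>s < t\<close>; the lower speed bound
  keeps the limit away from 0.\<close>

lemma C_curve_derivative:
  assumes C: "is_cone C" and \<gamma>: "C_curve \<phi> C \<gamma>" and t: "t \<in> frag_dom \<gamma>" "t islimpt frag_dom \<gamma>"
    and v: "((\<lambda>t. \<phi> (frag_map \<gamma> t)) has_vector_derivative v) (at t within frag_dom \<gamma>)"
  shows "v \<in> C - {0}"
proof -
  obtain \<delta> where \<delta>: "\<delta> > 0" "\<And>s. s \<in> frag_dom \<gamma> \<Longrightarrow> \<phi> (frag_map \<gamma> s) - \<phi> (frag_map \<gamma> t) \<in> C"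
    "\<And>s. s \<in> frag_dom \<gamma> \<Longrightarrow> norm (\<phi> (frag_map \<gamma> s) - \<phi> (frag_map \<gamma> t)) \<ge> \<delta> * \<bar>t - s\<bar>"
    using \<gamma> t(1) unfolding C_curve_def by blast
  let ?q = "\<lambda>s. (\<phi> (frag_map \<gamma> s) - \<phi> (frag_map \<gamma> t)) /\<^sub>R (s - t)"
  have lim: "(?q \<longlongrightarrow> v) (at t within frag_dom \<gamma>)"
  proof (rule tendstoI)
    fix e :: real assume "e > 0"
    then have "e / 2 > 0" by simp
    then obtain d where d: "d > 0" "\<And>s. s \<in> frag_dom \<gamma> \<Longrightarrow> norm (s - t) < d \<Longrightarrow>
        norm (\<phi> (frag_map \<gamma> s) - \<phi> (frag_map \<gamma> t) - (s - t) *\<^sub>R v) \<le> e / 2 * norm (s - t)"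
      using v unfolding has_vector_derivative_def has_derivative_within_alt by meson
    have "dist (?q s) v < e" if s: "s \<in> frag_dom \<gamma>" "s \<noteq> t" "dist s t < d" for s
    proof -
      have "?q s - v = (\<phi> (frag_map \<gamma> s) - \<phi> (frag_map \<gamma> t) - (s - t) *\<^sub>R v) /\<^sub>R (s - t)"
        using s(2) by (simp add: scaleR_diff_right)
      then have "dist (?q s) v = norm (\<phi> (frag_map \<gamma> s) - \<phi> (frag_map \<gamma> t) - (s - t) *\<^sub>R v) / \<bar>s - t\<bar>"
        by (simp add: dist_norm divide_inverse_commute)
      also have "\<dots> \<le> e / 2"
        using d(2)[OF s(1)] s(2,3) by (subst pos_divide_le_eq) (auto simp: dist_real_def)
      finally show ?thesis using \<open>e > 0\<close> by simp
    qed
    then show "\<forall>\<^sub>F s in at t within frag_dom \<gamma>. dist (?q s) v < e"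
      using d(1) unfolding eventually_at by blast
  qed
  have nt: "at t within frag_dom \<gamma> \<noteq> bot" using t(2) by (simp add: trivial_limit_within)
  have ev: "\<forall>\<^sub>F s in at t within frag_dom \<gamma>. s \<in> frag_dom \<gamma> \<and> s \<noteq> t"
    by (simp add: eventually_at_filter)
  have "\<forall>\<^sub>F s in at t within frag_dom \<gamma>. ?q s \<in> C"
    using ev by eventually_elim (intro is_cone_closed(2)[OF C] \<delta>(2), blast)
  then have "v \<in> C" using nt lim by (rule Lim_in_closed_set[OF is_cone_closed(1)[OF C]])
  have "\<forall>\<^sub>F s in at t within frag_dom \<gamma>. \<delta> \<le> norm (?q s)"
    using ev
  proof eventually_elim
    case (elim s)
    then have "\<delta> * \<bar>s - t\<bar> \<le> norm (\<phi> (frag_map \<gamma> s) - \<phi> (frag_map \<gamma> t))" "\<bar>s - t\<bar> > 0"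
      using \<delta>(3)[of s] by (auto simp: abs_minus_commute)
    then show ?case by (simp add: pos_le_divide_eq flip: divide_inverse_commute)
  qed
  then have "\<delta> \<le> norm v" by (rule tendsto_lowerbound[OF tendsto_norm[OF lim] _ nt])
  then show ?thesis using \<open>v \<in> C\<close> \<delta>(1) by auto
qed

text \<open>The true derivative is replaced by a nearby vector of the countable set \<open>D\<close>
  and the time by a nearby rational, so that countably many indices suffice.\<close>

lemma C_curve_straight_pairs_cover:
  fixes \<phi> :: "'a::metric_space \<Rightarrow> real ^ 'n"
  assumes \<phi>: "L-lipschitz_on UNIV \<phi>" and C: "is_cone C" and \<gamma>: "C_curve \<phi> C \<gamma>"
    and D: "C - {0} \<subseteq> closure D" and "\<eta> > 0"
  shows "AE t in lborel. t \<in> frag_dom \<gamma> \<longrightarrow> (\<exists>i\<in>D \<times> \<rat> \<times> UNIV. (\<gamma>, t) \<in> straight_pairs \<phi> \<eta> i)"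
proof -
  let ?c = "\<lambda>t. \<phi> (frag_map \<gamma> t)"
  have L: "L \<ge> 0" using \<phi> by (rule lipschitz_on_nonneg)
  have "(L * 2)-lipschitz_on (frag_dom \<gamma>) ?c"
  proof (rule lipschitz_onI)
    fix s t assume st: "s \<in> frag_dom \<gamma>" "t \<in> frag_dom \<gamma>"
    have "dist (?c s) (?c t) \<le> L * dist (frag_map \<gamma> s) (frag_map \<gamma> t)" using lipschitz_onD[OF \<phi>] by auto
    also have "\<dots> \<le> L * (2 * \<bar>s - t\<bar>)" using frag_bilipschitz[OF st] L by (intro mult_left_mono) auto
    finally show "dist (?c s) (?c t) \<le> L * 2 * dist s t" by (simp add: dist_real_def)
  qed (use L in auto)
  from lipschitz_AE_derivative_within[OF this frag_dom_nonempty]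
    AE_limit_point[OF borel_compact[OF compact_frag_dom[of \<gamma>]]]
  show ?thesis
  proof eventually_elim
    case (elim t)
    show ?case
    proof
      assume t: "t \<in> frag_dom \<gamma>"
      obtain v0 where v0: "(?c has_vector_derivative v0) (at t within frag_dom \<gamma>)" using elim t by blast
      have v0C: "v0 \<in> C - {0}" using C_curve_derivative[OF C \<gamma> t _ v0] elim t by blast
      \<comment> \<open>The first bound gives \<open>norm v \<ge> norm v0 / 2\<close>; the second
        limits the cost of exchanging \<open>v0\<close> for \<open>v\<close> to
        \<open>\<eta> * norm v0 / 4\<close>. With an equal error from differentiability the total is
        at most \<open>\<eta> * norm v\<close>.\<close>
      define m where "m = min (norm v0 / 2) (\<eta> * norm v0 / 4)"
      have m: "m > 0" using v0C \<open>\<eta> > 0\<close> by (auto simp: m_def)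
      obtain v where v: "v \<in> D" "dist v v0 < m" using v0C D m closure_approachable by (metis subsetD)
      have vn: "norm v0 / 2 \<le> norm v" "norm (v - v0) \<le> \<eta> * norm v0 / 4"
        using v(2) norm_triangle_ineq2[of v0 v] by (auto simp: m_def dist_norm norm_minus_commute)
      have "\<eta> * norm v0 / 4 > 0" using v0C \<open>\<eta> > 0\<close> by auto
      then obtain d where d: "d > 0" "\<And>s. s \<in> frag_dom \<gamma> \<Longrightarrow> norm (s - t) < d \<Longrightarrow>
          norm (?c s - ?c t - (s - t) *\<^sub>R v0) \<le> \<eta> * norm v0 / 4 * norm (s - t)"
        using v0 unfolding has_vector_derivative_def has_derivative_within_alt by meson
      \<comment> \<open>Both \<open>s\<close> and \<open>t\<close> lie within
        \<open>1 / real (Suc k)\<close> of \<open>q\<close>, hence within \<open>d\<close> of each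
        other.\<close>
      obtain k where k: "1 / real (Suc k) < d / 2" using nat_approx_posE[of "d / 2"] d(1) by auto
      obtain q where q: "q \<in> \<rat>" "t - 1 / real (Suc k) < q" "q < t + 1 / real (Suc k)"
        using Rats_dense_in_real[of "t - 1 / real (Suc k)" "t + 1 / real (Suc k)"] by auto
      have "norm (?c s - ?c t - (s - t) *\<^sub>R v) \<le> \<eta> * norm v * \<bar>s - t\<bar>"
        if s: "s \<in> frag_dom \<gamma>" "\<bar>s - q\<bar> < 1 / real (Suc k)" for s
      proof -
        have sd: "norm (s - t) < d" using s(2) q k by (auto simp: abs_if split: if_splits)
        have "?c s - ?c t - (s - t) *\<^sub>R v = (?c s - ?c t - (s - t) *\<^sub>R v0) - (s - t) *\<^sub>R (v - v0)"
          by (simp add: algebra_simps)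
        then have "norm (?c s - ?c t - (s - t) *\<^sub>R v) \<le> norm (?c s - ?c t - (s - t) *\<^sub>R v0) + norm ((s - t) *\<^sub>R (v - v0))"
          by (metis norm_triangle_ineq4)
        also have "\<dots> \<le> \<eta> * norm v0 / 4 * \<bar>s - t\<bar> + \<bar>s - t\<bar> * (\<eta> * norm v0 / 4)"
          using d(2)[OF s(1) sd] mult_left_mono[OF vn(2), of "\<bar>s - t\<bar>"] by (intro add_mono) auto
        also have "\<dots> = \<eta> * (norm v0 / 2) * \<bar>s - t\<bar>" by (simp add: algebra_simps)
        also have "\<dots> \<le> \<eta> * norm v * \<bar>s - t\<bar>"
          using vn(1) \<open>\<eta> > 0\<close> by (intro mult_right_mono mult_left_mono) auto
        finally show ?thesis .
      qed
      moreover have "\<bar>t - q\<bar> < 1 / real (Suc k)" using q by (simp add: abs_less_iff)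
      ultimately have "(\<gamma>, t) \<in> straight_pairs \<phi> \<eta> (v, q, k)" using t by (auto simp: straight_pairs_def)
      then show "\<exists>i\<in>D \<times> \<rat> \<times> UNIV. (\<gamma>, t) \<in> straight_pairs \<phi> \<eta> i"
        using v(1) q(1) by (intro bexI[of _ "(v, q, k)"]) auto
    qed
  qed
qed

section \<open>Transport along one representation\<close>

text \<open>On \<open>S1\<close> the densities of \<open>N i\<close> and \<open>N' i m\<close> relative to \<open>\<mu>\<close> are pinched between \<open>c / 2\<close> and
  \<open>2 * c\<close>. The bound on their ratio does not depend on \<open>i\<close>, hence not on \<open>\<eta>\<close>, and this is what allows
  \<open>\<eta>\<close> to be chosen after the number of grid points in the counting argument.\<close>

lemma density_selection:
  fixes \<nu> \<mu> :: "'x measure" and N :: "'i \<Rightarrow> 'x measure" and N' :: "'i \<Rightarrow> nat \<Rightarrow> 'x measure"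
  assumes \<nu>: "finite_measure \<nu>" and \<mu>: "finite_measure \<mu>" "sets \<mu> = sets \<nu>" "absolutely_continuous \<nu> \<mu>"
    and N: "\<And>i. sets (N i) = sets \<nu>" "\<And>i E. E \<in> sets \<nu> \<Longrightarrow> emeasure (N i) E \<le> emeasure \<nu> E"
    and N': "\<And>i m. sets (N' i m) = sets \<nu>" "\<And>i m E. E \<in> sets \<nu> \<Longrightarrow> emeasure (N' i m) E \<le> emeasure (N i) E"
    and cover: "\<And>E. E \<in> sets \<nu> \<Longrightarrow> emeasure \<nu> E > 0 \<Longrightarrow> \<exists>i\<in>I. emeasure (N i) E > 0"
    and sup: "\<And>i E. i \<in> I \<Longrightarrow> E \<in> sets \<nu> \<Longrightarrow> emeasure (N i) E \<le> (SUP m. emeasure (N' i m) E)"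
    and S0: "S0 \<in> sets \<nu>" "emeasure \<mu> S0 > 0"
  obtains i m c S1 where "i \<in> I" "c > 0" "S1 \<in> sets \<nu>" "S1 \<subseteq> S0" "emeasure \<mu> S1 > 0"
    "\<And>E. E \<in> sets \<nu> \<Longrightarrow> E \<subseteq> S1 \<Longrightarrow> ennreal c * emeasure \<mu> E \<le> 2 * emeasure (N' i m) E"
    "\<And>E. E \<in> sets \<nu> \<Longrightarrow> E \<subseteq> S1 \<Longrightarrow> emeasure (N i) E \<le> ennreal (2 * c) * emeasure \<mu> E"
proof -
  interpret \<nu>: finite_measure \<nu> by fact
  interpret \<mu>: finite_measure \<mu> by fact
  define g where "g = RN_deriv \<nu> \<mu>"
  have g[measurable]: "g \<in> borel_measurable \<nu>" by (simp add: g_def)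
  have gd: "density \<nu> g = \<mu>" unfolding g_def by (rule \<nu>.density_RN_deriv[OF \<mu>(3,2)])
  have gI: "emeasure \<mu> E = (\<integral>\<^sup>+x. g x * indicator E x \<partial>\<nu>)" if "E \<in> sets \<nu>" for E
    unfolding gd[symmetric] by (rule emeasure_density[OF g that])
  have gfin: "AE x in \<nu>. g x \<noteq> \<infinity>"
    unfolding g_def by (rule \<nu>.RN_deriv_finite[OF \<mu>.sigma_finite_measure_axioms \<mu>(3,2)])
  define f where "f M = RN_deriv \<nu> M" for M
  have f[measurable]: "f M \<in> borel_measurable \<nu>" for M by (simp add: f_def)
  have le_ac: "absolutely_continuous \<nu> M" if "sets M = sets \<nu>" "\<And>E. E \<in> sets \<nu> \<Longrightarrow> emeasure M E \<le> emeasure \<nu> E" for M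
    unfolding absolutely_continuous_def
  proof
    fix A assume A: "A \<in> null_sets \<nu>"
    then have "emeasure M A \<le> 0" using that(2)[of A] by (auto simp: null_sets_def)
    then show "A \<in> null_sets M" using A that(1) by (auto simp: null_sets_def)
  qed
  have fI: "emeasure M E = (\<integral>\<^sup>+x. f M x * indicator E x \<partial>\<nu>)"
    if "sets M = sets \<nu>" "\<And>E. E \<in> sets \<nu> \<Longrightarrow> emeasure M E \<le> emeasure \<nu> E" "E \<in> sets \<nu>" for M E
  proof -
    have "density \<nu> (f M) = M" unfolding f_def by (rule \<nu>.density_RN_deriv[OF le_ac[OF that(1,2)] that(1)])
    then show ?thesis using emeasure_density[OF f that(3), of M] by simp
  qed
  have fN: "emeasure (N i) E = (\<integral>\<^sup>+x. f (N i) x * indicator E x \<partial>\<nu>)" if "E \<in> sets \<nu>" for i E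
    by (rule fI[OF N(1) N(2) that])
  have fN': "emeasure (N' i m) E = (\<integral>\<^sup>+x. f (N' i m) x * indicator E x \<partial>\<nu>)" if "E \<in> sets \<nu>" for i m E
    by (rule fI[OF N'(1) order_trans[OF N'(2) N(2)] that])
  have pos: "emeasure \<nu> {x \<in> E. h x > 0} > 0"
    if "(\<integral>\<^sup>+x. h x * indicator E x \<partial>\<nu>) > 0" "E \<in> sets \<nu>" and [measurable]: "h \<in> borel_measurable \<nu>" for h and E
  proof (rule ccontr)
    have [measurable]: "E \<in> sets \<nu>" by fact
    have s: "{x \<in> E. h x > 0} = {x \<in> space \<nu>. x \<in> E \<and> h x > 0}" using sets.sets_into_space[OF that(2)] by auto
    assume "\<not> ?thesis"
    then have "{x \<in> space \<nu>. x \<in> E \<and> h x > 0} \<in> null_sets \<nu>" by (auto simp: s null_sets_def)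
    then have "AE x in \<nu>. \<not> (x \<in> E \<and> h x > 0)" by (rule AE_I') (auto simp: zero_less_iff_neq_zero)
    then have "AE x in \<nu>. h x * indicator E x = 0" by eventually_elim (auto simp: indicator_def)
    then have "(\<integral>\<^sup>+x. h x * indicator E x \<partial>\<nu>) = 0" by (simp add: nn_integral_0_iff_AE)
    then show False using that(1) by simp
  qed
  have AEpos: "emeasure \<nu> {x \<in> E. Q x} > 0" if "AE x in \<nu>. Q x" "emeasure \<nu> E > 0" "E \<in> sets \<nu>" "Measurable.pred \<nu> Q" for Q E
  proof -
    have [measurable]: "E \<in> sets \<nu>" "Measurable.pred \<nu> Q" by fact+
    have s: "{x \<in> E. Q x} = {x \<in> space \<nu>. x \<in> E \<and> Q x}" using sets.sets_into_space[OF that(3)] by auto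
    have "{x \<in> E. Q x} \<in> sets \<nu>" unfolding s by measurable
    then have "emeasure \<nu> {x \<in> E. Q x} = emeasure \<nu> E" using that(1,3) by (intro emeasure_eq_AE) auto
    then show ?thesis using that(2) by simp
  qed
  have [measurable]: "S0 \<in> sets \<nu>" by fact
  define S0' where "S0' = {x \<in> {x \<in> S0. g x > 0}. g x \<noteq> \<infinity>}"
  have s0: "{x \<in> S0. g x > 0} \<in> sets \<nu>" 
  proof -
    have "{x \<in> S0. g x > 0} = {x \<in> space \<nu>. x \<in> S0 \<and> g x > 0}" using sets.sets_into_space[OF S0(1)] by auto
    then show ?thesis by simp
  qed
  have S0': "S0' \<in> sets \<nu>" "emeasure \<nu> S0' > 0"
  proof -
    have "S0' = {x \<in> space \<nu>. x \<in> S0 \<and> g x > 0 \<and> g x \<noteq> \<infinity>}" using sets.sets_into_space[OF S0(1)] by (auto simp: S0'_def)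
    then show "S0' \<in> sets \<nu>" by simp
    show "emeasure \<nu> S0' > 0" unfolding S0'_def
      using s0 pos[of g S0] S0 gI[of S0] by (intro AEpos[OF gfin]) auto
  qed
  obtain i where i: "i \<in> I" "emeasure (N i) S0' > 0" using cover[OF S0'] by blast
  let ?f = "f (N i)"
  have sfN: "sigma_finite_measure (N i)"
  proof -
    have "emeasure (N i) (space (N i)) \<le> emeasure \<nu> (space \<nu>)"
      using N(2)[OF sets.top, of i] sets_eq_imp_space_eq[OF N(1)] by simp
    then have "finite_measure (N i)" by (intro finite_measureI) (auto simp: top_unique)
    then show ?thesis by (rule finite_measure.axioms(1))
  qed
  have ffin: "AE x in \<nu>. ?f x \<noteq> \<infinity>"
    unfolding f_def by (rule \<nu>.RN_deriv_finite[OF sfN le_ac[OF N(1) N(2)] N(1)])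
  define S1' where "S1' = {x \<in> {x \<in> S0'. ?f x > 0}. ?f x \<noteq> \<infinity>}"
  have [measurable]: "S0' \<in> sets \<nu>" by fact
  have s1: "{x \<in> S0'. ?f x > 0} \<in> sets \<nu>" 
  proof -
    have "{x \<in> S0'. ?f x > 0} = {x \<in> space \<nu>. x \<in> S0' \<and> ?f x > 0}" using sets.sets_into_space[OF S0'(1)] by auto
    then show ?thesis by simp
  qed
  have S1': "emeasure \<nu> S1' > 0"
    unfolding S1'_def using s1 pos[of ?f S0'] S0' i fN[of S0' i] by (intro AEpos[OF ffin]) auto
  \<comment> \<open>Dyadic bands for the ratio of \<open>?f\<close> to \<open>g\<close>, which is
    finite and positive on \<open>S1'\<close>. There are countably many, so one of them has positive
    measure; its lower end becomes the constant \<open>c\<close>.\<close>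
  define c where "c j = (2::real) powr real_of_int j" for j :: int
  have cpos: "c j > 0" for j by (simp add: c_def)
  define S where "S j = {x \<in> space \<nu>. x \<in> S0' \<and> ennreal (c j) * g x \<le> ?f x \<and> ?f x \<le> ennreal (2 * c j) * g x}" for j
  have Sm[measurable]: "S j \<in> sets \<nu>" for j unfolding S_def by measurable
  have "S1' \<subseteq> (\<Union>j. S j)"
  proof
    fix x assume x: "x \<in> S1'"
    obtain a where a: "g x = ennreal a" "a > 0"
      using x by (cases "g x") (auto simp: S1'_def S0'_def)
    obtain b where b: "?f x = ennreal b" "b > 0"
      using x by (cases "?f x") (auto simp: S1'_def S0'_def)
    define j where "j = \<lfloor>log 2 (b / a)\<rfloor>"
    have r: "b / a = 2 powr (log 2 (b / a))" using a b by simp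
    have "c j \<le> b / a" unfolding c_def j_def by (subst (2) r) (intro powr_mono, auto)
    moreover have "b / a \<le> 2 * c j"
    proof -
      have "b / a \<le> 2 powr (real_of_int j + 1)" unfolding j_def
        by (subst r) (intro powr_mono, linarith, simp)
      then show ?thesis by (simp add: c_def powr_add)
    qed
    ultimately have "c j * a \<le> b" "b \<le> 2 * c j * a" using a by (auto simp: field_simps)
    then have "x \<in> S j"
      using x a b cpos[of j] sets.sets_into_space[OF S0'(1)]
      by (auto simp: S_def S1'_def simp flip: ennreal_mult intro!: ennreal_leI)
    then show "x \<in> (\<Union>j. S j)" by blast
  qed
  then have "emeasure \<nu> (\<Union>j. S j) > 0"
    using S1' by (intro less_le_trans[OF S1' emeasure_mono]) auto
  have "\<exists>j. emeasure \<nu> (S j) > 0"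
  proof (rule ccontr)
    assume "\<nexists>j. emeasure \<nu> (S j) > 0"
    then have "S j \<in> null_sets \<nu>" for j by (auto simp: null_sets_def)
    then have "(\<Union>j. S j) \<in> null_sets \<nu>" by (intro null_sets_UN')  auto
    then show False using \<open>emeasure \<nu> (\<Union>j. S j) > 0\<close> by auto
  qed
  then obtain j where j: "emeasure \<nu> (S j) > 0" by blast
  define T where "T m = {x \<in> space \<nu>. x \<in> S j \<and> ?f x \<le> 2 * f (N' i m) x}" for m
  have Tm[measurable]: "T m \<in> sets \<nu>" for m unfolding T_def by measurable
  \<comment> \<open>If every \<open>T m\<close> were null, each \<open>N' i m\<close> would carry at
    most half of the mass of \<open>N i\<close> on \<open>S j\<close>. That mass is finite, so the
    supremum condition would force it to be zero, although \<open>?f\<close> is positive on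
    \<open>S j\<close>.\<close>
  have "\<exists>m. emeasure \<nu> (T m) > 0"
  proof (rule ccontr)
    assume no: "\<nexists>m. emeasure \<nu> (T m) > 0"
    have half: "2 * emeasure (N' i m) (S j) \<le> emeasure (N i) (S j)" for m
    proof -
      have "T m \<in> null_sets \<nu>" using no by (auto simp: null_sets_def)
      then have "AE x in \<nu>. x \<notin> T m" by (rule AE_not_in)
      then have ae: "AE x in \<nu>. 2 * f (N' i m) x * indicator (S j) x \<le> ?f x * indicator (S j) x"
        using AE_space by eventually_elim (auto simp: T_def indicator_def)
      have "2 * emeasure (N' i m) (S j) = (\<integral>\<^sup>+x. 2 * (f (N' i m) x * indicator (S j) x) \<partial>\<nu>)"
        by (subst fN'[of "S j" i m]) (auto simp: nn_integral_cmult)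
      also have "\<dots> \<le> emeasure (N i) (S j)"
        unfolding fN[OF Sm] using ae by (intro nn_integral_mono_AE) (simp add: mult.assoc)
      finally show ?thesis .
    qed
    have "2 * emeasure (N i) (S j) \<le> 2 * (SUP m. emeasure (N' i m) (S j))"
      by (intro mult_left_mono sup i Sm) auto
    also have "\<dots> = (SUP m. 2 * emeasure (N' i m) (S j))" by (simp add: SUP_mult_left_ennreal)
    also have "\<dots> \<le> emeasure (N i) (S j)" by (intro SUP_least half)
    finally have le: "2 * emeasure (N i) (S j) \<le> emeasure (N i) (S j)" .
    have "emeasure (N i) (S j) < \<infinity>"
      using N(2)[OF Sm[of j], of i] \<nu>.emeasure_finite[of "S j"] by (auto simp: less_top[symmetric] top_unique)
    then obtain r where r: "emeasure (N i) (S j) = ennreal r" "r \<ge> 0" by (cases "emeasure (N i) (S j)") auto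
    have "ennreal (2 * r) \<le> ennreal r" using le r by (simp add: ennreal_mult)
    then have "r = 0" using r by (simp add: ennreal_le_iff)
    then have "(\<integral>\<^sup>+x. ?f x * indicator (S j) x \<partial>\<nu>) = 0" using fN[OF Sm, of i] r by simp
    then have "AE x in \<nu>. ?f x * indicator (S j) x = 0" by (simp add: nn_integral_0_iff_AE)
    then have "AE x in \<nu>. x \<notin> S j"
    proof eventually_elim
      case (elim x)
      show ?case
      proof
        assume x: "x \<in> S j"
        then have "?f x = 0" using elim by simp
        then have "ennreal (c j) * g x = 0" using x by (auto simp: S_def)
        then show False using x cpos[of j] by (auto simp: S_def S0'_def)
      qed
    qed
    then have "emeasure \<nu> (S j) = 0" using sets.sets_into_space[OF Sm]
      by (subst (asm) AE_iff_measurable[OF Sm]) auto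
    then show False using j by simp
  qed
  then obtain m where m: "emeasure \<nu> (T m) > 0" by blast
  show thesis
  proof (rule that[of i "c j" "T m" m])
    show "i \<in> I" "c j > 0" "T m \<in> sets \<nu>" by (auto simp: i cpos)
    show "T m \<subseteq> S0" by (auto simp: T_def S_def S0'_def)
    show "emeasure \<mu> (T m) > 0"
    proof (rule ccontr)
      assume "\<not> ?thesis"
      then have "(\<integral>\<^sup>+x. g x * indicator (T m) x \<partial>\<nu>) = 0" using gI[OF Tm] by simp
      then have "AE x in \<nu>. g x * indicator (T m) x = 0" by (simp add: nn_integral_0_iff_AE)
      then have "AE x in \<nu>. x \<notin> T m"
        by eventually_elim (auto simp: T_def S_def S0'_def indicator_def)
      then have "emeasure \<nu> (T m) = 0" using sets.sets_into_space[OF Tm]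
        by (subst (asm) AE_iff_measurable[OF Tm]) auto
      then show False using m by simp
    qed
    fix E assume E: "E \<in> sets \<nu>" "E \<subseteq> T m"
    have [measurable]: "E \<in> sets \<nu>" by fact
    have "ennreal (c j) * emeasure \<mu> E = (\<integral>\<^sup>+x. ennreal (c j) * (g x * indicator E x) \<partial>\<nu>)"
      by (subst gI[OF E(1)]) (auto simp: nn_integral_cmult)
    also have "\<dots> \<le> (\<integral>\<^sup>+x. 2 * (f (N' i m) x * indicator E x) \<partial>\<nu>)"
      using E(2) by (intro nn_integral_mono) (auto simp: T_def S_def indicator_def intro: order_trans)
    also have "\<dots> = 2 * emeasure (N' i m) E"
      by (subst fN'[OF E(1)]) (auto simp: nn_integral_cmult)
    finally show "ennreal (c j) * emeasure \<mu> E \<le> 2 * emeasure (N' i m) E" .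
    have "emeasure (N i) E = (\<integral>\<^sup>+x. ?f x * indicator E x \<partial>\<nu>)" by (rule fN[OF E(1)])
    also have "\<dots> \<le> (\<integral>\<^sup>+x. ennreal (2 * c j) * (g x * indicator E x) \<partial>\<nu>)"
      using E(2) by (intro nn_integral_mono) (auto simp: T_def S_def indicator_def)
    also have "\<dots> = ennreal (2 * c j) * emeasure \<mu> E"
      by (subst gI[OF E(1)]) (auto simp: nn_integral_cmult)
    finally show "emeasure (N i) E \<le> ennreal (2 * c j) * emeasure \<mu> E" .
  qed
qed

text \<open>A curve that meets the ball at a density time spends time comparable to \<open>b / norm v\<close> both in
  that ball and in the tripled ball displaced by \<open>A\<close> in direction \<open>v\<close>.\<close>

lemma straight_transport:
  fixes c :: "real \<Rightarrow> 'b::real_normed_vector"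
  assumes G: "G \<in> sets borel" "G' \<subseteq> G"
    and flat: "\<And>s t. s \<in> G \<Longrightarrow> t \<in> G \<Longrightarrow> norm (c s - c t - (s - t) *\<^sub>R v) \<le> \<eta> * norm v * \<bar>s - t\<bar>"
    and dens: "\<And>t h. t \<in> G' \<Longrightarrow> h \<in> \<rat> \<Longrightarrow> 0 < h \<Longrightarrow> h < h1 \<Longrightarrow> ennreal ((1 - \<eta>) * h) \<le> emeasure lborel (G \<inter> {t<..<t+h})"
    and v: "v \<noteq> 0" and A: "0 \<le> A" "0 < b" "2 * \<eta> * (A + b) \<le> b" "A + b < norm v * h1" and \<eta>: "0 < \<eta>"
    and E2: "{t \<in> G. c t \<in> cball (y + A *\<^sub>R (v /\<^sub>R norm v)) (3 * b)} \<in> sets borel"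
  shows "emeasure lborel {t \<in> G'. c t \<in> cball y b} \<le>
    32 * emeasure lborel {t \<in> G. c t \<in> cball (y + A *\<^sub>R (v /\<^sub>R norm v)) (3 * b)}"
proof (cases "{t \<in> G'. c t \<in> cball y b} = {}")
  case True
  show ?thesis unfolding True by simp
next
  case False
  then obtain t0 where t0: "t0 \<in> G'" "c t0 \<in> cball y b" by auto
  let ?n = "norm v"
  have n: "?n > 0" using v by simp
  have \<eta>2: "\<eta> \<le> 1 / 2"
  proof -
    have "2 * \<eta> * b \<le> 2 * \<eta> * (A + b)" using A \<eta> by (intro mult_left_mono) auto
    then have "(2 * \<eta>) * b \<le> 1 * b" using A(3) by linarith
    then have "2 * \<eta> \<le> 1" using A(2) by (rule mult_right_le_imp_le)
    then show ?thesis by simp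
  qed
  \<comment> \<open>Two positions in the ball are at most \<open>2 * b\<close> apart, and for
    \<open>\<eta> \<le> 1 / 2\<close> a chord has at least half the length
    \<open>\<bar>t - t0\<bar> * norm v\<close>.\<close>
  have "{t \<in> G'. c t \<in> cball y b} \<subseteq> {t0 - 4 * b / ?n .. t0 + 4 * b / ?n}"
  proof
    fix t assume t: "t \<in> {t \<in> G'. c t \<in> cball y b}"
    have "dist (c t) (c t0) \<le> 2 * b"
      using t t0 dist_triangle[of "c t" "c t0" y] by (auto simp: dist_commute)
    then have "norm (c t - c t0) \<le> 2 * b" by (simp add: dist_norm)
    moreover have "norm ((t - t0) *\<^sub>R v) \<le> norm (c t - c t0) + norm (c t - c t0 - (t - t0) *\<^sub>R v)"
      by (metis norm_minus_commute norm_triangle_sub add.commute diff_diff_eq2 diff_add_cancel)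
    moreover have "norm (c t - c t0 - (t - t0) *\<^sub>R v) \<le> \<eta> * ?n * \<bar>t - t0\<bar>"
      using t t0 G by (intro flat) auto
    moreover have "\<eta> * ?n * \<bar>t - t0\<bar> \<le> 1 / 2 * ?n * \<bar>t - t0\<bar>" using \<eta>2 by (intro mult_right_mono) auto
    moreover have "norm ((t - t0) *\<^sub>R v) = \<bar>t - t0\<bar> * ?n" "1 / 2 * ?n * \<bar>t - t0\<bar> = \<bar>t - t0\<bar> * ?n / 2" by simp_all
    ultimately have "\<bar>t - t0\<bar> * ?n \<le> 4 * b" by linarith
    then have "\<bar>t - t0\<bar> \<le> 4 * b / ?n" using n by (simp add: field_simps)
    then show "t \<in> {t0 - 4 * b / ?n .. t0 + 4 * b / ?n}" by auto
  qed
  then have "emeasure lborel {t \<in> G'. c t \<in> cball y b} \<le> emeasure lborel {t0 - 4 * b / ?n .. t0 + 4 * b / ?n}"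
    by (intro emeasure_mono) auto
  also have "\<dots> = ennreal (8 * b / ?n)" using A n by simp
  finally have up: "emeasure lborel {t \<in> G'. c t \<in> cball y b} \<le> ennreal (8 * b / ?n)" .
  \<comment> \<open>\<open>h\<close> has to be rational because the density hypothesis only speaks
    of rational windows. The missing part of the window costs at most \<open>b / 2\<close> in
    length, since \<open>\<eta> * (A + b) \<le> b / 2\<close>; starting from
    \<open>A + 3 / 4 * b\<close>, a length \<open>b / 4\<close> beyond \<open>A\<close> survives.
    Against the upper bound \<open>8 * b\<close> this gives the factor 32.\<close>
  have "(A + 3 / 4 * b) / ?n < (A + b) / ?n" using A n by (intro divide_strict_right_mono) auto
  then obtain h where h: "h \<in> \<rat>" "(A + 3 / 4 * b) / ?n < h" "h < (A + b) / ?n" using Rats_dense_in_real by blast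
  have h': "A + 3 / 4 * b < h * ?n" "h * ?n < A + b" using h n by (auto simp: field_simps)
  have h0: "0 < h" using h(2) A n by (auto intro: le_less_trans[rotated])
  have h1: "h < h1" using h'(2) A(4) n by (metis mult.commute mult_less_cancel_right_pos order.strict_trans)
  define E where "E = {t \<in> G. c t \<in> cball (y + A *\<^sub>R (v /\<^sub>R ?n)) (3 * b)}"
  have "G \<inter> {t0<..<t0+h} \<subseteq> E \<union> {t0<..t0 + A / ?n}"
  proof
    fix t assume t: "t \<in> G \<inter> {t0<..<t0+h}"
    show "t \<in> E \<union> {t0<..t0 + A / ?n}"
    proof (cases "t \<le> t0 + A / ?n")
      case False
      have tn: "0 < t - t0" "A < (t - t0) * ?n" "(t - t0) * ?n < A + b"
      proof -
        show "0 < t - t0" using t by auto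
        show "A < (t - t0) * ?n" using False n by (simp add: field_simps)
        have "(t - t0) * ?n < h * ?n" using t n by (intro mult_strict_right_mono) auto
        then show "(t - t0) * ?n < A + b" using h'(2) by simp
      qed
      have 1: "norm (c t - c t0 - (t - t0) *\<^sub>R v) \<le> \<eta> * ?n * \<bar>t - t0\<bar>"
        using t t0 G by (intro flat) auto
      have "\<eta> * ?n * \<bar>t - t0\<bar> = \<eta> * ((t - t0) * ?n)" using tn by simp
      also have "\<dots> \<le> \<eta> * (A + b)" using tn \<eta> by (intro mult_left_mono) auto
      also have "\<dots> \<le> b / 2" using A by simp
      finally have 1: "norm (c t - c t0 - (t - t0) *\<^sub>R v) \<le> b / 2" using 1 by simp
      have 2: "norm (c t0 - y) \<le> b" using t0 by (simp add: dist_norm norm_minus_commute)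
      have "(t - t0) *\<^sub>R v - A *\<^sub>R (v /\<^sub>R ?n) = ((t - t0) - A / ?n) *\<^sub>R v"
        by (simp add: algebra_simps divide_inverse)
      then have "norm ((t - t0) *\<^sub>R v - A *\<^sub>R (v /\<^sub>R ?n)) = \<bar>(t - t0) - A / ?n\<bar> * ?n" by simp
      also have "\<dots> = \<bar>((t - t0) - A / ?n) * ?n\<bar>" by (simp add: abs_mult)
      also have "((t - t0) - A / ?n) * ?n = (t - t0) * ?n - A" using n by (simp add: algebra_simps)
      finally have 3: "norm ((t - t0) *\<^sub>R v - A *\<^sub>R (v /\<^sub>R ?n)) \<le> b" using tn by simp
      \<comment> \<open>Three errors: deviation from the straight line, at most
        \<open>b / 2\<close>; starting point, at most \<open>b\<close>; overshoot beyond
        \<open>A\<close>, at most \<open>b\<close>. Radius \<open>3 * b\<close> covers them.\<close>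
      have "c t - (y + A *\<^sub>R (v /\<^sub>R ?n)) = (c t - c t0 - (t - t0) *\<^sub>R v) + (c t0 - y) + ((t - t0) *\<^sub>R v - A *\<^sub>R (v /\<^sub>R ?n))"
        by simp
      then have "norm (c t - (y + A *\<^sub>R (v /\<^sub>R ?n))) \<le> b / 2 + b + b"
        using 1 2 3 by (metis (no_types, lifting) add_mono norm_triangle_le)
      then have "c t \<in> cball (y + A *\<^sub>R (v /\<^sub>R ?n)) (3 * b)"
        using A(2) by (simp add: dist_norm norm_minus_commute)
      then show ?thesis using t by (auto simp: E_def)
    qed (use t in auto)
  qed
  then have "emeasure lborel (G \<inter> {t0<..<t0+h}) \<le> emeasure lborel E + emeasure lborel {t0<..t0 + A / ?n}"
    using E2 by (intro order_trans[OF emeasure_mono emeasure_subadditive]) (auto simp: E_def)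
  then have low: "ennreal ((1 - \<eta>) * h) \<le> emeasure lborel E + ennreal (A / ?n)"
    using dens[OF t0(1) h(1) h0 h1] A n by simp
  have *: "b / (4 * ?n) + A / ?n \<le> (1 - \<eta>) * h"
  proof -
    have "\<eta> * (h * ?n) \<le> \<eta> * (A + b)" using h' \<eta> by (intro mult_left_mono) auto
    then have "(1 - \<eta>) * (h * ?n) \<ge> A + b / 4" using A(3) h'(1) by (simp add: algebra_simps)
    then show ?thesis using n by (simp add: field_simps)
  qed
  have "ennreal (b / (4 * ?n)) + ennreal (A / ?n) \<le> emeasure lborel E + ennreal (A / ?n)"
    using ennreal_leI[OF *] low A n by (simp flip: ennreal_plus)
  then have "ennreal (b / (4 * ?n)) \<le> emeasure lborel E"
    by (simp add: add.commute[of _ "ennreal (A / ?n)"] ennreal_add_left_cancel_le)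
  then have "32 * ennreal (b / (4 * ?n)) \<le> 32 * emeasure lborel E" by (intro mult_left_mono) auto
  moreover have "32 * ennreal (b / (4 * ?n)) = ennreal (8 * b / ?n)"
    using A n by (simp flip: ennreal_mult' ennreal_numeral)
  ultimately show ?thesis using up by (simp add: E_def)
qed

section \<open>Density points of the time sections\<close>

text \<open>Windows extend forward only, because transport follows increasing time. Rational
  \<open>h\<close> make the condition a countable intersection of measurable ones, and the parts
  increase with \<open>m\<close>, as the supremum condition of \<open>density_selection\<close>
  requires.\<close>

definition density_part :: "real \<Rightarrow> ('a \<times> real) set \<Rightarrow> nat \<Rightarrow> ('a \<times> real) set" where
  "density_part \<eta> G m = {(\<omega>, t) \<in> G. \<forall>h\<in>\<rat>. 0 < h \<and> h < 1 / real (Suc m) \<longrightarrow>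
     ennreal ((1 - \<eta>) * h) \<le> emeasure lborel ((Pair \<omega> -` G) \<inter> {t<..<t+h})}"

lemma density_part_subset: "density_part \<eta> G m \<subseteq> G"
  by (auto simp: density_part_def)

lemma density_part_mono: "m \<le> m' \<Longrightarrow> density_part \<eta> G m \<subseteq> density_part \<eta> G m'"
proof -
  assume m: "m \<le> m'"
  have "ennreal ((1 - \<eta>) * h) \<le> emeasure lborel (Pair a -` G \<inter> {b<..<b + h})"
    if *: "\<forall>h\<in>\<rat>. 0 < h \<and> h < 1 / real (Suc m) \<longrightarrow>
      ennreal ((1 - \<eta>) * h) \<le> emeasure lborel (Pair a -` G \<inter> {b<..<b + h})"
    and h: "h \<in> \<rat>" "0 < h" "h < 1 / real (Suc m')" for a b h
  proof -
    have "1 / real (Suc m') \<le> 1 / real (Suc m)" using m by (intro divide_left_mono) auto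
    then show "ennreal ((1 - \<eta>) * h) \<le> emeasure lborel (Pair a -` G \<inter> {b<..<b + h})"
      using * h by auto
  qed
  then show ?thesis unfolding density_part_def by blast
qed

lemma density_part_sets:
  assumes G[measurable]: "G \<in> sets (P \<Otimes>\<^sub>M borel)"
  shows "density_part \<eta> G m \<in> sets (P \<Otimes>\<^sub>M borel)"
proof -
  have [measurable]: "(\<lambda>x. emeasure lborel ((Pair (fst x) -` G) \<inter> {snd x<..<snd x+h})) \<in> borel_measurable (P \<Otimes>\<^sub>M borel)" for h
  proof -
    \<comment> \<open>The moving window is turned into a section of one measurable set in a triple
      product, so that measurability of section measures applies.\<close>
    define Q where "Q = {x \<in> space ((P \<Otimes>\<^sub>M borel) \<Otimes>\<^sub>M (lborel :: real measure)).
       (fst (fst x), snd x) \<in> G \<and> snd (fst x) < snd x \<and> snd x < snd (fst x) + h}"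
    have [measurable]: "(\<lambda>x. (fst (fst x), snd x)) \<in> (P \<Otimes>\<^sub>M borel) \<Otimes>\<^sub>M lborel \<rightarrow>\<^sub>M P \<Otimes>\<^sub>M (borel :: real measure)"
      by (intro measurable_Pair) (auto simp: measurable_lborel2)
    have [measurable]: "(\<lambda>x. (snd (fst x) :: real)) \<in> (P \<Otimes>\<^sub>M borel) \<Otimes>\<^sub>M (lborel :: real measure) \<rightarrow>\<^sub>M borel"
      by (rule measurable_compose[OF measurable_fst measurable_snd])
    have [measurable]: "snd \<in> (P \<Otimes>\<^sub>M (borel :: real measure)) \<Otimes>\<^sub>M (lborel :: real measure) \<rightarrow>\<^sub>M borel"
      using measurable_snd[of "P \<Otimes>\<^sub>M (borel :: real measure)" "lborel :: real measure"] by simp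
    have "Q \<in> sets ((P \<Otimes>\<^sub>M borel) \<Otimes>\<^sub>M lborel)" unfolding Q_def by measurable
    then have "(\<lambda>x. emeasure lborel (Pair x -` Q)) \<in> borel_measurable (P \<Otimes>\<^sub>M borel)"
      by (rule lborel.measurable_emeasure_Pair)
    then show ?thesis
    proof (rule measurable_cong[THEN iffD1, rotated])
      fix x assume "x \<in> space (P \<Otimes>\<^sub>M (borel :: real measure))"
      then have "Pair x -` Q = (Pair (fst x) -` G) \<inter> {snd x<..<snd x+h}"
        by (auto simp: Q_def space_pair_measure)
      then show "emeasure lborel (Pair x -` Q) = emeasure lborel ((Pair (fst x) -` G) \<inter> {snd x<..<snd x+h})" by simp
    qed
  qed
  have "density_part \<eta> G m = {x \<in> space (P \<Otimes>\<^sub>M borel). x \<in> G \<and> (\<forall>h\<in>\<rat>. 0 < h \<and> h < 1 / real (Suc m) \<longrightarrow>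
     ennreal ((1 - \<eta>) * h) \<le> emeasure lborel ((Pair (fst x) -` G) \<inter> {snd x<..<snd x+h}))}"
    using sets.sets_into_space[OF G] by (auto simp: density_part_def)
  also have "\<dots> = G \<inter> {x \<in> space (P \<Otimes>\<^sub>M borel). \<forall>h\<in>\<rat>. 0 < h \<and> h < 1 / real (Suc m) \<longrightarrow>
     ennreal ((1 - \<eta>) * h) \<le> emeasure lborel ((Pair (fst x) -` G) \<inter> {snd x<..<snd x+h})}"
    using sets.sets_into_space[OF G] by auto
  also have "\<dots> \<in> sets (P \<Otimes>\<^sub>M borel)"
    by (intro sets.Int G sets.sets_Collect_countable_All'[OF _ countable_rat]) measurable
  finally show ?thesis .
qed

lemma AE_density_part:
  assumes G: "Pair \<omega> -` G \<in> sets borel" and "\<eta> > 0"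
  shows "AE t in lborel. (\<omega>, t) \<in> G \<longrightarrow> (\<exists>m. (\<omega>, t) \<in> density_part \<eta> G m)"
  using lebesgue_density_real[OF G]
proof eventually_elim
  case (elim t)
  show ?case
  proof
    assume t: "(\<omega>, t) \<in> G"
    then obtain h0 where h0: "h0 > 0" "\<And>h. 0 < h \<Longrightarrow> h < h0 \<Longrightarrow>
       emeasure lborel ({t-h..t+h} - Pair \<omega> -` G) \<le> ennreal (\<eta> * h)" using elim \<open>\<eta> > 0\<close> by auto
    obtain m where m: "1 / real (Suc m) < h0" using nat_approx_posE[OF h0(1)] by blast
    have "ennreal ((1 - \<eta>) * h) \<le> emeasure lborel (Pair \<omega> -` G \<inter> {t<..<t + h})"
      if h: "0 < h" "h < 1 / real (Suc m)" for h
    proof -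
      have "ennreal h = emeasure lborel {t<..<t+h}" using h by simp
      also have "\<dots> \<le> emeasure lborel (Pair \<omega> -` G \<inter> {t<..<t + h}) + emeasure lborel ({t-h..t+h} - Pair \<omega> -` G)"
        using G h by (intro order_trans[OF emeasure_mono emeasure_subadditive]) auto
      also have "\<dots> \<le> emeasure lborel (Pair \<omega> -` G \<inter> {t<..<t + h}) + ennreal (\<eta> * h)"
        using h m by (intro add_left_mono h0) auto
      finally have *: "ennreal h \<le> emeasure lborel (Pair \<omega> -` G \<inter> {t<..<t + h}) + ennreal (\<eta> * h)" .
      show ?thesis
      \<comment> \<open>For larger \<open>\<eta>\<close> the lower bound is negative and
        \<open>ennreal\<close> sends it to 0.\<close>
      proof (cases "\<eta> \<le> 1")
        case True
        have "ennreal h = ennreal ((1 - \<eta>) * h) + ennreal (\<eta> * h)"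
          using True h \<open>\<eta> > 0\<close> by (subst ennreal_plus[symmetric]) (auto simp: algebra_simps)
        then show ?thesis using * by (simp add: add.commute[of _ "ennreal (\<eta> * h)"] ennreal_add_left_cancel_le)
      next
        case False
        then have "(1 - \<eta>) * h \<le> 0" using h by (intro mult_nonpos_nonneg) auto
        then show ?thesis by (simp add: ennreal_neg)
      qed
    qed
    then have "(\<omega>, t) \<in> density_part \<eta> G m" using t by (auto simp: density_part_def)
    then show "\<exists>m. (\<omega>, t) \<in> density_part \<eta> G m" by blast
  qed
qed

text \<open>Up to an error carried by the complement of \<open>S\<close>, the mass of \<open>S\<close> near \<open>y\<close> reappears near \<open>y + A u\<close>.
  Demanding this for all Borel subsets of \<open>S1\<close> makes the property stable under shrinking \<open>S1\<close>, so that
  the \<open>n\<close> representations can be treated one after the other.\<close>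

definition transports :: "'b::euclidean_space measure \<Rightarrow> real \<Rightarrow> 'b set \<Rightarrow> 'b \<Rightarrow> real \<Rightarrow> 'b measure \<Rightarrow> real \<Rightarrow> bool" where
  "transports \<mu> \<eta> S1 u K \<nu> r1 \<longleftrightarrow> (\<forall>S\<in>sets borel. S \<subseteq> S1 \<longrightarrow>
     (\<forall>y A b. 0 \<le> A \<and> 0 < b \<and> 2 * \<eta> * (A + b) \<le> b \<and> A + b < r1 \<longrightarrow>
        emeasure \<mu> (S \<inter> cball y b) \<le> 128 * emeasure \<mu> (S \<inter> cball (y + A *\<^sub>R u) (3 * b))
          + ennreal K * emeasure \<nu> (cball (y + A *\<^sub>R u) (3 * b) - S)))"

text \<open>Pairs of a fragment and a time carry the product of \<open>P\<close> with Lebesgue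
  measure; its image under evaluation is \<open>\<nu>\<close>. Countably many straight pieces cover
  almost all of it. \<open>density_selection\<close> picks one piece that is visible on a subset of
  \<open>S0\<close> of positive measure, and the transport of single curves is integrated over
  \<open>P\<close>.\<close>

proposition C_alberti_transports:
  fixes \<phi> :: "'a::metric_space \<Rightarrow> real ^ 'n" and \<mu> :: "(real ^ 'n) measure"
  assumes \<phi>: "L-lipschitz_on UNIV \<phi>" and C: "is_cone C"
    and P: "sets P = sets borel" "prob_space P" "AE \<gamma> in P. C_curve \<phi> C \<gamma>" and "\<eta> > 0"
    and ac: "\<And>E. E \<in> sets borel \<Longrightarrow>
      (\<integral>\<^sup>+\<gamma>. emeasure lborel {t \<in> frag_dom \<gamma>. \<phi> (frag_map \<gamma> t) \<in> E} \<partial>P) = 0 \<Longrightarrow> emeasure \<mu> E = 0"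
    and \<mu>: "sets \<mu> = sets borel" "finite_measure \<mu>"
    and S0: "S0 \<in> sets borel" "emeasure \<mu> S0 > 0"
  obtains S1 u K \<nu> r1 where "S1 \<in> sets borel" "S1 \<subseteq> S0" "emeasure \<mu> S1 > 0" "u \<in> C" "norm u = 1"
    "r1 > 0" "K > 0" "sets \<nu> = sets borel" "finite_measure \<nu>" "transports \<mu> \<eta> S1 u K \<nu> r1"
proof -
  interpret P: prob_space P by fact
  interpret pair_sigma_finite P lborel by unfold_locales
  define M where "M = P \<Otimes>\<^sub>M (lborel :: real measure)"
  have sM: "sets M = sets (borel \<Otimes>\<^sub>M borel)" unfolding M_def by (intro sets_pair_measure_cong) (auto simp: P)
  have spM: "space M = UNIV" using sets_eq_imp_space_eq[OF sM] by (simp add: space_pair_measure)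
  have spP: "space P = UNIV" using sets_eq_imp_space_eq[OF P(1)] by simp
  have cont: "continuous_on UNIV \<phi>" using \<phi> by (rule lipschitz_on_continuous_on)
  define ev where "ev = frag_eval \<phi>"
  have ev[measurable]: "ev \<in> M \<rightarrow>\<^sub>M borel"
    using measurable_frag_eval[OF cont] by (simp add: ev_def sM cong: measurable_cong_sets)
  have emM: "emeasure M X = (\<integral>\<^sup>+\<gamma>. emeasure lborel (Pair \<gamma> -` X) \<partial>P)" if "X \<in> sets M" for X
    using that unfolding M_def by (rule lborel.emeasure_pair_measure_alt)
  define F where "F = (frag_pairs :: ('a fragment \<times> real) set)"
  have F[measurable]: "F \<in> sets M" unfolding F_def sM by (rule closed_in_borel_pair[OF closed_frag_pairs])
  define pu where "pu T = distr (density M (indicator T)) borel ev" for T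
  have spu: "sets (pu T) = sets borel" for T by (simp add: pu_def)
  have pu: "emeasure (pu T) E = emeasure M (T \<inter> ev -` E)" if "T \<in> sets M" "E \<in> sets borel" for T E
  proof -
    have "ev -` E \<in> sets M" using measurable_sets[OF ev that(2)] by (simp add: spM)
    then show ?thesis unfolding pu_def using that ev
      by (subst emeasure_distr) (auto simp: emeasure_restricted spM)
  qed
  have pre: "ev -` E \<in> sets M" if "E \<in> sets borel" for E using measurable_sets[OF ev that] by (simp add: spM)
  have fst_fin: "emeasure M F \<le> 1"
  proof -
    have "emeasure M F = (\<integral>\<^sup>+\<gamma>. emeasure lborel (frag_dom \<gamma>) \<partial>P)"
      unfolding emM[OF F] by (auto simp: F_def frag_pairs_def vimage_def)
    also have "\<dots> \<le> (\<integral>\<^sup>+\<gamma>. emeasure lborel {0..1::real} \<partial>P)"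
      by (intro nn_integral_mono emeasure_mono frag_dom_subset) auto
    also have "\<dots> = 1" by (simp add: P.emeasure_space_1)
    finally show ?thesis .
  qed
  define \<nu> where "\<nu> = pu F"
  have s\<nu>: "sets \<nu> = sets borel" "space \<nu> = UNIV" using spu by (auto simp: \<nu>_def pu_def)
  have fin\<nu>: "finite_measure \<nu>"
  proof (rule finite_measureI)
    have "emeasure \<nu> UNIV \<le> 1" unfolding \<nu>_def using fst_fin by (subst pu) auto
    then show "emeasure \<nu> (space \<nu>) \<noteq> \<infinity>" by (auto simp: s\<nu> top_unique)
  qed
  have ac': "absolutely_continuous \<nu> \<mu>"
    unfolding absolutely_continuous_def
  proof
    fix E assume E: "E \<in> null_sets \<nu>"
    then have Eb: "E \<in> sets borel" by (auto simp: null_sets_def s\<nu>)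
    have "F \<inter> ev -` E \<in> sets M" using pre[OF Eb] by auto
    then have "(\<integral>\<^sup>+\<gamma>. emeasure lborel (Pair \<gamma> -` (F \<inter> ev -` E)) \<partial>P) = 0"
      using E Eb emM pu[OF F Eb] by (simp add: null_sets_def \<nu>_def)
    moreover have "Pair \<gamma> -` (F \<inter> ev -` E) = {t \<in> frag_dom \<gamma>. \<phi> (frag_map \<gamma> t) \<in> E}" for \<gamma>
      by (auto simp: F_def frag_pairs_def ev_def frag_eval_def)
    ultimately have "emeasure \<mu> E = 0" using ac[OF Eb] by simp
    then show "E \<in> null_sets \<mu>" using Eb \<mu> by (auto simp: null_sets_def)
  qed
  obtain D where D: "countable D" "D \<subseteq> C - {0}" "C - {0} \<subseteq> closure D"
    using separable[of "C - {0}"] by blast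
  define I where "I = D \<times> (\<rat> :: real set) \<times> (UNIV :: nat set)"
  have I: "countable I" unfolding I_def using D countable_rat by auto
  define G where "G = straight_pairs \<phi> \<eta>"
  have G[measurable]: "G i \<in> sets M" for i unfolding G_def sM by (rule straight_pairs_sets[OF cont])
  have GF: "G i \<subseteq> F" for i by (auto simp: G_def F_def straight_pairs_def frag_pairs_def split_beta)
  define G' where "G' i m = density_part \<eta> (G i) m" for i m
  have sMP: "sets M = sets (P \<Otimes>\<^sub>M borel)" unfolding M_def by (intro sets_pair_measure_cong) auto
  have G'[measurable]: "G' i m \<in> sets M" for i m
    using G[of i] unfolding G'_def sMP by (rule density_part_sets)
  have G'G: "G' i m \<subseteq> G i" for i m unfolding G'_def by (rule density_part_subset)
  have secG: "Pair \<gamma> -` T \<in> sets borel" if "T \<in> sets M" for T \<gamma>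
    using sets_Pair1[of T P lborel \<gamma>] that by (simp add: M_def)
  have cov: "AE x in M. x \<in> F \<longrightarrow> x \<in> (\<Union>i\<in>I. G i)"
    unfolding M_def
  proof (rule AE_pair_measure)
    have [measurable]: "(\<Union>i\<in>I. G i) \<in> sets M" using I by (intro sets.countable_UN') auto
    have "{x \<in> space M. x \<in> F \<longrightarrow> x \<in> (\<Union>i\<in>I. G i)} \<in> sets M" by measurable
    then show "{x \<in> space (P \<Otimes>\<^sub>M lborel). x \<in> F \<longrightarrow> x \<in> (\<Union>i\<in>I. G i)} \<in> sets (P \<Otimes>\<^sub>M lborel)" unfolding M_def .
    show "AE \<gamma> in P. AE t in lborel. (\<gamma>, t) \<in> F \<longrightarrow> (\<gamma>, t) \<in> (\<Union>i\<in>I. G i)"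
      using P(3)
    proof eventually_elim
      case (elim \<gamma>)
      show ?case
        using C_curve_straight_pairs_cover[OF \<phi> C elim D(3) \<open>\<eta> > 0\<close>]
        by (auto simp: F_def frag_pairs_def I_def G_def)
    qed
  qed
  have AE': "AE x in M. x \<in> G i \<longrightarrow> x \<in> (\<Union>m. G' i m)" for i
    unfolding M_def
  proof (rule AE_pair_measure)
    have "{x \<in> space M. x \<in> G i \<longrightarrow> x \<in> (\<Union>m. G' i m)} \<in> sets M" by measurable
    then show "{x \<in> space (P \<Otimes>\<^sub>M lborel). x \<in> G i \<longrightarrow> x \<in> (\<Union>m. G' i m)} \<in> sets (P \<Otimes>\<^sub>M lborel)" unfolding M_def .
    show "AE \<gamma> in P. AE t in lborel. (\<gamma>, t) \<in> G i \<longrightarrow> (\<gamma>, t) \<in> (\<Union>m. G' i m)"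
      using AE_density_part[OF secG[OF G] \<open>\<eta> > 0\<close>] by (auto simp: G'_def)
  qed
  obtain i m c S1 where sel: "i \<in> I" "c > 0" "S1 \<in> sets \<nu>" "S1 \<subseteq> S0" "emeasure \<mu> S1 > 0"
    and lo: "\<And>E. E \<in> sets \<nu> \<Longrightarrow> E \<subseteq> S1 \<Longrightarrow> ennreal c * emeasure \<mu> E \<le> 2 * emeasure (pu (G' i m)) E"
    and up: "\<And>E. E \<in> sets \<nu> \<Longrightarrow> E \<subseteq> S1 \<Longrightarrow> emeasure (pu (G i)) E \<le> ennreal (2 * c) * emeasure \<mu> E"
  proof (rule density_selection[OF fin\<nu> \<mu>(2) _ ac', of "\<lambda>i. pu (G i)" "\<lambda>i m. pu (G' i m)" I S0], goal_cases)
    case 1 then show ?case by (simp add: \<mu> s\<nu>)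
  next
    case 2 then show ?case by (simp add: spu s\<nu>)
  next
    case (3 i E)
    then have E: "E \<in> sets borel" by (simp add: s\<nu>)
    show ?case unfolding \<nu>_def pu[OF G E] pu[OF F E] using GF[of i] pre[OF E] by (intro emeasure_mono) auto
  next
    case 4 then show ?case by (simp add: spu s\<nu>)
  next
    case (5 i m E)
    then have E: "E \<in> sets borel" by (simp add: s\<nu>)
    show ?case unfolding pu[OF G E] pu[OF G' E] using G'G[of i m] pre[OF E] by (intro emeasure_mono) auto
  next
    case (6 E)
    then have E: "E \<in> sets borel" by (simp add: s\<nu>)
    note [measurable] = pre[OF E]
    show ?case
    proof (rule ccontr)
      assume "\<not> ?thesis"
      then have "G i \<inter> ev -` E \<in> null_sets M" if "i \<in> I" for i
        using that pu[OF G E] by (auto simp: null_sets_def)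
      then have "(\<Union>i\<in>I. G i \<inter> ev -` E) \<in> null_sets M" using I by (intro null_sets_UN') auto
      then have "AE x in M. x \<notin> (\<Union>i\<in>I. G i \<inter> ev -` E)" by (rule AE_not_in)
      with cov have "AE x in M. x \<notin> F \<inter> ev -` E" by eventually_elim auto
      then have "emeasure M (F \<inter> ev -` E) = 0"
        by (subst (asm) AE_iff_measurable[of "F \<inter> ev -` E"]) (auto simp: spM)
      then show False using 6 pu[OF F E] by (simp add: \<nu>_def)
    qed
  next
    case (7 i E)
    then have E: "E \<in> sets borel" by (simp add: s\<nu>)
    note [measurable] = pre[OF E]
    have "incseq (\<lambda>m. G' i m \<inter> ev -` E)"
      unfolding incseq_def G'_def using density_part_mono by blast
    then have "(SUP m. emeasure M (G' i m \<inter> ev -` E)) = emeasure M (\<Union>m. G' i m \<inter> ev -` E)"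
      by (intro SUP_emeasure_incseq) auto
    moreover have "emeasure M (G i \<inter> ev -` E) \<le> emeasure M (\<Union>m. G' i m \<inter> ev -` E)"
      using AE'[of i] by (intro emeasure_mono_AE) (auto elim: AE_mp)
    ultimately show ?case by (simp add: pu[OF G E] pu[OF G' E])
  next
    case 8 then show ?case using S0 s\<nu> by simp
  next
    case 9 then show ?case using S0 by simp
  next
    case (10 i m c S1) show ?case by (rule that[of i c S1 m]) (use 10 in \<open>auto\<close>)
  qed
  obtain v q k where i: "i = (v, q, k)" by (cases i)
  have v: "v \<in> C" "v \<noteq> 0" using sel(1) D(2) by (auto simp: I_def i)
  define u where "u = v /\<^sub>R norm v"
  have u: "u \<in> C" "norm u = 1" using v is_cone_closed(2)[OF C v(1)] by (auto simp: u_def)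
  define r1 where "r1 = norm v * (1 / real (Suc m))"
  have r1: "r1 > 0" using v by (simp add: r1_def)
  have tr: "emeasure (pu (G' i m)) (cball y b) \<le> 32 * emeasure (pu (G i)) (cball (y + A *\<^sub>R u) (3 * b))"
    if A: "0 \<le> A" "0 < b" "2 * \<eta> * (A + b) \<le> b" "A + b < r1" for y A b
  proof -
    have cb: "cball y b \<in> sets borel" "cball (y + A *\<^sub>R u) (3 * b) \<in> sets borel" by auto
    note [measurable] = pre[OF cb(1)] pre[OF cb(2)]
    have sec: "Pair \<gamma> -` (T \<inter> ev -` E) = {t \<in> Pair \<gamma> -` T. \<phi> (frag_map \<gamma> t) \<in> E}" if "T \<subseteq> F" for T \<gamma> E
      using that by (auto simp: F_def frag_pairs_def ev_def frag_eval_def)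
    have G'F: "G' i m \<subseteq> F" using G'G[of i m] GF[of i] by blast
    have "emeasure (pu (G' i m)) (cball y b) = (\<integral>\<^sup>+\<gamma>. emeasure lborel {t \<in> Pair \<gamma> -` G' i m. \<phi> (frag_map \<gamma> t) \<in> cball y b} \<partial>P)"
      by (subst pu) (simp_all only: G' cb, subst emM, measurable, simp only: sec[OF G'F])
    also have "\<dots> \<le> (\<integral>\<^sup>+\<gamma>. 32 * emeasure lborel {t \<in> Pair \<gamma> -` G i. \<phi> (frag_map \<gamma> t) \<in> cball (y + A *\<^sub>R u) (3 * b)} \<partial>P)"
    proof (rule nn_integral_mono)
      fix \<gamma> assume "\<gamma> \<in> space P"
      have E2: "{t \<in> Pair \<gamma> -` G i. \<phi> (frag_map \<gamma> t) \<in> cball (y + A *\<^sub>R u) (3 * b)} \<in> sets borel"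
        unfolding sec[OF GF, symmetric] by (rule secG) measurable
      show "emeasure lborel {t \<in> Pair \<gamma> -` G' i m. \<phi> (frag_map \<gamma> t) \<in> cball y b}
         \<le> 32 * emeasure lborel {t \<in> Pair \<gamma> -` G i. \<phi> (frag_map \<gamma> t) \<in> cball (y + A *\<^sub>R u) (3 * b)}"
        unfolding u_def
      proof (rule straight_transport)
        show "Pair \<gamma> -` G i \<in> sets borel" by (rule secG[OF G])
        show "Pair \<gamma> -` G' i m \<subseteq> Pair \<gamma> -` G i" using G'G[of i m] by auto
        \<comment> \<open>All times of one section share the window around \<open>q\<close>, so the
          condition recorded at \<open>t\<close> applies to \<open>s\<close>.\<close>
        show "norm (\<phi> (frag_map \<gamma> s) - \<phi> (frag_map \<gamma> t) - (s - t) *\<^sub>R v) \<le> \<eta> * norm v * \<bar>s - t\<bar>"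
          if "s \<in> Pair \<gamma> -` G i" "t \<in> Pair \<gamma> -` G i" for s t
          using that by (auto simp: G_def i straight_pairs_def)
        show "ennreal ((1 - \<eta>) * h) \<le> emeasure lborel (Pair \<gamma> -` G i \<inter> {t<..<t + h})"
          if "t \<in> Pair \<gamma> -` G' i m" "h \<in> \<rat>" "0 < h" "h < 1 / real (Suc m)" for t h
          using that by (auto simp: G'_def density_part_def)
        show "{t \<in> Pair \<gamma> -` G i. \<phi> (frag_map \<gamma> t) \<in> cball (y + A *\<^sub>R (v /\<^sub>R norm v)) (3 * b)} \<in> sets borel"
          using E2 by (simp add: u_def)
      qed (use A v \<open>\<eta> > 0\<close> in \<open>auto simp: r1_def\<close>)
    qed
    also have "\<dots> = 32 * (\<integral>\<^sup>+\<gamma>. emeasure lborel (Pair \<gamma> -` (G i \<inter> ev -` cball (y + A *\<^sub>R u) (3 * b))) \<partial>P)"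
      unfolding sec[OF GF]
    proof (rule nn_integral_cmult)
      have "(\<lambda>\<gamma>. emeasure lborel (Pair \<gamma> -` (G i \<inter> ev -` cball (y + A *\<^sub>R u) (3 * b)))) \<in> borel_measurable P"
        by (rule lborel.measurable_emeasure_Pair) (unfold M_def[symmetric], measurable)
      then show "(\<lambda>\<gamma>. emeasure lborel {t \<in> Pair \<gamma> -` G i. \<phi> (frag_map \<gamma> t) \<in> cball (y + A *\<^sub>R u) (3 * b)}) \<in> borel_measurable P"
        unfolding sec[OF GF] .
    qed
    also have "\<dots> = 32 * emeasure (pu (G i)) (cball (y + A *\<^sub>R u) (3 * b))"
      by (subst pu) (simp_all only: G cb, subst emM, measurable)
    finally show ?thesis .
  qed
  have "transports \<mu> \<eta> S1 u (64 / c) \<nu> r1"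
    unfolding transports_def
  proof (intro ballI impI allI)
    fix S y A b assume S: "S \<in> sets borel" "S \<subseteq> S1" and
      "0 \<le> A \<and> 0 < b \<and> 2 * \<eta> * (A + b) \<le> b \<and> A + b < r1"
    then have A: "0 \<le> A" "0 < b" "2 * \<eta> * (A + b) \<le> b" "A + b < r1" by auto
    define B where "B = cball (y + A *\<^sub>R u) (3 * b)"
    have [measurable]: "B \<in> sets borel" "S \<in> sets borel" using S by (auto simp: B_def)
    have "ennreal c * emeasure \<mu> (S \<inter> cball y b) \<le> 2 * emeasure (pu (G' i m)) (S \<inter> cball y b)"
      using S by (intro lo) (auto simp: s\<nu>)
    also have "\<dots> \<le> 2 * emeasure (pu (G' i m)) (cball y b)"
      using S by (intro mult_left_mono emeasure_mono) (auto simp: spu)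
    also have "\<dots> \<le> 2 * (32 * emeasure (pu (G i)) B)"
      unfolding B_def by (intro mult_left_mono tr A) auto
    also have "emeasure (pu (G i)) B \<le> emeasure (pu (G i)) (S \<inter> B) + emeasure (pu (G i)) (B - S)"
      by (intro order_trans[OF emeasure_mono emeasure_subadditive]) (auto simp: spu)
    also have "\<dots> \<le> ennreal (2 * c) * emeasure \<mu> (S \<inter> B) + emeasure \<nu> (B - S)"
    proof (rule add_mono)
      show "emeasure (pu (G i)) (S \<inter> B) \<le> ennreal (2 * c) * emeasure \<mu> (S \<inter> B)"
        using S by (intro up) (auto simp: s\<nu>)
      have "B - S \<in> sets borel" by measurable
      then show "emeasure (pu (G i)) (B - S) \<le> emeasure \<nu> (B - S)"
        unfolding \<nu>_def using GF[of i] pre by (auto simp: pu intro!: emeasure_mono)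
    qed
    finally have *: "ennreal c * emeasure \<mu> (S \<inter> cball y b) \<le>
        2 * (32 * (ennreal (2 * c) * emeasure \<mu> (S \<inter> B) + emeasure \<nu> (B - S)))" 
      by (simp add: mult_left_mono)
    \<comment> \<open>Dividing by \<open>c\<close> leaves \<open>128 = 2 * 32 * 2\<close>: the half
      of the density kept at density times, the ratio of times, and the width of the dyadic band.
      Only the error term retains the factor \<open>1 / c\<close>.\<close>
    have "emeasure \<mu> (S \<inter> cball y b) = ennreal (1 / c) * (ennreal c * emeasure \<mu> (S \<inter> cball y b))"
      using sel(2) by (simp add: mult.assoc[symmetric] flip: ennreal_mult)
    also have "\<dots> \<le> ennreal (1 / c) * (2 * (32 * (ennreal (2 * c) * emeasure \<mu> (S \<inter> B) + emeasure \<nu> (B - S))))"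
      by (intro mult_left_mono *) auto
    also have "\<dots> = (ennreal (1 / c) * ennreal 64 * ennreal (2 * c)) * emeasure \<mu> (S \<inter> B) + (ennreal (1 / c) * ennreal 64) * emeasure \<nu> (B - S)"
    proof -
      have "2 * (32 * x) = ennreal 64 * x" for x :: ennreal by (simp flip: mult.assoc)
      then show ?thesis by (simp only: distrib_left mult.assoc)
    qed
    also have "ennreal (1 / c) * ennreal 64 * ennreal (2 * c) = ennreal 128"
      using sel(2) by (simp flip: ennreal_mult del: ennreal_numeral)
    also have "ennreal 128 = 128" by simp
    also have "ennreal (1 / c) * ennreal 64 = ennreal (64 / c)"
      using sel(2) by (simp flip: ennreal_mult del: ennreal_numeral)
    finally show "emeasure \<mu> (S \<inter> cball y b) \<le> 128 * emeasure \<mu> (S \<inter> cball (y + A *\<^sub>R u) (3 * b))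
          + ennreal (64 / c) * emeasure \<nu> (cball (y + A *\<^sub>R u) (3 * b) - S)" by (simp add: B_def)
  qed
  then show thesis
    using sel u r1 s\<nu> fin\<nu> by (intro that[of S1 u r1 "64 / c" \<nu>]) auto
qed

section \<open>Independent directions\<close>

text \<open>Compactness: the unit vectors of closed cones together with a unit coefficient vector
  form a compact set, on which the norm of the combination is continuous and, by independence, never
  zero. Uniformity in \<open>u\<close> allows \<open>\<kappa>\<close> to be used before the
  directions are selected.\<close>

lemma independent_cones_lower_bound:
  fixes C :: "'n::finite \<Rightarrow> (real ^ 'n) set"
  assumes cone: "\<And>i. is_cone (C i)" and ind: "independent_cones C"
  obtains \<kappa> where "\<kappa> > 0"
    "\<And>(u :: 'n \<Rightarrow> real ^ 'n) (a :: 'n \<Rightarrow> real) j. (\<And>i. u i \<in> C i \<and> norm (u i) = 1) \<Longrightarrow> \<kappa> * \<bar>a j\<bar> \<le> norm (\<Sum>i\<in>UNIV. a i *\<^sub>R u i)"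
proof -
  define K where "K = {p :: ((real ^ 'n) ^ 'n) \<times> (real ^ 'n). (\<forall>i. fst p $ i \<in> C i \<and> norm (fst p $ i) = 1) \<and> norm (snd p) = 1}"
  define f where "f p = norm (\<Sum>i\<in>UNIV. (snd p $ i) *\<^sub>R (fst p $ i))" for p :: "((real ^ 'n) ^ 'n) \<times> (real ^ 'n)"
  have cf: "continuous_on K f" unfolding f_def by (intro continuous_intros)
  have "K = (\<Inter>i. {p. fst p $ i \<in> C i} \<inter> {p. norm (fst p $ i) = 1}) \<inter> {p. norm (snd p) = 1}"
    by (auto simp: K_def)
  moreover have "closed {p :: ((real ^ 'n) ^ 'n) \<times> (real ^ 'n). fst p $ i \<in> C i}" for i
  proof -
    have "{p :: ((real ^ 'n) ^ 'n) \<times> (real ^ 'n). fst p $ i \<in> C i} = (\<lambda>p. fst p $ i) -` C i" by auto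
    then show ?thesis
      using continuous_closed_vimage[OF is_cone_closed(1)[OF cone[of i]], of "\<lambda>p :: ((real ^ 'n) ^ 'n) \<times> (real ^ 'n). fst p $ i"]
      by (simp add: continuous_intros)
  qed
  ultimately have "closed K"
    by (auto intro!: closed_Int closed_INT closed_Collect_eq continuous_intros)
  moreover have "bounded K"
  proof (rule boundedI)
    fix p assume p: "p \<in> K"
    have "norm (fst p) \<le> (\<Sum>i\<in>UNIV. norm (fst p $ i))" unfolding norm_vec_def by (rule L2_set_le_sum) auto
    also have "\<dots> = real CARD('n)" using p by (simp add: K_def)
    finally show "norm p \<le> real CARD('n) + 1"
      using norm_Pair_le[of "fst p" "snd p"] p by (simp add: K_def)
  qed
  ultimately have "compact K" by (simp add: compact_eq_bounded_closed)
  have pos: "f p > 0" if p: "p \<in> K" for p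
  proof (rule ccontr)
    assume "\<not> f p > 0"
    then have 0: "(\<Sum>i\<in>UNIV. (snd p $ i) *\<^sub>R (fst p $ i)) = 0" by (simp add: f_def)
    have "fst p $ i \<in> C i - {0}" for i
    proof -
      have "fst p $ i \<in> C i" "norm (fst p $ i) = 1" using p by (auto simp: K_def)
      then show ?thesis by auto
    qed
    then have inj: "inj (($) (fst p))" and indep: "independent (range (($) (fst p)))"
      using ind unfolding independent_cones_def by blast+
    define c where "c x = snd p $ (inv (($) (fst p)) x)" for x
    have "(\<Sum>x\<in>range (($) (fst p)). c x *\<^sub>R x) = 0"
      using 0 inj by (subst sum.reindex) (auto simp: c_def)
    moreover have "finite (range (($) (fst p)))" by simp
    ultimately have "\<forall>x\<in>range (($) (fst p)). c x = 0" using indep dependent_finite by blast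
    then have "snd p = 0" using inj by (auto simp: c_def vec_eq_iff)
    then show False using p by (simp add: K_def)
  qed
  obtain \<kappa> where \<kappa>: "\<kappa> > 0" "\<And>p. p \<in> K \<Longrightarrow> \<kappa> \<le> f p"
  proof (cases "K = {}")
    case True
    then show ?thesis using that[of 1] by auto
  next
    case False
    then obtain p where "p \<in> K" "\<And>p'. p' \<in> K \<Longrightarrow> f p \<le> f p'"
      using continuous_attains_inf[OF \<open>compact K\<close> False cf] by blast
    then show ?thesis using that[of "f p"] pos by auto
  qed
  show thesis
  proof (rule that[OF \<kappa>(1)])
    fix u :: "'n \<Rightarrow> real ^ 'n" and a :: "'n \<Rightarrow> real" and j assume u: "\<And>i. u i \<in> C i \<and> norm (u i) = 1"
    define v where "v = (\<chi> i. a i)"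
    show "\<kappa> * \<bar>a j\<bar> \<le> norm (\<Sum>i\<in>UNIV. a i *\<^sub>R u i)"
    proof (cases "v = 0")
      case True
      then have "a j = 0" by (auto simp: v_def vec_eq_iff)
      then show ?thesis by simp
    next
      case False
      define p where "p = ((\<chi> i. u i), v /\<^sub>R norm v)"
      have "p \<in> K" using u False by (auto simp: K_def p_def)
      have "(\<Sum>i\<in>UNIV. a i *\<^sub>R u i) = norm v *\<^sub>R (\<Sum>i\<in>UNIV. (snd p $ i) *\<^sub>R (fst p $ i))"
        unfolding scaleR_sum_right using False by (intro sum.cong) (auto simp: p_def v_def)
      then have "norm (\<Sum>i\<in>UNIV. a i *\<^sub>R u i) = norm v * f p" by (simp add: f_def)
      also have "\<dots> \<ge> norm v * \<kappa>" using \<kappa>(2)[OF \<open>p \<in> K\<close>] by (intro mult_left_mono) auto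
      finally have "\<kappa> * norm v \<le> norm (\<Sum>i\<in>UNIV. a i *\<^sub>R u i)" by (simp add: mult.commute)
      moreover have "\<kappa> * \<bar>a j\<bar> \<le> \<kappa> * norm v"
        using component_le_norm_cart[of v j] \<kappa>(1) by (intro mult_left_mono) (auto simp: v_def)
      ultimately show ?thesis by linarith
    qed
  qed
qed

lemma transports_subset: "transports \<mu> \<eta> S1 u K \<nu> r1 \<Longrightarrow> S \<subseteq> S1 \<Longrightarrow> transports \<mu> \<eta> S u K \<nu> r1"
  unfolding transports_def by (meson subset_trans)

section \<open>Displacement along all directions and the grid\<close>

text \<open>Induction over the set of directions already followed. Every step triples the radius and
  costs a factor 128; all target balls stay inside \<open>cball y R\<close>, so that one quantity
  \<open>V\<close> bounds every error.\<close>

lemma transports_chain: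
  fixes \<mu> :: "'b::euclidean_space measure" and \<nu> :: "'n::finite \<Rightarrow> 'b measure"
  assumes tr: "\<And>i. transports \<mu> \<eta> S (u i) (K i) (\<nu> i) (r1 i)" and S: "S \<in> sets borel"
    and sets: "sets \<mu> = sets borel" "\<And>i. sets (\<nu> i) = sets borel" and u: "\<And>i. norm (u i) = 1"
    and A: "\<And>i. 0 \<le> A i \<and> A i \<le> a" and b: "0 < b" and \<eta>: "0 < \<eta>" "2 * \<eta> * (a + 3 ^ CARD('n) * b) \<le> b"
    and r1: "\<And>i. a + 3 ^ CARD('n) * b < r1 i" and R: "real CARD('n) * a + 3 ^ CARD('n) * b \<le> R"
  shows "emeasure \<mu> (S \<inter> cball y b) \<le> 128 ^ CARD('n) *
    (emeasure \<mu> (S \<inter> cball (y + (\<Sum>i\<in>UNIV. A i *\<^sub>R u i)) (3 ^ CARD('n) * b))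
      + (\<Sum>i\<in>UNIV. ennreal (K i) * emeasure (\<nu> i) (cball y R - S)))"
proof -
  define V where "V = (\<Sum>i\<in>UNIV. ennreal (K i) * emeasure (\<nu> i) (cball y R - S))"
  have "emeasure \<mu> (S \<inter> cball y b) \<le> 128 ^ card F *
    (emeasure \<mu> (S \<inter> cball (y + (\<Sum>i\<in>F. A i *\<^sub>R u i)) (3 ^ card F * b)) + V)" for F :: "'n set"
  proof (induction F rule: infinite_finite_induct)
    case (insert i F)
    define z where "z = y + (\<Sum>i\<in>F. A i *\<^sub>R u i)"
    define b' where "b' = 3 ^ card F * b"
    have card: "Suc (card F) \<le> CARD('n)" using insert(1,2) card_mono[of UNIV "insert i F"] by simp
    have bb: "b \<le> b'" "b' \<le> 3 ^ CARD('n) * b" "3 * b' \<le> 3 ^ CARD('n) * b"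
    proof -
      show "b \<le> b'" using b by (simp add: b'_def)
      have "(3::real) ^ card F \<le> 3 ^ CARD('n)" "(3::real) ^ Suc (card F) \<le> 3 ^ CARD('n)"
        using card by (intro power_increasing; simp)+
      then show "b' \<le> 3 ^ CARD('n) * b" "3 * b' \<le> 3 ^ CARD('n) * b"
        using b by (auto simp: b'_def mult.assoc[symmetric] intro!: mult_right_mono)
    qed
    have "2 * \<eta> * (A i + b') \<le> 2 * \<eta> * (a + 3 ^ CARD('n) * b)"
      using A[of i] bb \<eta> by (intro mult_left_mono add_mono) auto
    then have "2 * \<eta> * (A i + b') \<le> b'" using \<eta> bb by linarith
    moreover have "A i + b' < r1 i" using A[of i] bb r1[of i] by linarith
    moreover have "0 < b'" using bb b by linarith
    ultimately have "emeasure \<mu> (S \<inter> cball z b') \<le> 128 * emeasure \<mu> (S \<inter> cball (z + A i *\<^sub>R u i) (3 * b'))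
          + ennreal (K i) * emeasure (\<nu> i) (cball (z + A i *\<^sub>R u i) (3 * b') - S)"
      using tr[of i] S A[of i] unfolding transports_def by blast
    also have "\<dots> \<le> 128 * emeasure \<mu> (S \<inter> cball (z + A i *\<^sub>R u i) (3 * b')) + V"
    proof (rule add_left_mono)
      have "norm (\<Sum>i\<in>insert i F. A i *\<^sub>R u i) \<le> (\<Sum>i\<in>insert i F. a)"
        using A u by (intro order_trans[OF norm_sum] sum_mono) auto
      also have "\<dots> \<le> real CARD('n) * a" using card insert(1,2) A[of i] by (auto intro!: mult_right_mono)
      finally have "norm (\<Sum>i\<in>insert i F. A i *\<^sub>R u i) \<le> real CARD('n) * a" .
      moreover have "z + A i *\<^sub>R u i - y = (\<Sum>i\<in>insert i F. A i *\<^sub>R u i)" using insert(1,2) by (simp add: z_def)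
      ultimately have "dist (z + A i *\<^sub>R u i) y \<le> real CARD('n) * a" by (metis dist_norm)
      then have "cball (z + A i *\<^sub>R u i) (3 * b') \<subseteq> cball y R"
        using R bb(3) by (subst cball_subset_cball_iff) auto
      then have "ennreal (K i) * emeasure (\<nu> i) (cball (z + A i *\<^sub>R u i) (3 * b') - S) \<le> ennreal (K i) * emeasure (\<nu> i) (cball y R - S)"
        using S sets(2) by (intro mult_left_mono emeasure_mono) auto
      also have "\<dots> \<le> V" unfolding V_def by (rule member_le_sum) auto
      finally show "ennreal (K i) * emeasure (\<nu> i) (cball (z + A i *\<^sub>R u i) (3 * b') - S) \<le> V" .
    qed
    finally have 1: "emeasure \<mu> (S \<inter> cball z b') \<le> 128 * emeasure \<mu> (S \<inter> cball (z + A i *\<^sub>R u i) (3 * b')) + V" .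
    have "emeasure \<mu> (S \<inter> cball y b) \<le> 128 ^ card F * (emeasure \<mu> (S \<inter> cball z b') + V)"
      using insert.IH by (simp add: z_def b'_def)
    also have "\<dots> \<le> 128 ^ card F * ((128 * emeasure \<mu> (S \<inter> cball (z + A i *\<^sub>R u i) (3 * b')) + V) + V)"
      by (intro mult_left_mono add_right_mono 1) auto
    \<comment> \<open>The old and the new error are merged by \<open>V + V \<le> 128 * V\<close>,
      which restores the form of the induction hypothesis.\<close>
    also have "\<dots> \<le> 128 ^ card F * (128 * (emeasure \<mu> (S \<inter> cball (z + A i *\<^sub>R u i) (3 * b')) + V))"
    proof (intro mult_left_mono)
      have "V + V \<le> 128 * V" using mult_right_mono[of 2 128 V] by (simp add: mult_2)
      then show "(128 * emeasure \<mu> (S \<inter> cball (z + A i *\<^sub>R u i) (3 * b')) + V) + V \<le> 128 * (emeasure \<mu> (S \<inter> cball (z + A i *\<^sub>R u i) (3 * b')) + V)"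
        by (simp add: distrib_left add.assoc add_left_mono)
    qed auto
    finally have 2: "emeasure \<mu> (S \<inter> cball y b) \<le> 128 ^ card F * (128 * (emeasure \<mu> (S \<inter> cball (z + A i *\<^sub>R u i) (3 * b')) + V))" .
    have card': "card (insert i F) = Suc (card F)" using insert(1,2) by simp
    have z': "z + A i *\<^sub>R u i = y + (\<Sum>i\<in>insert i F. A i *\<^sub>R u i)" using insert(1,2) by (simp add: z_def add_ac)
    have b'': "3 * b' = 3 ^ card (insert i F) * b" unfolding card' by (simp add: b'_def)
    have p': "128 ^ card F * (128 * x) = 128 ^ card (insert i F) * x" for x :: ennreal
      unfolding card' by (simp only: power_Suc mult_ac)
    show ?case using 2 unfolding z' b'' p' .
  qed (auto simp: distrib_left intro!: order_trans[OF emeasure_mono])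
  from this[of UNIV] show ?thesis by (simp add: V_def)
qed

text \<open>The \<open>N\<^sup>n\<close> points \<open>y + (\<Sum>i. q m\<^sub>i u\<^sub>i)\<close> with \<open>m\<^sub>i < N\<close> carry disjoint balls inside the ball of radius
  \<open>c N b\<close>, each of mass at least \<open>128\<^sup>-\<^sup>n\<close> times that of the ball of radius \<open>b\<close>, up to the error terms.\<close>

lemma transports_grid:
  fixes \<mu> :: "(real ^ 'n) measure" and \<nu> :: "'n::finite \<Rightarrow> (real ^ 'n) measure" and N :: nat
  defines "n \<equiv> CARD('n)"
  assumes tr: "\<And>i. transports \<mu> \<eta> S (u i) (K i) (\<nu> i) (r1 i)" and S: "S \<in> sets borel"
    and sets: "sets \<mu> = sets borel" "\<And>i. sets (\<nu> i) = sets borel" and u: "\<And>i. norm (u i) = 1"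
    and \<kappa>: "\<kappa> > 0" "\<And>a j. \<kappa> * \<bar>a j\<bar> \<le> norm (\<Sum>i\<in>UNIV. a i *\<^sub>R u i)"
    and N: "N > 0" and b: "0 < b" and \<eta>: "0 < \<eta>" "2 * \<eta> * (3 ^ (n + 1) * real N / \<kappa> + 3 ^ n) \<le> 1"
    and c: "c = real n * 3 ^ (n + 1) / \<kappa> + 3 ^ n"
    and r1: "\<And>i. c * real N * b < r1 i"
  shows "of_nat (N ^ n) * emeasure \<mu> (S \<inter> cball y b) \<le> 128 ^ n *
    (emeasure \<mu> (S \<inter> cball y (c * real N * b))
      + of_nat (N ^ n) * (\<Sum>i\<in>UNIV. ennreal (K i) * emeasure (\<nu> i) (cball y (c * real N * b) - S)))"
proof -
  define V where "V = (\<Sum>i\<in>UNIV. ennreal (K i) * emeasure (\<nu> i) (cball y (c * real N * b) - S))"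
  \<comment> \<open>After \<open>n\<close> transports the radius is \<open>3 ^ n * b\<close>.
    Distinct grid points are at least \<open>\<kappa> * q\<close> apart, which is three such radii
    and hence more than the two that disjointness demands.\<close>
  define q where "q = 3 ^ (n + 1) * b / \<kappa>"
  define a where "a = q * real N"
  define Ms where "Ms = (PiE UNIV (\<lambda>_. {..<N}) :: ('n \<Rightarrow> nat) set)"
  define p where "p m = y + (\<Sum>i\<in>UNIV. (q * real (m i)) *\<^sub>R u i)" for m :: "'n \<Rightarrow> nat"
  have q: "q > 0" using \<kappa> b by (simp add: q_def)
  have n: "n \<ge> 1" unfolding n_def using zero_less_card_finite[where 'a='n] by simp
  have fin: "finite Ms" and cardMs: "card Ms = N ^ n"
    unfolding Ms_def n_def by (auto intro!: finite_PiE simp: card_PiE)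
  have aN: "a = 3 ^ (n + 1) * real N / \<kappa> * b" by (simp add: a_def q_def)
  \<comment> \<open>This is the origin of \<open>c\<close>: at most \<open>n\<close> displacements
    of length \<open>a\<close>, plus the final radius.\<close>
  have R: "real n * a + 3 ^ n * b \<le> c * real N * b"
  proof -
    have "3 ^ n * b * 1 \<le> 3 ^ n * b * real N" using N b by (intro mult_left_mono) auto
    then show ?thesis unfolding c aN by (simp add: algebra_simps)
  qed
  have a0: "a \<ge> 0" using q by (simp add: a_def)
  have "a \<le> real n * a" using n a0 mult_right_mono[of 1 "real n" a] by simp
  then have ar: "a + 3 ^ n * b < r1 i" for i using R r1[of i] by linarith
  have "2 * \<eta> * (a + 3 ^ n * b) = (2 * \<eta> * (3 ^ (n + 1) * real N / \<kappa> + 3 ^ n)) * b"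
    unfolding aN by (simp add: algebra_simps)
  also have "\<dots> \<le> 1 * b" using \<eta>(2) b by (intro mult_right_mono) auto
  finally have \<eta>a: "2 * \<eta> * (a + 3 ^ n * b) \<le> b" by simp
  have chain: "emeasure \<mu> (S \<inter> cball y b) \<le> 128 ^ n * (emeasure \<mu> (S \<inter> cball (p m) (3 ^ n * b)) + V)"
    if m: "m \<in> Ms" for m
  proof -
    have mi: "m i < N" for i using m by (auto simp: Ms_def)
    have A: "0 \<le> q * real (m i) \<and> q * real (m i) \<le> a" for i
      using q mi[of i] by (auto simp: a_def)
    show ?thesis
      unfolding p_def V_def n_def
      by (rule transports_chain[where u = u and A = "\<lambda>i. q * real (m i)" and a = a and K = K and \<nu> = \<nu> and ?r1.0 = r1 and \<eta> = \<eta>])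
        (use tr S sets u A b \<eta>(1) \<eta>a ar R in \<open>auto simp: n_def\<close>)
  qed
  have disj: "disjoint_family_on (\<lambda>m. S \<inter> cball (p m) (3 ^ n * b)) Ms"
    unfolding disjoint_family_on_def
  proof (intro ballI impI)
    fix m m' assume "m \<in> Ms" "m' \<in> Ms" "m \<noteq> m'"
    then obtain j where j: "m j \<noteq> m' j" by auto
    have "p m - p m' = (\<Sum>i\<in>UNIV. (q * (real (m i) - real (m' i))) *\<^sub>R u i)"
      by (simp add: p_def sum_subtractf[symmetric] scaleR_diff_left[symmetric] right_diff_distrib)
    then have "\<kappa> * \<bar>q * (real (m j) - real (m' j))\<bar> \<le> dist (p m) (p m')"
      using \<kappa>(2)[of "\<lambda>i. q * (real (m i) - real (m' i))" j] by (simp add: dist_norm)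
    moreover have "1 \<le> \<bar>real (m j) - real (m' j)\<bar>" using j by linarith
    then have "q * 1 \<le> q * \<bar>real (m j) - real (m' j)\<bar>" using q by (intro mult_left_mono) auto
    then have "\<kappa> * q \<le> \<kappa> * \<bar>q * (real (m j) - real (m' j))\<bar>" using q \<kappa> by (intro mult_left_mono) (auto simp: abs_mult)
    moreover have "\<kappa> * q = 3 * (3 ^ n * b)" using \<kappa> by (simp add: q_def)
    moreover have "3 ^ n * b > 0" using b by simp
    ultimately have "dist (p m) (p m') > 2 * (3 ^ n * b)" by linarith
    have "False" if z: "z \<in> cball (p m) (3 ^ n * b)" "z \<in> cball (p m') (3 ^ n * b)" for z
    proof -
      have "dist (p m) (p m') \<le> dist (p m) z + dist (p m') z" by (metis dist_triangle dist_commute)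
      then show False using z \<open>dist (p m) (p m') > 2 * (3 ^ n * b)\<close> by simp
    qed
    then show "S \<inter> cball (p m) (3 ^ n * b) \<inter> (S \<inter> cball (p m') (3 ^ n * b)) = {}" by blast
  qed
  have sub: "cball (p m) (3 ^ n * b) \<subseteq> cball y (c * real N * b)" if m: "m \<in> Ms" for m
  proof -
    have mi: "real (m i) \<le> real N" for i using m by (auto simp: Ms_def PiE_def Pi_def less_imp_le)
    have "norm (\<Sum>i\<in>UNIV. (q * real (m i)) *\<^sub>R u i) \<le> (\<Sum>i\<in>(UNIV::'n set). a)"
      using q mi u by (intro order_trans[OF norm_sum] sum_mono) (auto simp: a_def intro!: mult_left_mono)
    then have "dist (p m) y \<le> real n * a" by (simp add: p_def dist_norm n_def)
    then show ?thesis using R by (subst cball_subset_cball_iff) auto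
  qed
  have "of_nat (N ^ n) * emeasure \<mu> (S \<inter> cball y b) = (\<Sum>m\<in>Ms. emeasure \<mu> (S \<inter> cball y b))"
    by (simp add: cardMs)
  also have "\<dots> \<le> (\<Sum>m\<in>Ms. 128 ^ n * (emeasure \<mu> (S \<inter> cball (p m) (3 ^ n * b)) + V))"
    by (intro sum_mono chain)
  also have "\<dots> = 128 ^ n * ((\<Sum>m\<in>Ms. emeasure \<mu> (S \<inter> cball (p m) (3 ^ n * b))) + of_nat (N ^ n) * V)"
    by (simp add: sum_distrib_left[symmetric] sum.distrib cardMs)
  also have "(\<Sum>m\<in>Ms. emeasure \<mu> (S \<inter> cball (p m) (3 ^ n * b))) = emeasure \<mu> (\<Union>m\<in>Ms. S \<inter> cball (p m) (3 ^ n * b))"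
    using S sets fin disj by (intro sum_emeasure) auto
  also have "\<dots> \<le> emeasure \<mu> (S \<inter> cball y (c * real N * b))"
    using sub S sets by (intro emeasure_mono) auto
  finally show ?thesis by (simp add: V_def mult_left_mono add_right_mono)
qed

section \<open>Choice of scale and power decay\<close>

text \<open>The place where \<open>s < n\<close> enters: \<open>N\<close> to the power
  \<open>n - s\<close> outgrows every constant.\<close>

lemma grid_scale:
  fixes n :: nat and s :: real
  assumes "s < real n" "c > 0"
  obtains N :: nat where "N > 0" "5 * c * real N > 1"
    "2 * 128 ^ n * (5 * c * real N) powr s \<le> real (N ^ n)"
proof -
  define D where "D = 2 * 128 ^ n * (5 * c) powr s"
  have "filterlim (\<lambda>N. real N powr (real n - s)) at_top sequentially"
    using assms by real_asymp
  then have "\<forall>\<^sub>F N in sequentially. real N powr (real n - s) \<ge> D" by (simp add: filterlim_at_top)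
  moreover have "\<forall>\<^sub>F N in sequentially. 5 * c * real N > 1"
  proof -
    have "filterlim (\<lambda>N. 5 * c * real N) at_top sequentially"
      using assms by (intro filterlim_tendsto_pos_mult_at_top[OF tendsto_const _ filterlim_real_sequentially]) auto
    then show ?thesis by (simp add: filterlim_at_top_dense)
  qed
  ultimately have "\<forall>\<^sub>F N in sequentially. N > 0 \<and> 5 * c * real N > 1 \<and> real N powr (real n - s) \<ge> D"
    using eventually_gt_at_top[of 0] by eventually_elim auto
  then obtain N where N: "N > 0" "5 * c * real N > 1" "real N powr (real n - s) \<ge> D"
    by (auto simp: eventually_sequentially)
  have "2 * 128 ^ n * (5 * c * real N) powr s = D * real N powr s"
    using assms by (simp add: D_def powr_mult)
  also have "\<dots> \<le> real N powr (real n - s) * real N powr s" using N by (intro mult_right_mono) auto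
  also have "\<dots> = real (N ^ n)" using N(1) by (simp add: powr_add[symmetric] powr_realpow)
  finally show thesis using that N by blast
qed

text \<open>At a point where the complement of \<open>S\<close> is negligible for every
  \<open>\<nu> i\<close>, passing from radius \<open>T * b\<close> to \<open>b\<close> divides the
  mass by at least the \<open>s\<close>-th power of \<open>T\<close>. Iterating from
  \<open>b\<close> up to a fixed scale gives the power law. Both \<open>b0\<close> and
  \<open>D\<close> may depend on the point.\<close>

lemma transports_decay:
  fixes \<mu> :: "(real ^ 'n) measure" and \<nu> :: "'n::finite \<Rightarrow> (real ^ 'n) measure" and N :: nat and s :: real
  defines "n \<equiv> CARD('n)"
  assumes tr: "\<And>i. transports \<mu> \<eta> S (u i) (K i) (\<nu> i) (r1 i)" and S: "S \<in> sets borel"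
    and \<mu>: "sets \<mu> = sets borel" "finite_measure \<mu>"
    and \<nu>: "\<And>i. sets (\<nu> i) = sets borel" "\<And>i. finite_measure (\<nu> i)" and u: "\<And>i. norm (u i) = 1"
    and K: "\<And>i. K i > 0" and r1: "\<And>i. r1 i > 0"
    and \<kappa>: "\<kappa> > 0" "\<And>a j. \<kappa> * \<bar>a j\<bar> \<le> norm (\<Sum>i\<in>UNIV. a i *\<^sub>R u i)"
    and N: "N > 0" and \<eta>: "0 < \<eta>" "2 * \<eta> * (3 ^ (n + 1) * real N / \<kappa> + 3 ^ n) \<le> 1"
    and c: "c = real n * 3 ^ (n + 1) / \<kappa> + 3 ^ n"
    and s: "0 \<le> s" and T: "5 * c * real N > 1" "2 * 128 ^ n * (5 * c * real N) powr s \<le> real (N ^ n)"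
  shows "\<exists>Z\<in>null_sets \<mu>. \<forall>y\<in>S - Z. \<exists>b0>0. \<exists>D\<ge>0. \<forall>b. 0 < b \<and> b < b0 \<longrightarrow>
    emeasure \<mu> (S \<inter> cball y b) \<le> ennreal (D * b powr s)"
proof -
  interpret \<mu>: finite_measure \<mu> by fact
  define M where "M = c * real N"
  define T where "T = 5 * M"
  have c0: "c > 0" unfolding c using \<kappa> by (intro add_nonneg_pos) auto
  have M: "M > 0" using c0 N by (simp add: M_def)
  have T1: "T > 1" using T(1) by (simp add: T_def M_def)
  have NT: "2 * 128 ^ n * T powr s \<le> real (N ^ n)" using T(2) by (simp add: T_def M_def mult_ac)
  \<comment> \<open>Normalised so that all error terms together amount to at most one more copy of
    the mass at radius \<open>T * b\<close>; this copy accounts for the 2 in the hypothesis on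
    \<open>N\<close>. The density bound compares radius \<open>M * b\<close> with
    \<open>5 * (M * b)\<close>, hence \<open>T = 5 * M\<close>.\<close>
  define \<tau> where "\<tau> = 1 / (real (N ^ n) * (\<Sum>i\<in>UNIV. K i))"
  have Kpos: "(\<Sum>i\<in>UNIV. K i) > 0" using K by (intro sum_pos) auto
  have \<tau>: "\<tau> > 0" using Kpos N by (simp add: \<tau>_def)
  have "\<forall>i. \<exists>Z\<in>null_sets \<mu>. \<forall>y\<in>S - Z. \<exists>r0>0. \<forall>r. 0 < r \<and> r < r0 \<longrightarrow>
     emeasure (\<nu> i) (cball y r - S) \<le> ennreal \<tau> * emeasure \<mu> (S \<inter> cball y (5 * r))"
    using vitali_density[OF \<nu>(1,2) \<mu>(1) S \<tau>] by blast
  then obtain Z where Z: "\<And>i. Z i \<in> null_sets \<mu>"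
    "\<And>i y. y \<in> S - Z i \<Longrightarrow> \<exists>r0>0. \<forall>r. 0 < r \<and> r < r0 \<longrightarrow>
     emeasure (\<nu> i) (cball y r - S) \<le> ennreal \<tau> * emeasure \<mu> (S \<inter> cball y (5 * r))" by metis
  show ?thesis
  proof (intro bexI ballI)
    show "(\<Union>i. Z i) \<in> null_sets \<mu>" using Z(1) by (intro null_sets_UN') auto
    fix y assume y: "y \<in> S - (\<Union>i. Z i)"
    have "\<forall>i. \<exists>r0>0. \<forall>r. 0 < r \<and> r < r0 \<longrightarrow>
       emeasure (\<nu> i) (cball y r - S) \<le> ennreal \<tau> * emeasure \<mu> (S \<inter> cball y (5 * r))"
      using y Z(2) by blast
    then obtain r0 where r0: "\<And>i. r0 i > 0" "\<And>i r. 0 < r \<Longrightarrow> r < r0 i \<Longrightarrow>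
       emeasure (\<nu> i) (cball y r - S) \<le> ennreal \<tau> * emeasure \<mu> (S \<inter> cball y (5 * r))" by metis
    define b0 where "b0 = Min (range (\<lambda>i. min (r0 i) (r1 i))) / M"
    have "Min (range (\<lambda>i. min (r0 i) (r1 i))) > 0" using r0(1) r1 by (subst Min_gr_iff) auto
    then have b0: "b0 > 0" using M by (simp add: b0_def)
    have step: "emeasure \<mu> (S \<inter> cball y b) \<le> ennreal (T powr - s) * emeasure \<mu> (S \<inter> cball y (T * b))"
      if b: "0 < b" "b < b0" for b
    proof -
      have "M * b < Min (range (\<lambda>i. min (r0 i) (r1 i)))" using b(2) M by (simp add: b0_def field_simps)
      then have Mb: "M * b < r0 i" "M * b < r1 i" for i
        by (auto simp: Min_gr_iff)
      have "ennreal (real (N ^ n)) * emeasure \<mu> (S \<inter> cball y b) \<le> 128 ^ n *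
        (emeasure \<mu> (S \<inter> cball y (M * b))
          + ennreal (real (N ^ n)) * (\<Sum>i\<in>UNIV. ennreal (K i) * emeasure (\<nu> i) (cball y (M * b) - S)))"
        using transports_grid[where u = u and K = K and \<nu> = \<nu> and ?r1.0 = r1 and \<eta> = \<eta> and c = c and N = N and S = S and \<mu> = \<mu> and \<kappa> = \<kappa> and b = b and y = y]
          tr S \<mu> \<nu> u \<kappa> N b(1) \<eta> c Mb(2) by (simp add: n_def M_def ennreal_of_nat_eq_real_of_nat)
      also have "\<dots> \<le> 128 ^ n * (emeasure \<mu> (S \<inter> cball y (T * b)) + emeasure \<mu> (S \<inter> cball y (T * b)))"
      proof (intro mult_left_mono add_mono)
        have "1 * (M * b) \<le> 5 * (M * b)" using M b by (intro mult_right_mono) auto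
        then show "emeasure \<mu> (S \<inter> cball y (M * b)) \<le> emeasure \<mu> (S \<inter> cball y (T * b))"
          using S \<mu> by (intro emeasure_mono) (auto simp: T_def)
        have "(\<Sum>i\<in>UNIV. ennreal (K i) * emeasure (\<nu> i) (cball y (M * b) - S))
            \<le> (\<Sum>i\<in>UNIV. ennreal (K i) * (ennreal \<tau> * emeasure \<mu> (S \<inter> cball y (T * b))))"
          using r0(2)[OF _ Mb(1)] M b by (intro sum_mono mult_left_mono) (auto simp: T_def mult.assoc)
        also have "\<dots> = (\<Sum>i\<in>UNIV. ennreal (K i)) * (ennreal \<tau> * emeasure \<mu> (S \<inter> cball y (T * b)))"
          by (simp add: sum_distrib_right)
        also have "(\<Sum>i\<in>UNIV. ennreal (K i)) = ennreal (\<Sum>i\<in>UNIV. K i)"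
          using K by (intro sum_ennreal) (auto intro: less_imp_le)
        finally have "ennreal (real (N ^ n)) * (\<Sum>i\<in>UNIV. ennreal (K i) * emeasure (\<nu> i) (cball y (M * b) - S))
           \<le> ennreal (real (N ^ n)) * (ennreal (\<Sum>i\<in>UNIV. K i) * (ennreal \<tau> * emeasure \<mu> (S \<inter> cball y (T * b))))"
          by (rule mult_left_mono) simp
        also have "\<dots> = ennreal (real (N ^ n) * (\<Sum>i\<in>UNIV. K i) * \<tau>) * emeasure \<mu> (S \<inter> cball y (T * b))"
          using Kpos \<tau> by (simp add: ennreal_mult mult.assoc del: of_nat_power)
        also have "real (N ^ n) * (\<Sum>i\<in>UNIV. K i) * \<tau> = 1" using Kpos N by (simp add: \<tau>_def)
        finally show "ennreal (real (N ^ n)) * (\<Sum>i\<in>UNIV. ennreal (K i) * emeasure (\<nu> i) (cball y (M * b) - S))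
          \<le> emeasure \<mu> (S \<inter> cball y (T * b))" by simp
      qed auto
      also have "\<dots> = ennreal (2 * 128 ^ n) * emeasure \<mu> (S \<inter> cball y (T * b))"
        by (simp add: mult_2[symmetric] ennreal_mult ennreal_power[symmetric] mult_ac)
      finally have 1: "ennreal (real (N ^ n)) * emeasure \<mu> (S \<inter> cball y b) \<le> ennreal (2 * 128 ^ n) * emeasure \<mu> (S \<inter> cball y (T * b))" .
      have Ts: "T powr s > 0" using T1 by simp
      have "ennreal (2 * 128 ^ n) * (ennreal (T powr s) * emeasure \<mu> (S \<inter> cball y b)) =
          ennreal (2 * 128 ^ n * T powr s) * emeasure \<mu> (S \<inter> cball y b)"
        by (subst ennreal_mult) (auto simp: mult.assoc)
      also have "\<dots> \<le> ennreal (real (N ^ n)) * emeasure \<mu> (S \<inter> cball y b)"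
        by (intro mult_right_mono ennreal_leI NT) auto
      also note 1
      finally have "ennreal (T powr s) * emeasure \<mu> (S \<inter> cball y b) \<le> emeasure \<mu> (S \<inter> cball y (T * b))"
        by (subst (asm) ennreal_mult_le_mult_iff) auto
      then have "ennreal (T powr - s) * (ennreal (T powr s) * emeasure \<mu> (S \<inter> cball y b)) \<le> ennreal (T powr - s) * emeasure \<mu> (S \<inter> cball y (T * b))"
        by (rule mult_left_mono) auto
      moreover have "ennreal (T powr - s) * ennreal (T powr s) = 1"
        using T1 by (simp add: ennreal_mult[symmetric] powr_add[symmetric])
      ultimately show ?thesis by (simp add: mult.assoc[symmetric])
    qed
    have iter: "emeasure \<mu> (S \<inter> cball y b) \<le> ennreal (T powr (- s * real k)) * emeasure \<mu> (S \<inter> cball y (T ^ k * b))"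
      if "0 < b" "\<And>j. j < k \<Longrightarrow> T ^ j * b < b0" for b k
      using that
    proof (induction k)
      case 0
      then show ?case using T1 by simp
    next
      case (Suc k)
      have "emeasure \<mu> (S \<inter> cball y b) \<le> ennreal (T powr (- s * real k)) * emeasure \<mu> (S \<inter> cball y (T ^ k * b))"
        using Suc by auto
      also have "\<dots> \<le> ennreal (T powr (- s * real k)) * (ennreal (T powr - s) * emeasure \<mu> (S \<inter> cball y (T * (T ^ k * b))))"
        using Suc.prems T1 by (intro mult_left_mono step) auto
      also have "\<dots> = ennreal (T powr (- s * real k) * T powr - s) * emeasure \<mu> (S \<inter> cball y (T ^ Suc k * b))"
        by (simp add: ennreal_mult mult.assoc)
      also have "T powr (- s * real k) * T powr - s = T powr (- s * real (Suc k))"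
        by (simp add: powr_add[symmetric] algebra_simps)
      finally show ?case .
    qed
    have "emeasure \<mu> (S \<inter> cball y b) \<le> ennreal (measure \<mu> (space \<mu>) * b0 powr - s * b powr s)" if b: "0 < b" "b < b0" for b
    proof -
      obtain k0 where k0: "b0 / b < T ^ k0" using T1 real_arch_pow by blast
      \<comment> \<open>The first scale that reaches \<open>b0\<close>: every smaller one admits the
        one-step estimate, and \<open>b0 \<le> T ^ k * b\<close> turns the accumulated factor into a
        power of \<open>b / b0\<close>. The mass at the last scale is bounded by the total
        mass.\<close>
      define k where "k = (LEAST k. b0 \<le> T ^ k * b)"
      have "b0 \<le> T ^ k' * b" if "b0 / b < T ^ k'" for k' using that b by (simp add: field_simps less_imp_le)
      then have ex: "\<exists>k. b0 \<le> T ^ k * b" using k0 by blast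
      have k1: "b0 \<le> T ^ k * b" unfolding k_def by (rule LeastI_ex[OF ex])
      have k2: "T ^ j * b < b0" if "j < k" for j using not_less_Least[of j "\<lambda>k. b0 \<le> T ^ k * b"] that by (auto simp: k_def)
      have "emeasure \<mu> (S \<inter> cball y b) \<le> ennreal (T powr (- s * real k)) * emeasure \<mu> (S \<inter> cball y (T ^ k * b))"
        using b k2 by (intro iter) auto
      also have "\<dots> \<le> ennreal (b0 powr - s * b powr s) * emeasure \<mu> (space \<mu>)"
      proof (intro mult_mono ennreal_leI emeasure_space)
        have "T powr (- s * real k) = (T ^ k) powr - s" using T1 by (simp add: powr_realpow[symmetric] powr_powr mult.commute)
        also have "\<dots> \<le> (b0 / b) powr - s"
          using k1 b b0 s by (intro powr_mono2') (auto simp: field_simps)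
        also have "\<dots> = b0 powr - s * b powr s" using b b0 by (simp add: powr_divide powr_minus field_simps)
        finally show "T powr (- s * real k) \<le> b0 powr - s * b powr s" .
      qed auto
      also have "\<dots> = ennreal (measure \<mu> (space \<mu>) * b0 powr - s * b powr s)"
        by (subst \<mu>.emeasure_eq_measure) (simp add: ennreal_mult[symmetric] mult_ac)
      finally show ?thesis .
    qed
    then show "\<exists>b0>0. \<exists>D\<ge>0. \<forall>b. 0 < b \<and> b < b0 \<longrightarrow> emeasure \<mu> (S \<inter> cball y b) \<le> ennreal (D * b powr s)"
      using b0 by (intro exI[of _ b0] conjI exI[of _ "measure \<mu> (space \<mu>) * b0 powr - s"]) auto
  qed
qed

section \<open>Mass distribution principle and conclusion\<close>

text \<open>The usual principle, read through a Lipschitz map: the image of a covering set that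
  meets \<open>G\<close> lies in a ball of comparable radius around one of its points in
  \<open>G\<close>. The image of \<open>B\<close> need not be Borel, so the conclusion is phrased
  with a null superset.\<close>

lemma mass_distribution:
  fixes \<phi> :: "'a::metric_space \<Rightarrow> 'b::metric_space" and \<mu> :: "'b measure"
  assumes \<phi>: "L-lipschitz_on UNIV \<phi>" and \<mu>: "sets \<mu> = sets borel" and S: "S \<in> sets borel" "G \<subseteq> S"
    and s: "0 \<le> s" and b0: "b0 > 0" and D: "D \<ge> 0"
    and dec: "\<And>y b. y \<in> G \<Longrightarrow> 0 < b \<Longrightarrow> b < b0 \<Longrightarrow> emeasure \<mu> (S \<inter> cball y b) \<le> ennreal (D * b powr s)"
    and B: "hausdorff_measure s B = 0"
  shows "\<exists>Z\<in>null_sets \<mu>. G \<inter> \<phi> ` B \<subseteq> Z"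
proof -
  \<comment> \<open>The shift keeps the constant positive even when \<open>L = 0\<close>.\<close>
  define L' where "L' = L + 1"
  have L': "L' > 0" using lipschitz_on_nonneg[OF \<phi>] by (simp add: L'_def)
  define \<delta> where "\<delta> = b0 / (2 * L')"
  have \<delta>: "\<delta> > 0" using b0 L' by (simp add: \<delta>_def)
  define D' where "D' = D * L' powr s"
  have D': "D' \<ge> 0" using D by (simp add: D'_def)
  have small: "emeasure \<mu> (S \<inter> cball y (L' * diameter U)) \<le> ennreal D' * diam_pow s U"
    if y: "y \<in> G" and U: "U \<noteq> {}" "bounded U" "diameter U \<le> \<delta>" for y and U :: "'a set"
  proof -
    have d0: "diameter U \<ge> 0" by (rule diameter_ge_0[OF U(2)])
    have lt: "L' * diameter U < b0"
    proof -
      have "L' * diameter U \<le> L' * \<delta>" using U L' by (intro mult_left_mono) auto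
      also have "\<dots> < b0" using b0 L' by (simp add: \<delta>_def)
      finally show ?thesis .
    qed
    \<comment> \<open>Decay is known for positive radii only. At diameter 0 with
      \<open>s = 0\<close> the term \<open>diam_pow\<close> equals 1 and any radius below
      \<open>b0\<close> will do; with \<open>s > 0\<close> the term is 0 and letting the radius tend
      to 0 shows that the point has no mass.\<close>
    consider "diameter U > 0" | "diameter U = 0" "s = 0" | "diameter U = 0" "s > 0" using d0 s by linarith
    then show ?thesis
    proof cases
      case 1
      have "emeasure \<mu> (S \<inter> cball y (L' * diameter U)) \<le> ennreal (D * (L' * diameter U) powr s)"
        using 1 L' lt y by (intro dec) auto
      also have "D * (L' * diameter U) powr s = D' * diameter U powr s" using 1 L' by (simp add: D'_def powr_mult)
      also have "ennreal \<dots> = ennreal D' * diam_pow s U"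
        using U 1 D' by (auto simp: diam_pow_def ennreal_mult)
      finally show ?thesis .
    next
      case 2
      have "emeasure \<mu> (S \<inter> cball y (L' * diameter U)) \<le> emeasure \<mu> (S \<inter> cball y (b0 / 2))"
        using 2 S \<mu> b0 by (intro emeasure_mono) auto
      also have "\<dots> \<le> ennreal (D * (b0 / 2) powr s)" using y b0 by (intro dec) auto
      also have "\<dots> = ennreal D' * diam_pow s U" using 2 U b0 L' by (simp add: D'_def diam_pow_def)
      finally show ?thesis .
    next
      case 3
      have "((\<lambda>b. ennreal (D * b powr s)) \<longlongrightarrow> ennreal (D * 0 powr s)) (at_right 0)"
        using 3 by (intro tendsto_ennrealI tendsto_mult tendsto_const tendsto_powr' tendsto_ident_at)
          (auto simp: eventually_at_right_less less_imp_le intro!: eventually_at_right_less[THEN eventually_mono])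
      moreover have "\<forall>\<^sub>F b in at_right 0. emeasure \<mu> (S \<inter> cball y (L' * diameter U)) \<le> ennreal (D * b powr s)"
        unfolding eventually_at_right_field
      proof (intro exI[of _ b0] conjI b0 allI impI)
        fix b assume b: "0 < b" "b < b0"
        have "emeasure \<mu> (S \<inter> cball y (L' * diameter U)) \<le> emeasure \<mu> (S \<inter> cball y b)"
          using 3 b S \<mu> by (intro emeasure_mono) auto
        also have "\<dots> \<le> ennreal (D * b powr s)" using y b by (intro dec)
        finally show "emeasure \<mu> (S \<inter> cball y (L' * diameter U)) \<le> ennreal (D * b powr s)" .
      qed
      ultimately have "emeasure \<mu> (S \<inter> cball y (L' * diameter U)) \<le> ennreal (D * 0 powr s)"
        by (rule tendsto_lowerbound) auto
      then show ?thesis by simp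
    qed
  qed
  have "\<exists>Z\<in>sets borel. G \<inter> \<phi> ` B \<subseteq> Z \<and> emeasure \<mu> Z \<le> ennreal (1 / real (Suc k))" for k
  proof -
    have "hausdorff_content s \<delta> B \<le> hausdorff_measure s B"
      unfolding hausdorff_measure_def using \<delta> by (intro SUP_upper) auto
    then have "hausdorff_content s \<delta> B < ennreal (1 / (real (Suc k) * (D' + 1)))" using B D' by simp
    then obtain U where U: "B \<subseteq> (\<Union>i. U i)" "\<And>i. bounded (U i)" "\<And>i. diameter (U i) \<le> \<delta>"
      "(\<Sum>i. diam_pow s (U i)) < ennreal (1 / (real (Suc k) * (D' + 1)))"
      unfolding hausdorff_content_def INF_less_iff by auto
    \<comment> \<open>The centre is chosen in \<open>G\<close>, since decay is available only
      there.\<close>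
    define Z where "Z i = (if G \<inter> \<phi> ` U i = {} then {} else S \<inter> cball (SOME y. y \<in> G \<inter> \<phi> ` U i) (L' * diameter (U i)))" for i
    have y: "(SOME y. y \<in> G \<inter> \<phi> ` U i) \<in> G \<inter> \<phi> ` U i" if "G \<inter> \<phi> ` U i \<noteq> {}" for i
      using that by (metis some_in_eq)
    have Zm: "Z i \<in> sets borel" for i using S by (auto simp: Z_def)
    have Zle: "emeasure \<mu> (Z i) \<le> ennreal D' * diam_pow s (U i)" for i
    proof (cases "G \<inter> \<phi> ` U i = {}")
      case False
      then have "U i \<noteq> {}" by auto
      with False show ?thesis unfolding Z_def using small[OF _ _ U(2,3)] y[OF False] by auto
    qed (simp add: Z_def)
    have cov: "G \<inter> \<phi> ` U i \<subseteq> Z i" for i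
    proof
      fix z assume z: "z \<in> G \<inter> \<phi> ` U i"
      then have ne: "G \<inter> \<phi> ` U i \<noteq> {}" by auto
      define w where "w = (SOME y. y \<in> G \<inter> \<phi> ` U i)"
      obtain x1 x2 where x: "x1 \<in> U i" "x2 \<in> U i" "w = \<phi> x1" "z = \<phi> x2" using z y[OF ne] by (auto simp: w_def)
      have "dist w z \<le> L * dist x1 x2" unfolding x using lipschitz_onD[OF \<phi>] by auto
      also have "\<dots> \<le> L' * diameter (U i)"
        using diameter_bounded_bound[OF U(2) x(1,2)] lipschitz_on_nonneg[OF \<phi>] by (intro mult_mono) (auto simp: L'_def)
      finally have "z \<in> S \<inter> cball w (L' * diameter (U i))" using z S(2) by auto
      then show "z \<in> Z i" using ne unfolding Z_def w_def by simp
    qed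
    have "emeasure \<mu> (\<Union>i. Z i) \<le> (\<Sum>i. emeasure \<mu> (Z i))"
      using Zm \<mu> by (intro emeasure_subadditive_countably) auto
    also have "\<dots> \<le> (\<Sum>i. ennreal D' * diam_pow s (U i))" by (intro suminf_le Zle) auto
    also have "\<dots> = ennreal D' * (\<Sum>i. diam_pow s (U i))" by simp
    also have "\<dots> \<le> ennreal D' * ennreal (1 / (real (Suc k) * (D' + 1)))"
      using U(4) by (intro mult_left_mono) auto
    also have "\<dots> \<le> ennreal (1 / real (Suc k))"
    proof -
      have "D' * (1 / (real (Suc k) * (D' + 1))) = (D' / (D' + 1)) * (1 / real (Suc k))" by simp
      also have "\<dots> \<le> 1 * (1 / real (Suc k))" using D' by (intro mult_right_mono) auto
      finally show ?thesis using D' by (subst ennreal_mult[symmetric]) (auto intro: ennreal_leI)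
    qed
    finally have "emeasure \<mu> (\<Union>i. Z i) \<le> ennreal (1 / real (Suc k))" .
    moreover have "G \<inter> \<phi> ` B \<subseteq> (\<Union>i. Z i)" using U(1) cov by blast
    moreover have "(\<Union>i. Z i) \<in> sets borel" using Zm by auto
    ultimately show ?thesis by blast
  qed
  then obtain Z where Z: "\<And>k. Z k \<in> sets borel" "\<And>k. G \<inter> \<phi> ` B \<subseteq> Z k" "\<And>k. emeasure \<mu> (Z k) \<le> ennreal (1 / real (Suc k))"
    by metis
  have *: "emeasure \<mu> (\<Inter>k. Z k) \<le> ennreal (1 / real (Suc k))" for k
  proof -
    have "emeasure \<mu> (\<Inter>k. Z k) \<le> emeasure \<mu> (Z k)" using Z(1) \<mu> by (intro emeasure_mono) auto
    then show ?thesis using Z(3)[of k] by (rule order_trans)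
  qed
  have "(\<lambda>k. ennreal (1 / real (Suc k))) \<longlonglongrightarrow> ennreal 0"
    by (intro tendsto_ennrealI LIMSEQ_Suc[OF lim_1_over_n])
  then have "emeasure \<mu> (\<Inter>k. Z k) \<le> ennreal 0"
    by (rule LIMSEQ_le_const) (use * in blast)
  then have "(\<Inter>k. Z k) \<in> null_sets \<mu>" using Z(1) by (auto simp: null_sets_def \<mu>)
  moreover have "G \<inter> \<phi> ` B \<subseteq> (\<Inter>k. Z k)" using Z(2) by (rule INT_greatest)
  ultimately show ?thesis by (rule bexI[rotated])
qed

lemma sigma_finite_subset_finite_pos:
  assumes "sigma_finite_measure M" "B \<in> sets M" "emeasure M B > 0"
  obtains B' where "B' \<in> sets M" "B' \<subseteq> B" "emeasure M B' > 0" "emeasure M B' < \<infinity>"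
proof -
  interpret sigma_finite_measure M by fact
  obtain A :: "nat \<Rightarrow> 'a set" where A: "range A \<subseteq> sets M" "(\<Union>i. A i) = space M" "\<And>i. emeasure M (A i) \<noteq> \<infinity>"
    by (rule sigma_finite) blast
  have "\<exists>i. emeasure M (B \<inter> A i) > 0"
  proof (rule ccontr)
    assume "\<not> ?thesis"
    then have "B \<inter> A i \<in> null_sets M" for i using A assms by (auto simp: null_sets_def)
    then have "(\<Union>i. B \<inter> A i) \<in> null_sets M" by (intro null_sets_UN) auto
    moreover have "(\<Union>i. B \<inter> A i) = B" using A(2) sets.sets_into_space[OF assms(2)] by blast
    ultimately show False using assms(3) by (auto simp: null_sets_def)
  qed
  then obtain i where i: "emeasure M (B \<inter> A i) > 0" by blast
  moreover have "emeasure M (B \<inter> A i) \<le> emeasure M (A i)" using A(1) by (intro emeasure_mono) auto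
  then have "emeasure M (B \<inter> A i) < \<infinity>" using A(3)[of i] by (simp add: less_top le_less_trans)
  ultimately show thesis using A(1) assms(2) by (intro that[of "B \<inter> A i"]) auto
qed

theorem theorem5p3:
  fixes \<mu> :: "'a::polish_space measure"
    and P :: "'n::finite \<Rightarrow> 'a fragment measure"
  assumes "metric_measure_space \<mu>"
    and "independent_alberti_representations \<mu> P"
  shows "lower_hausdorff_dim \<mu> \<ge> ereal (real CARD('n))"
proof -
  have s\<mu>: "sets \<mu> = sets borel" and sf: "sigma_finite_measure \<mu>"
    using assms(1) by (auto simp: metric_measure_space_def)
  have sp\<mu>: "space \<mu> = UNIV" using sets_eq_imp_space_eq[OF s\<mu>] by simp
  obtain \<phi> :: "'a \<Rightarrow> real ^ 'n" and C L where \<phi>: "L-lipschitz_on UNIV \<phi>" and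
    C: "\<And>i. is_cone (C i)" "independent_cones C" and rep: "\<And>i. C_alberti_representation \<mu> \<phi> (C i) (P i)"
    using assms(2) unfolding independent_alberti_representations_def by blast
  have P: "sets (P i) = sets borel" "prob_space (P i)" "absolutely_continuous (nu (P i)) \<mu>"
    "AE \<gamma> in P i. C_curve \<phi> (C i) \<gamma>" for i
    using rep[of i] by (auto simp: C_alberti_representation_def alberti_representation_def)
  have cont: "continuous_on UNIV \<phi>" using \<phi> by (rule lipschitz_on_continuous_on)
  then have \<phi>m: "\<phi> \<in> borel_measurable borel" by (rule borel_measurable_continuous_onI)
  obtain \<kappa> where \<kappa>: "\<kappa> > 0"
    "\<And>(u :: 'n \<Rightarrow> real ^ 'n) (a :: 'n \<Rightarrow> real) j. (\<And>i. u i \<in> C i \<and> norm (u i) = 1) \<Longrightarrow> \<kappa> * \<bar>a j\<bar> \<le> norm (\<Sum>i\<in>UNIV. a i *\<^sub>R u i)"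
    using independent_cones_lower_bound[OF C] by blast
  \<comment> \<open>The Hausdorff dimension is an infimum over exponents of zero measure, so it
    suffices to exclude such an exponent below \<open>n\<close> for a Borel set of positive
    measure.\<close>
  have False if B: "B \<in> sets borel" "emeasure \<mu> B > 0" and s: "0 \<le> s" "hausdorff_measure s B = 0" "s < real CARD('n)" for B s
  proof -
    obtain B' where B': "B' \<in> sets \<mu>" "B' \<subseteq> B" "emeasure \<mu> B' > 0" "emeasure \<mu> B' < \<infinity>"
      using sigma_finite_subset_finite_pos[OF sf _ B(2)] B(1) s\<mu> by auto
    \<comment> \<open>Only a part of \<open>B\<close> of finite mass is pushed forward, which makes
      \<open>\<rho>\<close> finite and relates it to \<open>B\<close>.\<close>
    define \<rho> where "\<rho> = distr (density \<mu> (indicator B')) borel \<phi>"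
    have \<phi>m': "\<phi> \<in> \<mu> \<rightarrow>\<^sub>M borel" using \<phi>m s\<mu> by (simp cong: measurable_cong_sets)
    have pre: "\<phi> -` E \<in> sets \<mu>" if "E \<in> sets borel" for E
      using measurable_sets[OF \<phi>m' that] sp\<mu> by simp
    have \<rho>: "emeasure \<rho> E = emeasure \<mu> (B' \<inter> \<phi> -` E)" if "E \<in> sets borel" for E
      unfolding \<rho>_def using that \<phi>m' B'(1) pre[OF that]
      by (subst emeasure_distr) (auto simp: emeasure_restricted sp\<mu>)
    have s\<rho>: "sets \<rho> = sets borel" "space \<rho> = UNIV" by (auto simp: \<rho>_def)
    have fin\<rho>: "finite_measure \<rho>"
      using B'(4) \<rho>[of UNIV] by (intro finite_measureI) (auto simp: s\<rho>)
    have pos\<rho>: "emeasure \<rho> UNIV > 0" using B'(3) \<rho>[of UNIV] by simp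
    have ac: "emeasure \<rho> E = 0" if E: "E \<in> sets borel" and
      0: "(\<integral>\<^sup>+\<gamma>. emeasure lborel {t \<in> frag_dom \<gamma>. \<phi> (frag_map \<gamma> t) \<in> E} \<partial>P i) = 0" for E i
    proof -
      have pE: "\<phi> -` E \<in> sets borel" using pre[OF E] s\<mu> by simp
      have "emeasure (nu (P i)) (\<phi> -` E) = 0"
        using 0 by (simp add: emeasure_nu[OF P(1) pE] emeasure_frag_push[OF pE])
      then have "\<phi> -` E \<in> null_sets \<mu>"
        using P(3)[of i] pE by (auto simp: absolutely_continuous_def null_sets_def)
      then have "B' \<inter> \<phi> -` E \<in> null_sets \<mu>" using B'(1) by (rule null_set_Int1)
      then show ?thesis using \<rho>[OF E] by auto
    qed
    define n where "n = CARD('n)"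
    define c where "c = real n * 3 ^ (n + 1) / \<kappa> + 3 ^ n"
    have "c > 0" unfolding c_def using \<kappa>(1) by (intro add_nonneg_pos) auto
    then obtain N :: nat where N: "N > 0" "5 * c * real N > 1" "2 * 128 ^ n * (5 * c * real N) powr s \<le> real (N ^ n)"
      using grid_scale[of s n c] s(3) by (auto simp: n_def)
    define w where "w = 3 ^ (n + 1) * real N / \<kappa> + 3 ^ n"
    have w: "w > 0" unfolding w_def using \<kappa>(1) by (intro add_nonneg_pos) auto
    define \<eta> where "\<eta> = 1 / (2 * w)"
    have \<eta>: "\<eta> > 0" "2 * \<eta> * w \<le> 1" using w by (auto simp: \<eta>_def)
    define Q where "Q i S u K \<nu> r \<longleftrightarrow> u \<in> C i \<and> norm u = 1 \<and> 0 < r \<and> 0 < K \<and> sets \<nu> = sets borel \<and>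
      finite_measure \<nu> \<and> transports \<rho> \<eta> S u K \<nu> r" for i S u K \<nu> r
    \<comment> \<open>The set shrinks each time a representation is added;
      \<open>transports_subset\<close> preserves what was gained before.\<close>
    have "\<exists>S\<in>sets borel. emeasure \<rho> S > 0 \<and> (\<forall>i\<in>F. \<exists>u K \<nu> r. Q i S u K \<nu> r)" if "finite F" for F
      using that
    proof induction
      case empty
      then show ?case using pos\<rho> by (intro bexI[of _ UNIV]) auto
    next
      case (insert i F)
      then obtain S where S: "S \<in> sets borel" "emeasure \<rho> S > 0" "\<forall>i\<in>F. \<exists>u K \<nu> r. Q i S u K \<nu> r" by blast
      obtain S1 u K \<nu> r1 where S1: "S1 \<in> sets borel" "S1 \<subseteq> S" "emeasure \<rho> S1 > 0" "u \<in> C i" "norm u = 1"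
        "r1 > 0" "K > 0" "sets \<nu> = sets borel" "finite_measure \<nu>" "transports \<rho> \<eta> S1 u K \<nu> r1"
        by (rule C_alberti_transports[OF \<phi> C(1) P(1,2,4) \<eta>(1) ac s\<rho>(1) fin\<rho> S(1,2)])
      have "Q i S1 u K \<nu> r1" using S1 by (simp add: Q_def)
      moreover have "\<exists>u K \<nu> r. Q j S1 u K \<nu> r" if "j \<in> F" for j
        using S(3) that transports_subset[OF _ S1(2)] unfolding Q_def by blast
      ultimately show ?case using S1(1,3) by blast
    qed
    from this[of UNIV] obtain S where S: "S \<in> sets borel" "emeasure \<rho> S > 0" "\<And>i. \<exists>u K \<nu> r. Q i S u K \<nu> r"
      by auto
    then obtain u K \<nu> r where Q: "\<And>i. Q i S (u i) (K i) (\<nu> i) (r i)" by metis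
    obtain Z0 where Z0: "Z0 \<in> null_sets \<rho>" "\<And>y. y \<in> S - Z0 \<Longrightarrow> \<exists>b0>0. \<exists>D\<ge>0. \<forall>b. 0 < b \<and> b < b0 \<longrightarrow>
        emeasure \<rho> (S \<inter> cball y b) \<le> ennreal (D * b powr s)"
    proof -
      have "\<exists>Z\<in>null_sets \<rho>. \<forall>y\<in>S - Z. \<exists>b0>0. \<exists>D\<ge>0. \<forall>b. 0 < b \<and> b < b0 \<longrightarrow>
        emeasure \<rho> (S \<inter> cball y b) \<le> ennreal (D * b powr s)"
        by (rule transports_decay[where u = u and K = K and \<nu> = \<nu> and ?r1.0 = r and \<eta> = \<eta> and \<kappa> = \<kappa> and N = N and c = c])
          (use Q S s\<rho> fin\<rho> \<kappa> N \<eta> s in \<open>auto simp: Q_def c_def n_def w_def\<close>)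
      then show ?thesis using that by blast
    qed
    \<comment> \<open>\<open>mass_distribution\<close> needs constants uniform in the point; these
      sets exhaust the points of decay by countably many uniform choices.\<close>
    define G where "G k = {y \<in> S. \<forall>b. 0 < b \<and> b < 1 / real (Suc k) \<longrightarrow>
       emeasure \<rho> (S \<inter> cball y b) \<le> ennreal (real k * b powr s)}" for k
    have "\<exists>Z\<in>null_sets \<rho>. G k \<inter> \<phi> ` B \<subseteq> Z" for k
      by (rule mass_distribution[OF \<phi> s\<rho>(1) S(1) _ s(1) _ _ _ s(2), of "G k" "1 / real (Suc k)" "real k"])
        (auto simp: G_def)
    then obtain Z where Z: "\<And>k. Z k \<in> null_sets \<rho>" "\<And>k. G k \<inter> \<phi> ` B \<subseteq> Z k" by metis
    define W where "W = Z0 \<union> (\<Union>k. Z k)"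
    have W: "W \<in> null_sets \<rho>" unfolding W_def using Z0(1) Z(1) by auto
    have "S \<inter> \<phi> ` B \<subseteq> W"
    proof
      fix y assume y: "y \<in> S \<inter> \<phi> ` B"
      show "y \<in> W"
      proof (cases "y \<in> Z0")
        case False
        then obtain b0 D where bD: "b0 > 0" "D \<ge> 0" "\<And>b. 0 < b \<Longrightarrow> b < b0 \<Longrightarrow>
            emeasure \<rho> (S \<inter> cball y b) \<le> ennreal (D * b powr s)" using Z0(2)[of y] y by blast
        obtain k1 where k1: "1 / real (Suc k1) < b0" using nat_approx_posE[OF bD(1)] by blast
        obtain k2 where k2: "D < real k2" using reals_Archimedean2 by blast
        define k where "k = max k1 k2"
        have "1 / real (Suc k) \<le> 1 / real (Suc k1)" by (intro divide_left_mono) (auto simp: k_def)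
        then have kb: "1 / real (Suc k) < b0" using k1 by linarith
        have "emeasure \<rho> (S \<inter> cball y b) \<le> ennreal (real k * b powr s)" if b: "0 < b" "b < 1 / real (Suc k)" for b
        proof -
          have "D * b powr s \<le> real k * b powr s" using k2 by (intro mult_right_mono) (auto simp: k_def)
          then show ?thesis using bD(3)[of b] b kb by (auto intro: order_trans ennreal_leI)
        qed
        then have "y \<in> G k" using y by (simp add: G_def)
        then show ?thesis using Z(2)[of k] y by (auto simp: W_def)
      qed (auto simp: W_def)
    qed
    \<comment> \<open>\<open>\<rho>\<close> lives on the image of \<open>B'\<close>, and
      \<open>B'\<close> is contained in \<open>B\<close>; so the part of \<open>S\<close> that it
      sees lies in the null set \<open>W\<close>, although \<open>S\<close> has positive
      mass.\<close>
    then have "B' \<inter> \<phi> -` S \<subseteq> B' \<inter> \<phi> -` W" using B'(2) by auto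
    then have "emeasure \<rho> S \<le> emeasure \<rho> W"
      using S(1) W B'(1) pre s\<rho> by (subst (1 2) \<rho>) (auto simp: null_sets_def intro!: emeasure_mono)
    then show False using W S(2) by (auto simp: null_sets_def)
  qed
  then show ?thesis
    unfolding lower_hausdorff_dim_def hausdorff_dim_def
    by (intro INF_greatest) (auto simp: not_less[symmetric])
qed

end
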